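(* Consider a less-noisy discrete memoryless broadcast channel (DMBC) with channel law $P_{Y_1Y_2|X}$ and rate-limited feedback of rate $R_{\mathrm{FB}}\ge 0$ from Receiver 1. The feedback capacity region $\mathcal{C}_{\mathrm{FB}}(R_{\mathrm{FB}})$ includes the set $\mathcal{R}_{\mathrm{in},1}$ of all nonnegative rate pairs $(R_1,R_2)$ that satisfy $$R_1\le I(U;Y_1|Q),$$ $$R_1\le I(U;Y_2|Q)-I(\tilde Y;Y_1|U,Y_2,Q),$$ $$R_2\le I(X;\tilde Y,Y_2|U,Q)$$ for some probability mass function of the form $P_Q P_{U|Q}P_{X|UQ}P_{Y_1Y_2|X}P_{\tilde Y|UY_1Q}$ (joint pmf of $(Q,U,X,Y_1,Y_2,\tilde Y)$, where $Q,U,\tilde Y$ are auxiliary random variables with finite alphabets) satisfying $$I(\tilde Y;Y_1|U,Y_2,Q)\le R_{\mathrm{FB}}.$$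
   Context: All logarithms are base 2. A discrete memoryless broadcast channel (DMBC) is given by a finite input alphabet $\mathcal X$, finite output alphabets $\mathcal Y_1,\mathcal Y_2$ and a channel law $P_{Y_1Y_2|X}$: if at time $t$ the transmitter sends $x_t\in\mathcal X$, then, independently of the past given $x_t$, Receiver $i\in\{1,2\}$ observes $Y_{i,t}\in\mathcal Y_i$ with $(Y_{1,t},Y_{2,t})\sim P_{Y_1Y_2|X}(\cdot,\cdot|x_t)$. Rate-limited feedback from Receiver 1: there is a nonnegative feedback rate $R_{\mathrm{FB}}$. For blocklength $N$, after observing $Y_{1,t}$, Receiver 1 sends a symbol $V_t=\psi_t^{(N)}(Y_{1,1},\dots,Y_{1,t})\in\mathcal V_t$ to the transmitter over a noiseless instantaneous link, where the finite alphabets $\mathcal V_1,\dots,\mathcal V_N$ are design parameters subject to $|\mathcal V_1|\cdots|\mathcal V_N|\le 2^{NR_{\mathrm{FB}}}$. Independent messages $M_i$ are uniform on $\mathcal M_i=\{1,\dots,\lfloor 2^{NR_i}\rfloor\}$, $i=1,2$. The channel inputs are $X_t=f_t^{(N)}(M_1,M_2,V_1,\dots,V_{t-1})$ with $f_t^{(N)}:\mathcal M_1\times\mathcal M_2\times\mathcal V_1\times\cdots\times\mathcal V_{t-1}\to\mathcal X$. Receiver $i$ produces the guess $\hat M_i=\Phi_i^{(N)}(Y_{i,1},\dots,Y_{i,N})\in\mathcal M_i$. A rate pair $(R_1,R_2)$ is achievable if for every $N$ there exist encoding functions, decoding functions, feedback alphabets satisfying $|\mathcal V_1|\cdots|\mathcal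 V_N|\le 2^{NR_{\mathrm{FB}}}$, and feedback-encoding functions such that $\Pr(M_1\neq\hat M_1\text{ or }M_2\ne\hat M_2)\to0$ as $N\to\infty$. The feedback capacity region $\mathcal C_{\mathrm{FB}}(R_{\mathrm{FB}})$ is the closure of the set of achievable rate pairs. The DMBC is less-noisy if $I(U;Y_2)\ge I(U;Y_1)$ holds for every pmf of the form $P_{UX}P_{Y_1Y_2|X}$ (with $U$ an auxiliary random variable on a finite alphabet). *)

theory Defs
  imports "HOL-Probability.Probability" "HOL-Library.Monad_Syntax"
begin

section \<open>Mutual information of discrete random variables, in bits\<close>

text \<open>
  The library's (conditional) mutual information, instantiated at the probability space
  given by a pmf, base 2 and discrete target spaces.  All uses below are at countable
  types, where the product of the discrete sigma-algebras is again discrete.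
\<close>

definition mutual_info ::
    "'o pmf \<Rightarrow> ('o \<Rightarrow> 'a) \<Rightarrow> ('o \<Rightarrow> 'b) \<Rightarrow> real" where
  "mutual_info p X Y =
     prob_space.mutual_information (measure_pmf p) 2 (count_space UNIV) (count_space UNIV) X Y"

definition cond_mutual_info ::
    "'o pmf \<Rightarrow> ('o \<Rightarrow> 'a) \<Rightarrow> ('o \<Rightarrow> 'b) \<Rightarrow> ('o \<Rightarrow> 'c) \<Rightarrow> real" where
  "cond_mutual_info p X Y Z =
     prob_space.conditional_mutual_information (measure_pmf p) 2
       (count_space UNIV) (count_space UNIV) (count_space UNIV) X Y Z"

section \<open>Broadcast channels\<close>

text \<open>Finite alphabets are finite types; a channel law is a Markov kernel.\<close>

type_synonym ('x, 'y1, 'y2) dmbc = "'x \<Rightarrow> ('y1 \<times> 'y2) pmf"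

text \<open>
  Auxiliary random variables take values in finite subsets of \<open>nat\<close>: up to relabelling,
  every finite alphabet is of this form.
\<close>

definition aux_input_joint ::
    "(nat \<times> 'x) pmf \<Rightarrow> ('x, 'y1, 'y2) dmbc \<Rightarrow> (nat \<times> 'x \<times> 'y1 \<times> 'y2) pmf" where
  "aux_input_joint P W =
     do { (u, x) \<leftarrow> P;
          (y1, y2) \<leftarrow> W x;
          return_pmf (u, x, y1, y2) }"

definition less_noisy :: "('x::finite, 'y1::finite, 'y2::finite) dmbc \<Rightarrow> bool" where
  "less_noisy W \<longleftrightarrow>
     (\<forall>P. finite (set_pmf P) \<longrightarrow>
        (let p = aux_input_joint P W;
             U = (\<lambda>(u, x, y1, y2). u);
             Y1 = (\<lambda>(u, x, y1, y2). y1);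
             Y2 = (\<lambda>(u, x, y1, y2). y2)
         in mutual_info p U Y2 \<ge> mutual_info p U Y1))"

section \<open>Codes with rate-limited feedback from Receiver 1\<close>

definition num_msgs :: "nat \<Rightarrow> real \<Rightarrow> nat" where
  "num_msgs N R = nat \<lfloor>2 powr (real N * R)\<rfloor>"

text \<open>
  Time indices start at 1.  \<open>fb_enc c t\<close> is applied to the list of Receiver 1's outputs at
  times \<open>1, \<dots>, t\<close>, and \<open>enc c t\<close> to the two messages and the list of feedback symbols
  of times \<open>1, \<dots>, t - 1\<close>.
\<close>

record ('x, 'y1, 'y2) fb_code =
  fb_alphabet :: "nat \<Rightarrow> nat set"
  fb_enc :: "nat \<Rightarrow> 'y1 list \<Rightarrow> nat"
  enc :: "nat \<Rightarrow> nat \<Rightarrow> nat \<Rightarrow> nat list \<Rightarrow> 'x"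
  dec1 :: "'y1 list \<Rightarrow> nat"
  dec2 :: "'y2 list \<Rightarrow> nat"

definition valid_code ::
    "nat \<Rightarrow> real \<Rightarrow> real \<Rightarrow> real \<Rightarrow> ('x, 'y1, 'y2) fb_code \<Rightarrow> bool" where
  "valid_code N RFB R1 R2 c \<longleftrightarrow>
     (\<forall>t\<in>{1..N}. finite (fb_alphabet c t)) \<and>
     real (\<Prod>t=1..N. card (fb_alphabet c t)) \<le> 2 powr (real N * RFB) \<and>
     (\<forall>t\<in>{1..N}. \<forall>ys. length ys = t \<longrightarrow> fb_enc c t ys \<in> fb_alphabet c t) \<and>
     (\<forall>ys. length ys = N \<longrightarrow> dec1 c ys \<in> {1..num_msgs N R1}) \<and>
     (\<forall>ys. length ys = N \<longrightarrow> dec2 c ys \<in> {1..num_msgs N R2})"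

text \<open>Distribution of the outputs at times \<open>1, \<dots>, n\<close> given the messages \<open>m1\<close>, \<open>m2\<close>.\<close>

primrec transmit ::
    "('x, 'y1, 'y2) dmbc \<Rightarrow> ('x, 'y1, 'y2) fb_code \<Rightarrow> nat \<Rightarrow> nat \<Rightarrow> nat \<Rightarrow>
     ('y1 \<times> 'y2) list pmf" where
  "transmit W c m1 m2 0 = return_pmf []"
| "transmit W c m1 m2 (Suc n) =
     do { ys \<leftarrow> transmit W c m1 m2 n;
          let vs = map (\<lambda>s. fb_enc c s (map fst (take s ys))) [1..<Suc n];
          y \<leftarrow> W (enc c (Suc n) m1 m2 vs);
          return_pmf (ys @ [y]) }"

definition error_prob ::
    "('x, 'y1, 'y2) dmbc \<Rightarrow> nat \<Rightarrow> real \<Rightarrow> real \<Rightarrow> ('x, 'y1, 'y2) fb_code \<Rightarrow> real" where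
  "error_prob W N R1 R2 c =
     measure_pmf.prob
       (do { (m1, m2) \<leftarrow> pair_pmf (pmf_of_set {1..num_msgs N R1}) (pmf_of_set {1..num_msgs N R2});
             ys \<leftarrow> transmit W c m1 m2 N;
             return_pmf (m1, m2, ys) })
       {(m1, m2, ys). dec1 c (map fst ys) \<noteq> m1 \<or> dec2 c (map snd ys) \<noteq> m2}"

text \<open>Rates are nonnegative, so that the message sets are nonempty.\<close>

definition achievable ::
    "('x, 'y1, 'y2) dmbc \<Rightarrow> real \<Rightarrow> real \<times> real \<Rightarrow> bool" where
  "achievable W RFB R \<longleftrightarrow>
     0 \<le> fst R \<and> 0 \<le> snd R \<and>
     (\<exists>c. (\<forall>N\<ge>1. valid_code N RFB (fst R) (snd R) (c N)) \<and>
          (\<lambda>N. error_prob W N (fst R) (snd R) (c N)) \<longlonglongrightarrow> 0)"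

definition fb_capacity_region ::
    "('x::finite, 'y1::finite, 'y2::finite) dmbc \<Rightarrow> real \<Rightarrow> (real \<times> real) set" where
  "fb_capacity_region W RFB = closure {R. achievable W RFB R}"

section \<open>The inner bound\<close>

text \<open>
  The joint pmf of \<open>(Q, U, X, Y\<^sub>1, Y\<^sub>2, T)\<close>, where \<open>T\<close> is the variable usually
  written \<open>Y\<close> with a tilde, a description of \<open>Y\<^sub>1\<close> given \<open>U\<close> and \<open>Q\<close>.
\<close>

definition aux_joint ::
    "('x, 'y1, 'y2) dmbc \<Rightarrow> nat pmf \<Rightarrow> (nat \<Rightarrow> nat pmf) \<Rightarrow> (nat \<Rightarrow> nat \<Rightarrow> 'x pmf) \<Rightarrow>
     (nat \<Rightarrow> 'y1 \<Rightarrow> nat \<Rightarrow> nat pmf) \<Rightarrow> (nat \<times> nat \<times> 'x \<times> 'y1 \<times> 'y2 \<times> nat) pmf" where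
  "aux_joint W PQ PU PX PT =
     do { q \<leftarrow> PQ;
          u \<leftarrow> PU q;
          x \<leftarrow> PX u q;
          (y1, y2) \<leftarrow> W x;
          t \<leftarrow> PT u y1 q;
          return_pmf (q, u, x, y1, y2, t) }"

text \<open>
  Finiteness of the support of the joint pmf says exactly that \<open>Q\<close>, \<open>U\<close>, \<open>T\<close> live on finite
  alphabets; the values of the kernels at conditions of probability zero are irrelevant.
\<close>

definition inner_region ::
    "('x::finite, 'y1::finite, 'y2::finite) dmbc \<Rightarrow> real \<Rightarrow> (real \<times> real) set" where
  "inner_region W RFB =
     {(R1, R2). 0 \<le> R1 \<and> 0 \<le> R2 \<and>
        (\<exists>PQ PU PX PT.
           let p = aux_joint W PQ PU PX PT;
               Q = (\<lambda>(q, u, x, y1, y2, t). q);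
               U = (\<lambda>(q, u, x, y1, y2, t). u);
               X = (\<lambda>(q, u, x, y1, y2, t). x);
               Y1 = (\<lambda>(q, u, x, y1, y2, t). y1);
               Y2 = (\<lambda>(q, u, x, y1, y2, t). y2);
               T = (\<lambda>(q, u, x, y1, y2, t). t);
               UQ = (\<lambda>\<omega>. (U \<omega>, Q \<omega>));
               TY2 = (\<lambda>\<omega>. (T \<omega>, Y2 \<omega>));
               UY2Q = (\<lambda>\<omega>. (U \<omega>, Y2 \<omega>, Q \<omega>))
           in finite (set_pmf p) \<and>
              R1 \<le> cond_mutual_info p U Y1 Q \<and>
              R1 \<le> cond_mutual_info p U Y2 Q - cond_mutual_info p T Y1 UY2Q \<and>
              R2 \<le> cond_mutual_info p X TY2 UQ \<and>
              cond_mutual_info p T Y1 UY2Q \<le> RFB)}"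

end

theory Submission
  imports Defs "HOL-Real_Asymp.Real_Asymp"
begin

text \<open>
  Block-Markov coding. In each block the transmitter sends a cloud codeword carrying a part of
  message 1 together with a bin index describing what Receiver 1 observed in the previous block,
  and a satellite codeword carrying a part of message 2. The description of \<open>Y\<^sub>1\<close> is a codeword for
  \<open>T\<close>, binned as in Wyner-Ziv coding; its bin index is the only feedback, sent at the end of the
  block. Receiver 1 knows the bin index, so it only needs \<open>R\<^sub>1 < I(U;Y\<^sub>1|Q)\<close>; Receiver 2 decodes the whole
  cloud, recovers \<open>T\<close> with its outputs of the previous block as side information, and then decodes the
  satellite from \<open>(T, Y\<^sub>2)\<close>.

  A single block is analysed by a one-shot random coding bound in which the tests are arbitrary
  events; for products of letters the tests are thresholds on likelihood ratios, and a Chernoff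
  bound replaces typicality. Boundary points are reached by erasing \<open>T\<close> on a small fraction of the
  letters. If \<open>I(T;Y\<^sub>1|U,Y\<^sub>2,Q) = 0\<close>, no slack can be gained in this way (the feedback rate may be 0), but
  then \<open>T\<close> is useless and is erased completely.
\<close>

section \<open>Integration over probability mass functions\<close>

text \<open>The feedback rate comes from two opposing demands on a codebook of \<open>L\<close>
  descriptions in \<open>K\<close> bins. Covering needs log \<open>L\<close> slightly above n
  I(T;Y1|U,Q); decoding inside a bin needs log (\<open>L\<close> / \<open>K\<close>) slightly below
  n I(T;Y2|U,Q). As T depends on X and Y2 only through U, Q and Y1, the difference of the two
  informations is I(T;Y1|U,Y2,Q). The proof works with this difference,
  \<open>info r5 - info r3\<close>, and identifies it with the conditional information only at the
  end.

  The number \<open>B\<close> of blocks that carry messages is fixed before the block size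
  \<open>n\<close> grows. One more block delivers the last bin index, so rates shrink by
  \<open>B\<close> / (\<open>B\<close> + 1); a strict inequality absorbs this, and the union bound
  over blocks costs a constant factor.

  The closure in the capacity region permits a loss in \<open>R1\<close> and \<open>R2\<close>, but
  not in the feedback budget. A margin there is gained by describing less, hence the erasures; their
  cost to Receiver 2 is proportional to their fraction and vanishes with it.\<close>

lemma nn_integral_pmf_mono:
  fixes f g :: "'a \<Rightarrow> ennreal"
  assumes "\<And>x. x \<in> set_pmf p \<Longrightarrow> f x \<le> g x"
  shows "(\<integral>\<^sup>+x. f x \<partial>measure_pmf p) \<le> (\<integral>\<^sup>+x. g x \<partial>measure_pmf p)"
  by (rule nn_integral_mono_AE) (use assms in \<open>auto simp: AE_measure_pmf_iff\<close>)

lemma nn_integral_pmf_cong: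
  fixes f g :: "'a \<Rightarrow> ennreal"
  assumes "\<And>x. x \<in> set_pmf p \<Longrightarrow> f x = g x"
  shows "(\<integral>\<^sup>+x. f x \<partial>measure_pmf p) = (\<integral>\<^sup>+x. g x \<partial>measure_pmf p)"
  by (rule nn_integral_cong_AE) (use assms in \<open>auto simp: AE_measure_pmf_iff\<close>)

lemma nn_integral_pmf_const [simp]: "(\<integral>\<^sup>+x. c \<partial>measure_pmf p) = (c::ennreal)"
  by (simp add: measure_pmf.emeasure_space_1)

lemma nn_integral_pmf_le_const:
  fixes f :: "'a \<Rightarrow> ennreal"
  assumes "\<And>x. x \<in> set_pmf p \<Longrightarrow> f x \<le> c"
  shows "(\<integral>\<^sup>+x. f x \<partial>measure_pmf p) \<le> c"
  using nn_integral_pmf_mono[of p f "\<lambda>_. c"] assms by simp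

text \<open>Tonelli without measurability side conditions: both sides integrate one function over
  pairs drawn in the two possible orders, which \<open>bind_commute_pmf\<close> identifies.\<close>

lemma nn_integral_pmf_swap:
  fixes f :: "'a \<Rightarrow> 'b \<Rightarrow> ennreal"
  shows "(\<integral>\<^sup>+x. \<integral>\<^sup>+y. f x y \<partial>measure_pmf q \<partial>measure_pmf p) =
         (\<integral>\<^sup>+y. \<integral>\<^sup>+x. f x y \<partial>measure_pmf p \<partial>measure_pmf q)"
proof -
  have "(\<integral>\<^sup>+z. (case z of (x, y) \<Rightarrow> f x y) \<partial>bind_pmf p (\<lambda>x. bind_pmf q (\<lambda>y. return_pmf (x, y)))) =
        (\<integral>\<^sup>+z. (case z of (x, y) \<Rightarrow> f x y) \<partial>bind_pmf q (\<lambda>y. bind_pmf p (\<lambda>x. return_pmf (x, y))))"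
    by (subst bind_commute_pmf) simp
  then show ?thesis by simp
qed

text \<open>Random choices are fixed with this: some outcome in the support does no worse than the
  mean. Were all values larger, the mean would be finite and strictly below itself.\<close>

lemma exists_le_nn_integral_pmf:
  fixes f :: "'a \<Rightarrow> ennreal"
  shows "\<exists>x\<in>set_pmf p. f x \<le> (\<integral>\<^sup>+x. f x \<partial>measure_pmf p)"
proof (rule ccontr)
  let ?I = "\<integral>\<^sup>+x. f x \<partial>measure_pmf p"
  assume "\<not> ?thesis"
  then have less: "\<And>x. x \<in> set_pmf p \<Longrightarrow> ?I < f x" by (auto simp: not_le)
  obtain x where "x \<in> set_pmf p" using set_pmf_not_empty by fast
  with less have fin: "?I < \<top>" using less_top_ennreal order_less_le_trans top_greatest by blast
  have "?I \<le> 0 \<or> ?I < ?I"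
  proof -
    have "(\<integral>\<^sup>+x. ?I \<partial>measure_pmf p) < ?I"
    proof (rule nn_integral_less)
      show "(\<lambda>x. ?I) \<in> borel_measurable (measure_pmf p)" "f \<in> borel_measurable (measure_pmf p)" by auto
      show "(\<integral>\<^sup>+x. ?I \<partial>measure_pmf p) \<noteq> \<infinity>" using fin by simp
      show "AE x in measure_pmf p. ?I \<le> f x" using less by (auto simp: AE_measure_pmf_iff intro: less_imp_le)
      show "\<not> (AE x in measure_pmf p. f x \<le> ?I)"
        using less \<open>x \<in> set_pmf p\<close> by (auto simp: AE_measure_pmf_iff not_le)
    qed
    then show ?thesis by simp
  qed
  then have "?I = 0" by simp
  then have "f x = 0" using \<open>x \<in> set_pmf p\<close>
    by (simp add: nn_integral_0_iff_AE AE_measure_pmf_iff)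
  then show False using less[OF \<open>x \<in> set_pmf p\<close>] by simp
qed

lemma nn_integral_of_bool_pmf:
  "(\<integral>\<^sup>+x. of_bool (P x) \<partial>measure_pmf p) = ennreal (measure_pmf.prob p {x. P x})"
proof -
  have "(\<integral>\<^sup>+x. of_bool (P x) \<partial>measure_pmf p) = (\<integral>\<^sup>+x. indicator {x. P x} x \<partial>measure_pmf p)"
    by (intro nn_integral_cong) (auto simp: indicator_def)
  then show ?thesis by (simp add: measure_pmf.emeasure_eq_measure)
qed

lemma of_bool_ennreal_disj_le: "(of_bool (P \<or> Q) :: ennreal) \<le> of_bool P + of_bool Q"
  by (auto simp: of_bool_def)

lemma of_bool_ennreal_bex_le:
  assumes "finite S"
  shows "(of_bool (\<exists>a\<in>S. P a) :: ennreal) \<le> (\<Sum>a\<in>S. of_bool (P a))"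
proof (cases "\<exists>a\<in>S. P a")
  case True
  then obtain a where "a \<in> S" "P a" by blast
  then have "(1::ennreal) \<le> (\<Sum>a\<in>S. of_bool (P a))"
    using assms member_le_sum[of a S "\<lambda>a. of_bool (P a) :: ennreal"] by auto
  then show ?thesis using True by simp
qed auto

lemma nn_integral_Pi_pmf_component:
  fixes f :: "'b \<Rightarrow> ennreal"
  assumes "finite A" "i \<in> A"
  shows "(\<integral>\<^sup>+C. f (C i) \<partial>measure_pmf (Pi_pmf A d p)) = (\<integral>\<^sup>+x. f x \<partial>measure_pmf (p i))"
proof -
  have "(\<integral>\<^sup>+x. f x \<partial>measure_pmf (map_pmf (\<lambda>C. C i) (Pi_pmf A d p))) = (\<integral>\<^sup>+x. f x \<partial>measure_pmf (p i))"
    using assms by (subst Pi_pmf_component) auto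
  then show ?thesis by simp
qed

lemma nn_integral_Pi_pmf_components:
  fixes f :: "'b \<Rightarrow> 'b \<Rightarrow> ennreal"
  assumes "finite A" "i \<in> A" "j \<in> A" "i \<noteq> j"
  shows "(\<integral>\<^sup>+C. f (C i) (C j) \<partial>measure_pmf (Pi_pmf A d p)) =
         (\<integral>\<^sup>+x. \<integral>\<^sup>+y. f x y \<partial>measure_pmf (p j) \<partial>measure_pmf (p i))"
proof -
  have "Pi_pmf A d p = Pi_pmf (insert i (A - {i})) d p"
    using assms by (simp add: insert_absorb)
  also have "\<dots> = p i \<bind> (\<lambda>x. Pi_pmf (A - {i}) d p \<bind> (\<lambda>C. return_pmf (C(i := x))))"
    using assms by (subst Pi_pmf_insert') auto
  finally have *: "Pi_pmf A d p = p i \<bind> (\<lambda>x. Pi_pmf (A - {i}) d p \<bind> (\<lambda>C. return_pmf (C(i := x))))" .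
  show ?thesis unfolding *
    using assms by (simp add: nn_integral_Pi_pmf_component)
qed

text \<open>Disintegration: drawing the value of \<open>f\<close> and then a point of its fibre
  recovers \<open>p\<close>. It serves to condition on what Receiver 1 observes.\<close>

lemma bind_map_cond_pmf:
  "map_pmf f p \<bind> (\<lambda>y. cond_pmf p {x. f x = y}) = p"
proof -
  have "map_pmf f p \<bind> (\<lambda>y. cond_pmf p {x. y = f x}) = p"
    by (rule bind_cond_pmf_cancel)
      (auto simp: measure_map_pmf vimage_def eq_commute intro!: arg_cong2[where f=measure])
  then show ?thesis by (simp add: eq_commute)
qed

text \<open>Jensen's inequality for the power \<open>L\<close> at the mixture of 1 and
  \<open>w\<close> with weights \<open>1 - z\<close> and \<open>z\<close>.\<close>

lemma power_convex_bound:
  fixes z w :: real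
  assumes "0 \<le> z" "z \<le> 1" "0 \<le> w" "w \<le> 1"
  shows "(1 - z + z * w) ^ L \<le> 1 - z + z * w ^ L"
proof (induction L)
  case (Suc L)
  have "(1 - z + z * w) ^ Suc L \<le> (1 - z + z * w) * (1 - z + z * w ^ L)"
    using Suc assms by (simp add: mult_left_mono)
  also have "\<dots> = 1 - z + z * w ^ Suc L - (1 - z) * z * (1 - w) * (1 - w ^ L)"
    by (simp add: algebra_simps)
  also have "\<dots> \<le> 1 - z + z * w ^ Suc L"
    using assms power_le_one[of w L] by simp
  finally show ?case .
qed simp

section \<open>One-shot coding for a single block\<close>

text \<open>
  In \<open>word i k j\<close>, the cloud index consists of a part \<open>i\<close> of message 1 and the index \<open>k\<close> by which
  Receiver 1 describes its outputs in the previous block; the satellite index \<open>j\<close> is a part of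
  message 2. Receiver 1 knows \<open>k\<close>, while Receiver 2 decodes \<open>(i, k)\<close> and, one block later, uses the
  next bin index to decode \<open>j\<close>.
\<close>

record ('x, 'y1, 'y2) block_code =
  word :: "nat \<Rightarrow> nat \<Rightarrow> nat \<Rightarrow> 'x"
  bin_idx :: "nat \<Rightarrow> nat \<Rightarrow> 'y1 \<Rightarrow> nat"
  own_dec :: "nat \<Rightarrow> 'y1 \<Rightarrow> nat"
  cloud_dec :: "'y2 \<Rightarrow> nat \<times> nat"
  sat_dec :: "nat \<Rightarrow> nat \<Rightarrow> nat \<Rightarrow> 'y2 \<Rightarrow> nat"

text \<open>\<open>sat_dec\<close> is judged with the true cloud and the true bin index. The real
  decoder takes them from \<open>cloud_dec\<close> of this block and of the next one, so a wrong
  input is already charged to one of these blocks.\<close>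

definition block_err :: "('x, 'y1, 'y2) block_code \<Rightarrow> nat \<Rightarrow> nat \<Rightarrow> nat \<Rightarrow> 'y1 \<Rightarrow> 'y2 \<Rightarrow> bool" where
  "block_err c i k j y1 y2 \<longleftrightarrow>
     own_dec c k y1 \<noteq> i \<or> cloud_dec c y2 \<noteq> (i, k) \<or> sat_dec c i k (bin_idx c i k y1) y2 \<noteq> j"

text \<open>
  \<open>A1\<close> to \<open>A4\<close> are the tests by which the receivers recognise a codeword, and \<open>q1\<close> to \<open>q4\<close> bound the
  probability that an independently drawn codeword passes. The codebook for the descriptions is
  drawn from \<open>PTU\<close>, which need not be the marginal of \<open>PT\<close>.
\<close>

locale one_shot =
  fixes PU :: "'u pmf" and PX :: "'u \<Rightarrow> 'x pmf" and V :: "'x \<Rightarrow> 'y pmf"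
    and f1 :: "'y \<Rightarrow> 'y1" and f2 :: "'y \<Rightarrow> 'y2"
    and PT :: "'u \<Rightarrow> 'y1 \<Rightarrow> 't pmf" and PTU :: "'u \<Rightarrow> 't pmf"
    and A1 :: "'u \<Rightarrow> 'y1 \<Rightarrow> bool" and A2 :: "'u \<Rightarrow> 'y2 \<Rightarrow> bool"
    and A3 :: "'u \<Rightarrow> 't \<Rightarrow> 'y2 \<Rightarrow> bool" and A4 :: "'u \<Rightarrow> 'x \<Rightarrow> 't \<Rightarrow> 'y2 \<Rightarrow> bool"
    and q1 q2 q3 q4 \<theta> \<gamma> :: real and M1 K L M2 :: nat
  assumes pos: "M1 > 0" "K > 0" "L > 0" "M2 > 0" "\<gamma> > 0" "\<theta> \<ge> 1"
    "0 \<le> q1" "0 \<le> q2" "0 \<le> q3" "0 \<le> q4"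
    and packing1: "\<And>y. (\<integral>\<^sup>+u. of_bool (A1 u y) \<partial>PU) \<le> ennreal q1"
    and packing2: "\<And>y. (\<integral>\<^sup>+u. of_bool (A2 u y) \<partial>PU) \<le> ennreal q2"
    and packing3: "\<And>u y. (\<integral>\<^sup>+t. of_bool (A3 u t y) \<partial>PTU u) \<le> ennreal q3"
    and packing4: "\<And>u t y. (\<integral>\<^sup>+x. of_bool (A4 u x t y) \<partial>PX u) \<le> ennreal q4"
begin

section \<open>The random code of one block and its error events\<close>

definition J :: "'u \<Rightarrow> ('x \<times> 'y) pmf" where
  "J u = PX u \<bind> (\<lambda>x. map_pmf (Pair x) (V x))"

definition JY :: "'u \<Rightarrow> 'y1 pmf" where "JY u = map_pmf (\<lambda>w. f1 (snd w)) (J u)"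

definition JC :: "'u \<Rightarrow> 'y1 \<Rightarrow> ('x \<times> 'y) pmf" where
  "JC u y1 = cond_pmf (J u) {w. f1 (snd w) = y1}"

lemma JC_eq: "w \<in> set_pmf (JC u y1) \<Longrightarrow> y1 \<in> set_pmf (JY u) \<Longrightarrow> f1 (snd w) = y1"
  unfolding JC_def JY_def by (subst (asm) set_cond_pmf) auto

lemma disintegrate: "JY u \<bind> JC u = J u"
  unfolding JY_def JC_def by (rule bind_map_cond_pmf)

definition bad :: "'u \<Rightarrow> 't \<Rightarrow> 'x \<times> 'y \<Rightarrow> bool" where
  "bad u t w \<longleftrightarrow> \<not> A3 u t (f2 (snd w)) \<or> \<not> A4 u (fst w) t (f2 (snd w))"

text \<open>
  Receiver 1 picks any description under which Receiver 2 is unlikely to fail, given \<open>u\<close> and \<open>y1\<close>.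
  As the description codebook is independent of the input and of \<open>y2\<close> given these two, this takes the
  place of a Markov lemma for typical sequences.
\<close>

definition G :: "'u \<Rightarrow> 'y1 \<Rightarrow> 't \<Rightarrow> bool" where
  "G u y1 t \<longleftrightarrow> (\<integral>\<^sup>+w. of_bool (bad u t w) \<partial>JC u y1) \<le> ennreal \<gamma>"

text \<open>The fallback 0 is a legal index because \<open>L > 0\<close>; hence
  \<open>sel_less\<close> holds even when no description is acceptable.\<close>

definition sel :: "'u \<Rightarrow> 'y1 \<Rightarrow> (nat \<Rightarrow> 't) \<Rightarrow> nat" where
  "sel u y1 ts = (if \<exists>l<L. G u y1 (ts l) then SOME l. l < L \<and> G u y1 (ts l) else 0)"

lemma sel_less: "sel u y1 ts < L"
  and sel_G: "\<exists>l<L. G u y1 (ts l) \<Longrightarrow> G u y1 (ts (sel u y1 ts))"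
  using someI_ex[of "\<lambda>l. l < L \<and> G u y1 (ts l)"] pos unfolding sel_def by auto

type_synonym ('uu, 'xx, 'tt) row = "'uu \<times> (nat \<Rightarrow> 'xx) \<times> (nat \<Rightarrow> 'tt)"

text \<open>Superposition coding: each cloud word owns a satellite codebook and a description
  codebook. Given the cloud word these two are independent, which the packing bounds
  exploit.\<close>

definition row_pmf :: "('u, 'x, 't) row pmf" where
  "row_pmf = PU \<bind> (\<lambda>u. Pi_pmf {..<M2} undefined (\<lambda>_. PX u) \<bind> (\<lambda>xs.
     Pi_pmf {..<L} undefined (\<lambda>_. PTU u) \<bind> (\<lambda>ts. return_pmf (u, xs, ts))))"

text \<open>The binning \<open>bn\<close> is an argument of its own because it is drawn
  independently of the codebook and shared by all rows. \<open>sat_dec\<close> works in two stages: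
  first the description inside the given bin, then the satellite word.\<close>

definition code :: "(nat \<times> nat \<Rightarrow> ('u, 'x, 't) row) \<Rightarrow> (nat \<Rightarrow> nat) \<Rightarrow> ('x, 'y1, 'y2) block_code" where
  "code C bn = \<lparr>
     word = \<lambda>i k j. fst (snd (C (i, k))) j,
     bin_idx = \<lambda>i k y1. bn (sel (fst (C (i, k))) y1 (snd (snd (C (i, k))))),
     own_dec = \<lambda>k y1. SOME i. i < M1 \<and> A1 (fst (C (i, k))) y1,
     cloud_dec = \<lambda>y2. SOME a. a \<in> {..<M1} \<times> {..<K} \<and> A2 (fst (C a)) y2,
     sat_dec = \<lambda>i k \<kappa> y2. (let l = SOME l. l < L \<and> bn l = \<kappa> \<and> A3 (fst (C (i, k))) (snd (snd (C (i, k))) l) y2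
        in SOME j. j < M2 \<and> A4 (fst (C (i, k))) (fst (snd (C (i, k))) j) (snd (snd (C (i, k))) l) y2)\<rparr>"

text \<open>If none of the eight events occurs, every \<open>SOME\<close> in \<open>code\<close> has
  the true index as its only candidate. The events are the summands of the union bound in
  \<open>expected_block_err\<close>.\<close>

lemma block_err_cases:
  fixes C bn i k and y :: 'y and j :: nat
  defines "u \<equiv> fst (C (i, k))" and "xs \<equiv> fst (snd (C (i, k)))" and "ts \<equiv> snd (snd (C (i, k)))"
  defines "l \<equiv> sel u (f1 y) ts"
  assumes "block_err (code C bn) i k j (f1 y) (f2 y)" "i < M1" "k < K" "j < M2"
  shows "\<not> A1 u (f1 y) \<or> \<not> A2 u (f2 y) \<or>
    (\<exists>a\<in>{..<M1} \<times> {k} - {(i, k)}. A1 (fst (C a)) (f1 y)) \<or>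
    (\<exists>a\<in>{..<M1} \<times> {..<K} - {(i, k)}. A2 (fst (C a)) (f2 y)) \<or>
    (\<forall>l\<in>{..<L}. \<not> G u (f1 y) (ts l)) \<or>
    (G u (f1 y) (ts l) \<and> bad u (ts l) (xs j, y)) \<or>
    (\<exists>l'\<in>{..<L}. l' \<noteq> l \<and> bn l' = bn l \<and> A3 u (ts l') (f2 y)) \<or>
    (\<exists>j'\<in>{..<M2} - {j}. A4 u (xs j') (ts l) (f2 y))"
proof (rule ccontr)
  assume neg: "\<not> ?thesis"
  then have A: "A1 u (f1 y)" "A2 u (f2 y)" by auto
  have "own_dec (code C bn) k (f1 y) = i"
    unfolding code_def
    by simp (rule some_equality, use neg assms(6,7) A in \<open>auto simp: u_def\<close>)
  moreover have "cloud_dec (code C bn) (f2 y) = (i, k)"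
    unfolding code_def
    by simp (rule some_equality, use neg assms(6,7) A in \<open>auto simp: u_def\<close>)
  moreover have "sat_dec (code C bn) i k (bin_idx (code C bn) i k (f1 y)) (f2 y) = j"
  proof -
    have "l < L" unfolding l_def by (rule sel_less)
    have "G u (f1 y) (ts l)" using neg sel_G[of u "f1 y" ts] unfolding l_def by blast
    then have nb: "A3 u (ts l) (f2 y)" "A4 u (xs j) (ts l) (f2 y)"
      using neg unfolding bad_def by auto
    have 1: "(SOME l'. l' < L \<and> bn l' = bn l \<and> A3 u (ts l') (f2 y)) = l"
      by (rule some_equality) (use nb \<open>l < L\<close> neg in auto)
    have 2: "(SOME j'. j' < M2 \<and> A4 u (xs j') (ts l) (f2 y)) = j"
      by (rule some_equality) (use nb \<open>j < M2\<close> neg in auto)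
    show ?thesis
      using 1 2 unfolding code_def by (simp add: u_def xs_def ts_def l_def Let_def)
  qed
  ultimately show False using assms(5) unfolding block_err_def by auto
qed

lemma nn_integral_row:
  "(\<integral>\<^sup>+r. g r \<partial>row_pmf) = (\<integral>\<^sup>+u. \<integral>\<^sup>+xs. \<integral>\<^sup>+ts. g (u, xs, ts)
     \<partial>Pi_pmf {..<L} undefined (\<lambda>_. PTU u) \<partial>Pi_pmf {..<M2} undefined (\<lambda>_. PX u) \<partial>PU)"
  unfolding row_pmf_def by simp

section \<open>Averages over the random codebook and packing bounds\<close>

abbreviation "PXs u \<equiv> Pi_pmf {..<M2} undefined (\<lambda>_. PX u)"
abbreviation "PTs u \<equiv> Pi_pmf {..<L} undefined (\<lambda>_. PTU u)"
abbreviation "PB \<equiv> Pi_pmf {..<L} 0 (\<lambda>_. pmf_of_set {..<K})"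
abbreviation "PC \<equiv> Pi_pmf ({..<M1} \<times> {..<K}) undefined (\<lambda>_. row_pmf)"

lemma nn_integral_codebook_row:
  assumes "a \<in> {..<M1} \<times> {..<K}"
  shows "(\<integral>\<^sup>+C. g (fst (C a)) (fst (snd (C a))) (snd (snd (C a))) \<partial>PC) =
    (\<integral>\<^sup>+u. \<integral>\<^sup>+xs. \<integral>\<^sup>+ts. g u xs ts \<partial>PTs u \<partial>PXs u \<partial>PU)"
proof -
  have "(\<integral>\<^sup>+C. g (fst (C a)) (fst (snd (C a))) (snd (snd (C a))) \<partial>PC) =
     (\<integral>\<^sup>+r. g (fst r) (fst (snd r)) (snd (snd r)) \<partial>row_pmf)"
    using assms by (intro nn_integral_Pi_pmf_component) auto
  then show ?thesis by (simp add: nn_integral_row)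
qed

lemma nn_integral_J: "(\<integral>\<^sup>+w. g w \<partial>J u) = (\<integral>\<^sup>+x. \<integral>\<^sup>+y. g (x, y) \<partial>V x \<partial>PX u)"
  unfolding J_def by simp

lemma nn_integral_JY: "(\<integral>\<^sup>+y1. g y1 \<partial>JY u) = (\<integral>\<^sup>+x. \<integral>\<^sup>+y. g (f1 y) \<partial>V x \<partial>PX u)"
  unfolding JY_def by (simp add: nn_integral_J)

lemma nn_integral_satellite:
  assumes "j < M2"
  shows "(\<integral>\<^sup>+xs. \<integral>\<^sup>+y. g (xs j) y \<partial>V (xs j) \<partial>PXs u) = (\<integral>\<^sup>+w. g (fst w) (snd w) \<partial>J u)"
  unfolding nn_integral_J
  using nn_integral_Pi_pmf_component[where A="{..<M2}" and i=j and f="\<lambda>x. \<integral>\<^sup>+y. g x y \<partial>V x"] assms by simp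

text \<open>Row \<open>a'\<close> is independent of row \<open>a\<close> and of the output that
  \<open>a\<close> causes, so after a swap the competitor is integrated first, for a fixed output.
  The relation \<open>R\<close> and the map \<open>f\<close> are generic to serve both
  receivers.\<close>

lemma packing_rows:
  fixes R :: "'u \<Rightarrow> 'z \<Rightarrow> bool"
  assumes "\<And>z. (\<integral>\<^sup>+u. of_bool (R u z) \<partial>PU) \<le> ennreal q"
    and "a \<in> {..<M1} \<times> {..<K}" "a' \<in> {..<M1} \<times> {..<K}" "a' \<noteq> a"
  shows "(\<integral>\<^sup>+C. \<integral>\<^sup>+y. of_bool (R (fst (C a')) (f y)) \<partial>V (fst (snd (C a)) j) \<partial>PC) \<le> ennreal q"
proof -
  have "(\<integral>\<^sup>+C. \<integral>\<^sup>+y. of_bool (R (fst (C a')) (f y)) \<partial>V (fst (snd (C a)) j) \<partial>PC) =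
     (\<integral>\<^sup>+r. \<integral>\<^sup>+r'. \<integral>\<^sup>+y. of_bool (R (fst r') (f y)) \<partial>V (fst (snd r) j) \<partial>row_pmf \<partial>row_pmf)"
    using assms nn_integral_Pi_pmf_components[where A="{..<M1} \<times> {..<K}" and i=a and j=a' and
      f="\<lambda>r r'. \<integral>\<^sup>+y. of_bool (R (fst r') (f y)) \<partial>V (fst (snd r) j)" and d=undefined and p="\<lambda>_. row_pmf"] by simp
  also have "\<dots> = (\<integral>\<^sup>+r. \<integral>\<^sup>+y. \<integral>\<^sup>+r'. of_bool (R (fst r') (f y)) \<partial>row_pmf \<partial>V (fst (snd r) j) \<partial>row_pmf)"
    by (subst nn_integral_pmf_swap) simp
  also have "\<dots> \<le> ennreal q"
    by (rule nn_integral_pmf_le_const, rule nn_integral_pmf_le_const)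
       (use assms(1) in \<open>simp add: nn_integral_row\<close>)
  finally show ?thesis .
qed

text \<open>
  The union bound runs over all fixed descriptions \<open>l'\<close>, each independent of \<open>y2\<close>; only the bin
  collision involves the selected one. For \<open>L = 1\<close> there is no competitor at all, which is what
  allows feedback rate zero.
\<close>

lemma packing_bins:
  assumes "l' < L"
  shows "(\<integral>\<^sup>+ts. \<integral>\<^sup>+bn. \<integral>\<^sup>+y. of_bool (l' \<noteq> sel u (f1 y) ts \<and> bn l' = bn (sel u (f1 y) ts) \<and> A3 u (ts l') (f2 y))
     \<partial>V x \<partial>PB \<partial>PTs u) \<le> (if L = 1 then 0 else ennreal (q3 / real K))"
proof (cases "L = 1")
  case True
  then have "l' = sel u z ts" for z ts using sel_less[of u z ts] assms by auto
  then show ?thesis by simp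
next
  case False
  \<comment> \<open>For a fixed output and fixed descriptions both indices are constants, and two
    distinct indices get independent uniform bins.\<close>
  have *: "(\<integral>\<^sup>+bn. of_bool (l' \<noteq> l \<and> bn l' = bn l \<and> A) \<partial>PB) \<le> ennreal (1 / real K) * of_bool A" 
    if "l < L" for l A
  proof (cases "l' \<noteq> l \<and> A")
    case True
    have "(\<integral>\<^sup>+bn. of_bool (l' \<noteq> l \<and> bn l' = bn l \<and> A) \<partial>PB) = (\<integral>\<^sup>+bn. of_bool (bn l' = bn l) \<partial>PB)"
      using True by simp
    also have "\<dots> = (\<integral>\<^sup>+b'. \<integral>\<^sup>+b. of_bool (b' = b) \<partial>pmf_of_set {..<K} \<partial>pmf_of_set {..<K})"
      using True that assms nn_integral_Pi_pmf_components[where A="{..<L}" and i=l' and j=l and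
        f="\<lambda>b b'. of_bool (b = b')" and d=0 and p="\<lambda>_. pmf_of_set {..<K}"] by simp
    also have "\<dots> \<le> ennreal (1 / real K)"
    proof (rule nn_integral_pmf_le_const)
      fix b assume "b \<in> set_pmf (pmf_of_set {..<K})"
      have "{b'. b = b'} = {b}" by auto
      then show "(\<integral>\<^sup>+b'. of_bool (b = b') \<partial>pmf_of_set {..<K}) \<le> ennreal (1 / real K)"
        using pos by (simp add: nn_integral_of_bool_pmf measure_pmf_single pmf_of_set lessThan_empty_iff indicator_def)
    qed
    finally show ?thesis using True by simp
  qed auto
  have "(\<integral>\<^sup>+ts. \<integral>\<^sup>+bn. \<integral>\<^sup>+y. of_bool (l' \<noteq> sel u (f1 y) ts \<and> bn l' = bn (sel u (f1 y) ts) \<and> A3 u (ts l') (f2 y))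
     \<partial>V x \<partial>PB \<partial>PTs u) =
     (\<integral>\<^sup>+ts. \<integral>\<^sup>+y. \<integral>\<^sup>+bn. of_bool (l' \<noteq> sel u (f1 y) ts \<and> bn l' = bn (sel u (f1 y) ts) \<and> A3 u (ts l') (f2 y))
     \<partial>PB \<partial>V x \<partial>PTs u)"
    by (subst nn_integral_pmf_swap) simp
  also have "\<dots> \<le> (\<integral>\<^sup>+ts. \<integral>\<^sup>+y. ennreal (1 / real K) * of_bool (A3 u (ts l') (f2 y)) \<partial>V x \<partial>PTs u)"
    by (intro nn_integral_pmf_mono *) (rule sel_less)
  also have "\<dots> = ennreal (1 / real K) * (\<integral>\<^sup>+y. \<integral>\<^sup>+ts. of_bool (A3 u (ts l') (f2 y)) \<partial>PTs u \<partial>V x)"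
    by (simp add: nn_integral_cmult) (subst nn_integral_pmf_swap, simp)
  also have "\<dots> \<le> ennreal (1 / real K) * ennreal q3"
    by (intro mult_left_mono, rule nn_integral_pmf_le_const)
       (use assms packing3 in \<open>simp_all add: nn_integral_Pi_pmf_component[where f="\<lambda>t. of_bool (A3 _ t _)"]\<close>)
  also have "\<dots> = ennreal (q3 / real K)" using pos by (simp add: ennreal_mult[symmetric])
  finally show ?thesis using False by simp
qed

text \<open>The selected description depends on \<open>u\<close>, \<open>ts\<close> and the output
  caused by \<open>xs j\<close>; given \<open>u\<close> all of this is independent of the competing
  word \<open>xs j'\<close>, which can be integrated innermost.\<close>

lemma packing_satellites:
  assumes "j < M2" "j' < M2" "j' \<noteq> j"
  shows "(\<integral>\<^sup>+xs. \<integral>\<^sup>+y. of_bool (A4 u (xs j') (ts (sel u (f1 y) ts)) (f2 y)) \<partial>V (xs j) \<partial>PXs u) \<le> ennreal q4"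
proof -
  have "(\<integral>\<^sup>+xs. \<integral>\<^sup>+y. of_bool (A4 u (xs j') (ts (sel u (f1 y) ts)) (f2 y)) \<partial>V (xs j) \<partial>PXs u) =
    (\<integral>\<^sup>+x. \<integral>\<^sup>+x'. \<integral>\<^sup>+y. of_bool (A4 u x' (ts (sel u (f1 y) ts)) (f2 y)) \<partial>V x \<partial>PX u \<partial>PX u)"
    using assms nn_integral_Pi_pmf_components[where A="{..<M2}" and i=j and j=j' and
      f="\<lambda>x x'. \<integral>\<^sup>+y. of_bool (A4 u x' (ts (sel u (f1 y) ts)) (f2 y)) \<partial>V x" and d=undefined and p="\<lambda>_. PX u"] by simp
  also have "\<dots> = (\<integral>\<^sup>+x. \<integral>\<^sup>+y. \<integral>\<^sup>+x'. of_bool (A4 u x' (ts (sel u (f1 y) ts)) (f2 y)) \<partial>PX u \<partial>V x \<partial>PX u)"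
    by (subst nn_integral_pmf_swap) simp
  also have "\<dots> \<le> ennreal q4" by (intro nn_integral_pmf_le_const packing4)
  finally show ?thesis .
qed

text \<open>Once \<open>y1\<close> is fixed by disintegration, so is the selected description, and
  the definition of \<open>G\<close> bounds its conditional failure probability.\<close>

lemma selected_bad:
  "(\<integral>\<^sup>+w. of_bool (G u (f1 (snd w)) (ts (sel u (f1 (snd w)) ts)) \<and> bad u (ts (sel u (f1 (snd w)) ts)) w) \<partial>J u)
     \<le> ennreal \<gamma>"
proof -
  have "(\<integral>\<^sup>+w. of_bool (G u (f1 (snd w)) (ts (sel u (f1 (snd w)) ts)) \<and> bad u (ts (sel u (f1 (snd w)) ts)) w) \<partial>J u) =
    (\<integral>\<^sup>+y1. \<integral>\<^sup>+w. of_bool (G u (f1 (snd w)) (ts (sel u (f1 (snd w)) ts)) \<and> bad u (ts (sel u (f1 (snd w)) ts)) w)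
       \<partial>JC u y1 \<partial>JY u)"
    by (subst disintegrate[symmetric]) simp
  also have "\<dots> = (\<integral>\<^sup>+y1. \<integral>\<^sup>+w. of_bool (G u y1 (ts (sel u y1 ts))) * of_bool (bad u (ts (sel u y1 ts)) w)
       \<partial>JC u y1 \<partial>JY u)"
    by (intro nn_integral_pmf_cong) (simp add: JC_eq of_bool_conj)
  also have "\<dots> \<le> ennreal \<gamma>"
    by (rule nn_integral_pmf_le_const) (auto simp: nn_integral_cmult G_def)
  finally show ?thesis .
qed

text \<open>Change of measure: where \<open>pmf (PT u y1) t\<close> is at most \<theta> times
  \<open>pmf (PTU u) t\<close>, a set of good descriptions of probability \<open>p'\<close> under
  \<open>PT u y1\<close> has probability at least \<open>p' / \<theta>\<close> under
  \<open>PTU u\<close>, the law of the \<open>L\<close> independent candidates. All of them fail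
  with probability at most \<open>(1 - p' / \<theta>) ^ L\<close>.\<close>

lemma covering_power:
  "(\<integral>\<^sup>+ts. of_bool (\<forall>l\<in>{..<L}. \<not> G u y1 (ts l)) \<partial>PTs u) \<le>
    (\<integral>\<^sup>+t. of_bool (\<not> G u y1 t) + of_bool (\<not> pmf (PT u y1) t \<le> \<theta> * pmf (PTU u) t) \<partial>PT u y1)
    + ennreal ((1 - 1 / \<theta>) ^ L)"
proof -
  define A where "A t \<longleftrightarrow> G u y1 t \<and> pmf (PT u y1) t \<le> \<theta> * pmf (PTU u) t" for t
  define p where "p = measure_pmf.prob (PTU u) {t. G u y1 t}"
  define p' where "p' = measure_pmf.prob (PT u y1) {t. A t}"
  have p': "0 \<le> p'" "p' \<le> 1" and p: "0 \<le> p" "p \<le> 1" by (auto simp: p_def p'_def)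
  have "ennreal p' = (\<integral>\<^sup>+t. of_bool (A t) \<partial>PT u y1)"
    unfolding p'_def nn_integral_of_bool_pmf ..
  also have "\<dots> = (\<integral>\<^sup>+t. ennreal (pmf (PT u y1) t) * of_bool (A t) \<partial>count_space UNIV)"
    by (simp add: nn_integral_measure_pmf)
  also have "\<dots> \<le> (\<integral>\<^sup>+t. ennreal (pmf (PTU u) t) * (ennreal \<theta> * of_bool (G u y1 t)) \<partial>count_space UNIV)"
    using pos by (intro nn_integral_mono)
      (auto simp: A_def of_bool_def ennreal_mult[symmetric] mult.commute intro!: ennreal_leI)
  also have "\<dots> = ennreal \<theta> * (\<integral>\<^sup>+t. of_bool (G u y1 t) \<partial>PTU u)"
    by (simp add: nn_integral_measure_pmf[symmetric] nn_integral_cmult)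
  also have "\<dots> = ennreal (\<theta> * p)"
    using pos by (simp add: nn_integral_of_bool_pmf p_def ennreal_mult)
  finally have "p' \<le> \<theta> * p" using pos p by (simp add: ennreal_le_iff)
  then have le: "p' * (1 / \<theta>) \<le> p" using pos by (simp add: field_simps)
  have "(\<integral>\<^sup>+ts. of_bool (\<forall>l\<in>{..<L}. \<not> G u y1 (ts l)) \<partial>PTs u) =
    (\<integral>\<^sup>+ts. (\<Prod>l\<in>{..<L}. of_bool (\<not> G u y1 (ts l))) \<partial>PTs u)"
    by (intro nn_integral_cong) (auto simp: of_bool_def intro!: prod.neutral[symmetric] prod_zero[symmetric])
  also have "\<dots> = (\<Prod>l\<in>{..<L}. \<integral>\<^sup>+t. of_bool (\<not> G u y1 t) \<partial>PTU u)"
    by (subst nn_integral_prod_Pi_pmf) auto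
  also have "(\<integral>\<^sup>+t. of_bool (\<not> G u y1 t) \<partial>PTU u) = ennreal (1 - p)"
    unfolding nn_integral_of_bool_pmf p_def
    by (subst measure_pmf.prob_compl[symmetric]) (auto intro!: arg_cong[where f=ennreal] arg_cong2[where f=measure])
  also have "(\<Prod>l\<in>{..<L}. ennreal (1 - p)) = ennreal ((1 - p) ^ L)"
    using p by (simp add: ennreal_power)
  \<comment> \<open>The base \<open>1 - p' / \<theta>\<close> is written as a mixture of 1 and
    \<open>1 - 1 / \<theta>\<close>, so that \<open>power_convex_bound\<close> splits off
    \<open>1 - p'\<close>, the probability that the ideal description is itself
    unacceptable.\<close>
  also have "\<dots> \<le> ennreal ((1 - p' + p' * (1 - 1 / \<theta>)) ^ L)"
    using p le by (intro ennreal_leI power_mono) (auto simp: algebra_simps)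
  also have "\<dots> \<le> ennreal (1 - p' + p' * (1 - 1 / \<theta>) ^ L)"
    using pos p' by (intro ennreal_leI power_convex_bound) auto
  also have "\<dots> \<le> ennreal ((1 - p') + (1 - 1 / \<theta>) ^ L)"
    using pos p' by (intro ennreal_leI add_left_mono mult_left_le_one_le) auto
  also have "\<dots> = ennreal (1 - p') + ennreal ((1 - 1 / \<theta>) ^ L)"
    using pos p' by (intro ennreal_plus) auto
  also have "ennreal (1 - p') = (\<integral>\<^sup>+t. of_bool (\<not> A t) \<partial>PT u y1)"
    unfolding nn_integral_of_bool_pmf p'_def
    by (subst measure_pmf.prob_compl[symmetric]) (auto intro!: arg_cong[where f=ennreal] arg_cong2[where f=measure])
  also have "\<dots> \<le> (\<integral>\<^sup>+t. of_bool (\<not> G u y1 t) + of_bool (\<not> pmf (PT u y1) t \<le> \<theta> * pmf (PTU u) t) \<partial>PT u y1)"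
    by (intro nn_integral_pmf_mono) (auto simp: A_def of_bool_def)
  finally show ?thesis by (simp add: add_right_mono)
qed

section \<open>Covering failure and the total error of the random code\<close>

definition e1 :: ennreal where
  "e1 = (\<integral>\<^sup>+u. \<integral>\<^sup>+x. \<integral>\<^sup>+y. of_bool (\<not> A1 u (f1 y)) \<partial>V x \<partial>PX u \<partial>PU)"
definition e2 :: ennreal where
  "e2 = (\<integral>\<^sup>+u. \<integral>\<^sup>+x. \<integral>\<^sup>+y. of_bool (\<not> A2 u (f2 y)) \<partial>V x \<partial>PX u \<partial>PU)"
definition e34 :: ennreal where
  "e34 = (\<integral>\<^sup>+u. \<integral>\<^sup>+x. \<integral>\<^sup>+y. \<integral>\<^sup>+t. of_bool (bad u t (x, y)) \<partial>PT u (f1 y) \<partial>V x \<partial>PX u \<partial>PU)"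
definition e5 :: ennreal where
  "e5 = (\<integral>\<^sup>+u. \<integral>\<^sup>+x. \<integral>\<^sup>+y. \<integral>\<^sup>+t. of_bool (\<not> pmf (PT u (f1 y)) t \<le> \<theta> * pmf (PTU u) t)
     \<partial>PT u (f1 y) \<partial>V x \<partial>PX u \<partial>PU)"

lemma covering:
  "(\<integral>\<^sup>+u. \<integral>\<^sup>+ts. \<integral>\<^sup>+w. of_bool (\<forall>l\<in>{..<L}. \<not> G u (f1 (snd w)) (ts l)) \<partial>J u \<partial>PTs u \<partial>PU) \<le>
    ennreal (1 / \<gamma>) * e34 + e5 + ennreal ((1 - 1 / \<theta>) ^ L)"
proof -
  let ?B = "\<lambda>u y1 t. \<not> pmf (PT u y1) t \<le> \<theta> * pmf (PTU u) t"
  \<comment> \<open>Markov's inequality: a description rejected by \<open>G\<close> has conditional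
    failure probability above \<gamma>. This is the origin of the factor
    \<open>1 / \<gamma>\<close>.\<close>
  have G_le: "of_bool (\<not> G u y1 t) \<le> ennreal (1 / \<gamma>) * (\<integral>\<^sup>+w. of_bool (bad u t w) \<partial>JC u y1)" for u y1 t
  proof (cases "G u y1 t")
    case False
    then have "ennreal \<gamma> \<le> (\<integral>\<^sup>+w. of_bool (bad u t w) \<partial>JC u y1)" by (auto simp: G_def)
    then have "ennreal (1 / \<gamma>) * ennreal \<gamma> \<le> ennreal (1 / \<gamma>) * (\<integral>\<^sup>+w. of_bool (bad u t w) \<partial>JC u y1)"
      by (intro mult_left_mono) auto
    moreover have "ennreal (1 / \<gamma>) * ennreal \<gamma> = 1" using pos by (simp add: ennreal_mult[symmetric])
    ultimately show ?thesis using False by simp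
  qed auto
  have "(\<integral>\<^sup>+u. \<integral>\<^sup>+ts. \<integral>\<^sup>+w. of_bool (\<forall>l\<in>{..<L}. \<not> G u (f1 (snd w)) (ts l)) \<partial>J u \<partial>PTs u \<partial>PU) =
    (\<integral>\<^sup>+u. \<integral>\<^sup>+y1. \<integral>\<^sup>+ts. of_bool (\<forall>l\<in>{..<L}. \<not> G u y1 (ts l)) \<partial>PTs u \<partial>JY u \<partial>PU)"
    by (subst nn_integral_pmf_swap) (simp add: JY_def)
  also have "\<dots> \<le> (\<integral>\<^sup>+u. \<integral>\<^sup>+y1. (\<integral>\<^sup>+t. ennreal (1 / \<gamma>) * (\<integral>\<^sup>+w. of_bool (bad u t w) \<partial>JC u y1) +
      of_bool (?B u y1 t) \<partial>PT u y1) + ennreal ((1 - 1 / \<theta>) ^ L) \<partial>JY u \<partial>PU)"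
    by (intro nn_integral_pmf_mono order_trans[OF covering_power] add_right_mono G_le)
  also have "\<dots> = ennreal (1 / \<gamma>) * (\<integral>\<^sup>+u. \<integral>\<^sup>+y1. \<integral>\<^sup>+t. \<integral>\<^sup>+w. of_bool (bad u t w) \<partial>JC u y1 \<partial>PT u y1 \<partial>JY u \<partial>PU) +
      (\<integral>\<^sup>+u. \<integral>\<^sup>+y1. \<integral>\<^sup>+t. of_bool (?B u y1 t) \<partial>PT u y1 \<partial>JY u \<partial>PU) + ennreal ((1 - 1 / \<theta>) ^ L)"
    by (simp add: nn_integral_add nn_integral_cmult)
  also have "(\<integral>\<^sup>+u. \<integral>\<^sup>+y1. \<integral>\<^sup>+t. of_bool (?B u y1 t) \<partial>PT u y1 \<partial>JY u \<partial>PU) = e5"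
    unfolding e5_def nn_integral_JY ..
  also have "(\<integral>\<^sup>+u. \<integral>\<^sup>+y1. \<integral>\<^sup>+t. \<integral>\<^sup>+w. of_bool (bad u t w) \<partial>JC u y1 \<partial>PT u y1 \<partial>JY u \<partial>PU) =
    (\<integral>\<^sup>+u. \<integral>\<^sup>+y1. \<integral>\<^sup>+w. \<integral>\<^sup>+t. of_bool (bad u t w) \<partial>PT u y1 \<partial>JC u y1 \<partial>JY u \<partial>PU)"
    by (subst nn_integral_pmf_swap) simp
  \<comment> \<open>On the fibre over \<open>y1\<close> the argument of \<open>PT\<close> may be
    read off \<open>w\<close>; then \<open>JY\<close> and \<open>JC\<close> recombine to
    \<open>J\<close>.\<close>
  also have "\<dots> = (\<integral>\<^sup>+u. \<integral>\<^sup>+y1. \<integral>\<^sup>+w. \<integral>\<^sup>+t. of_bool (bad u t w) \<partial>PT u (f1 (snd w)) \<partial>JC u y1 \<partial>JY u \<partial>PU)"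
    by (intro nn_integral_pmf_cong) (simp add: JC_eq)
  also have "\<dots> = (\<integral>\<^sup>+u. \<integral>\<^sup>+w. \<integral>\<^sup>+t. of_bool (bad u t w) \<partial>PT u (f1 (snd w)) \<partial>J u \<partial>PU)"
    by (subst disintegrate[symmetric]) simp
  also have "\<dots> = e34"
    unfolding e34_def nn_integral_J by simp
  finally show ?thesis .
qed

text \<open>The nesting copies that of the union bound \<open>S\<close> in
  \<open>expected_block_err\<close>, so that \<open>add_mono\<close> compares the two summand by
  summand.\<close>

definition total :: ennreal where
  "total = e1 + (e2 + (ennreal (real (M1 - 1) * q1) + (ennreal (real (M1 * K - 1) * q2) +
     ((ennreal (1 / \<gamma>) * e34 + e5 + ennreal ((1 - 1 / \<theta>) ^ L)) + (ennreal \<gamma> +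
     ((if L = 1 then 0 else ennreal (real L * q3 / real K)) + ennreal (real (M2 - 1) * q4)))))))"

lemma expected_block_err:
  assumes ikj: "i < M1" "k < K" "j < M2"
  shows "(\<integral>\<^sup>+C. \<integral>\<^sup>+bn. \<integral>\<^sup>+y. of_bool (block_err (code C bn) i k j (f1 y) (f2 y))
     \<partial>V (word (code C bn) i k j) \<partial>PB \<partial>PC) \<le> total"
proof -
  define a where "a = (i, k)"
  define u where "u C = fst (C a)" for C :: "nat \<times> nat \<Rightarrow> ('u, 'x, 't) row"
  define xs where "xs C = fst (snd (C a))" for C :: "nat \<times> nat \<Rightarrow> ('u, 'x, 't) row"
  define ts where "ts C = snd (snd (C a))" for C :: "nat \<times> nat \<Rightarrow> ('u, 'x, 't) row"
  define l where "l C y = sel (u C) (f1 y) (ts C)" for C y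
  have a: "a \<in> {..<M1} \<times> {..<K}" using ikj by (simp add: a_def)
  define F1 where "F1 C y = (\<not> A1 (u C) (f1 y))" for C y
  define F2 where "F2 C y = (\<not> A2 (u C) (f2 y))" for C y
  define F3 where "F3 C y a' = A1 (fst (C a')) (f1 y)" for C :: "nat \<times> nat \<Rightarrow> ('u, 'x, 't) row" and y a'
  define F4 where "F4 C y a' = A2 (fst (C a')) (f2 y)" for C :: "nat \<times> nat \<Rightarrow> ('u, 'x, 't) row" and y a'
  define F5 where "F5 C y = (\<forall>l\<in>{..<L}. \<not> G (u C) (f1 y) (ts C l))" for C y
  define F6 where "F6 C y = (G (u C) (f1 y) (ts C (l C y)) \<and> bad (u C) (ts C (l C y)) (xs C j, y))" for C y
  define F7 where "F7 C bn y l' = (l' \<noteq> l C y \<and> bn l' = bn (l C y) \<and> A3 (u C) (ts C l') (f2 y))" for C y l' and bn :: "nat \<Rightarrow> nat"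
  define F8 where "F8 C y j' = A4 (u C) (xs C j') (ts C (l C y)) (f2 y)" for C y j'
  note defs = F1_def F2_def F3_def F4_def F5_def F6_def F7_def F8_def
  define S1 where "S1 = {..<M1} \<times> {k} - {a}"
  define S2 where "S2 = {..<M1} \<times> {..<K} - {a}"
  have word: "word (code C bn) i k j = xs C j" for C bn
    by (simp add: code_def xs_def a_def)
  define S :: "(nat \<times> nat \<Rightarrow> ('u, 'x, 't) row) \<Rightarrow> (nat \<Rightarrow> nat) \<Rightarrow> 'y \<Rightarrow> ennreal" where
    "S C bn y = of_bool (F1 C y) + (of_bool (F2 C y) + ((\<Sum>a'\<in>S1. of_bool (F3 C y a')) +
    ((\<Sum>a'\<in>S2. of_bool (F4 C y a')) + (of_bool (F5 C y) + (of_bool (F6 C y) +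
    ((\<Sum>l'\<in>{..<L}. of_bool (F7 C bn y l')) + (\<Sum>j'\<in>{..<M2} - {j}. of_bool (F8 C y j'))))))))" for C bn y
  have pointwise: "of_bool (block_err (code C bn) i k j (f1 y) (f2 y)) \<le> S C bn y" for C bn y
  proof -
    have "of_bool (block_err (code C bn) i k j (f1 y) (f2 y)) \<le> (of_bool (F1 C y \<or> F2 C y \<or>
       (\<exists>a'\<in>S1. F3 C y a') \<or> (\<exists>a'\<in>S2. F4 C y a') \<or> F5 C y \<or> F6 C y \<or>
       (\<exists>l'\<in>{..<L}. F7 C bn y l') \<or> (\<exists>j'\<in>{..<M2} - {j}. F8 C y j')) :: ennreal)"
      using block_err_cases[where C=C and bn=bn and i=i and k=k and y=y and j=j] ikj
      unfolding defs S1_def S2_def a_def u_def xs_def ts_def l_def of_bool_def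
      by (cases "block_err (code C bn) i k j (f1 y) (f2 y)") (simp_all only: if_True if_False zero_le order_refl simp_thms)
    also have "\<dots> \<le> S C bn y"
      unfolding S_def
      by (intro order_trans[OF of_bool_ennreal_disj_le] add_mono of_bool_ennreal_bex_le order_refl)
         (auto simp: S1_def S2_def)
    finally show ?thesis .
  qed
  let ?I = "\<lambda>F. (\<integral>\<^sup>+C. \<integral>\<^sup>+bn. \<integral>\<^sup>+y. of_bool (F C bn y) \<partial>V (xs C j) \<partial>PB \<partial>PC) :: ennreal"
  have I1: "?I (\<lambda>C bn y. F1 C y) = e1"
    unfolding F1_def u_def xs_def
    by (simp add: nn_integral_codebook_row[OF a, where g="\<lambda>u xs ts. \<integral>\<^sup>+y. of_bool (\<not> A1 u (f1 y)) \<partial>V (xs j)"]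
      nn_integral_satellite[OF ikj(3), where g="\<lambda>x y. of_bool (\<not> A1 _ (f1 y))"] e1_def nn_integral_J)
  have I2: "?I (\<lambda>C bn y. F2 C y) = e2"
    unfolding F2_def u_def xs_def
    by (simp add: nn_integral_codebook_row[OF a, where g="\<lambda>u xs ts. \<integral>\<^sup>+y. of_bool (\<not> A2 u (f2 y)) \<partial>V (xs j)"]
      nn_integral_satellite[OF ikj(3), where g="\<lambda>x y. of_bool (\<not> A2 _ (f2 y))"] e2_def nn_integral_J)
  have I3: "?I (\<lambda>C bn y. F3 C y a') \<le> ennreal q1" if "a' \<in> S1" for a'
    unfolding F3_def xs_def using that a ikj
    by simp (rule packing_rows[OF packing1, where f=f1], auto simp: S1_def)
  have I4: "?I (\<lambda>C bn y. F4 C y a') \<le> ennreal q2" if "a' \<in> S2" for a'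
    unfolding F4_def xs_def using that a ikj
    by simp (rule packing_rows[OF packing2, where f=f2], auto simp: S2_def)
  have I5: "?I (\<lambda>C bn y. F5 C y) \<le> ennreal (1 / \<gamma>) * e34 + e5 + ennreal ((1 - 1 / \<theta>) ^ L)"
  proof -
    have "?I (\<lambda>C bn y. F5 C y) = (\<integral>\<^sup>+u. \<integral>\<^sup>+xs. \<integral>\<^sup>+ts. \<integral>\<^sup>+y. of_bool (\<forall>l\<in>{..<L}. \<not> G u (f1 y) (ts l)) \<partial>V (xs j) \<partial>PTs u \<partial>PXs u \<partial>PU)"
      unfolding F5_def u_def xs_def ts_def
      by (simp add: nn_integral_codebook_row[OF a, where g="\<lambda>u xs ts. \<integral>\<^sup>+y. of_bool (\<forall>l\<in>{..<L}. \<not> G u (f1 y) (ts l)) \<partial>V (xs j)"])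
    also have "\<dots> = (\<integral>\<^sup>+u. \<integral>\<^sup>+ts. \<integral>\<^sup>+xs. \<integral>\<^sup>+y. of_bool (\<forall>l\<in>{..<L}. \<not> G u (f1 y) (ts l)) \<partial>V (xs j) \<partial>PXs u \<partial>PTs u \<partial>PU)"
      by (subst nn_integral_pmf_swap) simp
    also have "\<dots> = (\<integral>\<^sup>+u. \<integral>\<^sup>+ts. \<integral>\<^sup>+w. of_bool (\<forall>l\<in>{..<L}. \<not> G u (f1 (snd w)) (ts l)) \<partial>J u \<partial>PTs u \<partial>PU)"
      by (subst nn_integral_satellite[OF ikj(3)]) simp
    finally show ?thesis using covering by simp
  qed
  have I6: "?I (\<lambda>C bn y. F6 C y) \<le> ennreal \<gamma>"
  proof -
    have "?I (\<lambda>C bn y. F6 C y) = (\<integral>\<^sup>+u. \<integral>\<^sup>+xs. \<integral>\<^sup>+ts. \<integral>\<^sup>+y. of_bool (G u (f1 y) (ts (sel u (f1 y) ts)) \<and> bad u (ts (sel u (f1 y) ts)) (xs j, y)) \<partial>V (xs j) \<partial>PTs u \<partial>PXs u \<partial>PU)"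
      unfolding F6_def u_def xs_def ts_def l_def
      by (simp add: nn_integral_codebook_row[OF a, where g="\<lambda>u xs ts. \<integral>\<^sup>+y. of_bool (G u (f1 y) (ts (sel u (f1 y) ts)) \<and> bad u (ts (sel u (f1 y) ts)) (xs j, y)) \<partial>V (xs j)"])
    also have "\<dots> = (\<integral>\<^sup>+u. \<integral>\<^sup>+ts. \<integral>\<^sup>+xs. \<integral>\<^sup>+y. of_bool (G u (f1 y) (ts (sel u (f1 y) ts)) \<and> bad u (ts (sel u (f1 y) ts)) (xs j, y)) \<partial>V (xs j) \<partial>PXs u \<partial>PTs u \<partial>PU)"
      by (subst nn_integral_pmf_swap) simp
    also have "\<dots> \<le> ennreal \<gamma>"
      by (rule nn_integral_pmf_le_const, rule nn_integral_pmf_le_const, subst nn_integral_satellite[OF ikj(3), where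
        g="\<lambda>x y. of_bool (G u (f1 y) (ts (sel u (f1 y) ts)) \<and> bad u (ts (sel u (f1 y) ts)) (x, y))" for u ts])
        (use selected_bad in simp)
    finally show ?thesis .
  qed
  have I7: "?I (\<lambda>C bn y. F7 C bn y l') \<le> (if L = 1 then 0 else ennreal (q3 / real K))" if "l' \<in> {..<L}" for l'
  proof -
    have "?I (\<lambda>C bn y. F7 C bn y l') = (\<integral>\<^sup>+u. \<integral>\<^sup>+xs. \<integral>\<^sup>+ts. \<integral>\<^sup>+bn. \<integral>\<^sup>+y. of_bool (l' \<noteq> sel u (f1 y) ts \<and> bn l' = bn (sel u (f1 y) ts) \<and> A3 u (ts l') (f2 y)) \<partial>V (xs j) \<partial>PB \<partial>PTs u \<partial>PXs u \<partial>PU)"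
      unfolding F7_def u_def xs_def ts_def l_def
      by (rule nn_integral_codebook_row[OF a, where g="\<lambda>u xs ts. \<integral>\<^sup>+bn. \<integral>\<^sup>+y. of_bool (l' \<noteq> sel u (f1 y) ts \<and> bn l' = bn (sel u (f1 y) ts) \<and> A3 u (ts l') (f2 y)) \<partial>V (xs j) \<partial>PB"])
    also have "\<dots> \<le> (if L = 1 then 0 else ennreal (q3 / real K))"
      
      by (rule nn_integral_pmf_le_const, rule nn_integral_pmf_le_const, rule packing_bins) (use that in auto)
    finally show ?thesis .
  qed
  have I8: "?I (\<lambda>C bn y. F8 C y j') \<le> ennreal q4" if "j' \<in> {..<M2} - {j}" for j'
  proof -
    have "?I (\<lambda>C bn y. F8 C y j') = (\<integral>\<^sup>+u. \<integral>\<^sup>+xs. \<integral>\<^sup>+ts. \<integral>\<^sup>+y. of_bool (A4 u (xs j') (ts (sel u (f1 y) ts)) (f2 y)) \<partial>V (xs j) \<partial>PTs u \<partial>PXs u \<partial>PU)"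
      unfolding F8_def u_def xs_def ts_def l_def
      by (simp add: nn_integral_codebook_row[OF a, where g="\<lambda>u xs ts. \<integral>\<^sup>+y. of_bool (A4 u (xs j') (ts (sel u (f1 y) ts)) (f2 y)) \<partial>V (xs j)"])
    also have "\<dots> = (\<integral>\<^sup>+u. \<integral>\<^sup>+ts. \<integral>\<^sup>+xs. \<integral>\<^sup>+y. of_bool (A4 u (xs j') (ts (sel u (f1 y) ts)) (f2 y)) \<partial>V (xs j) \<partial>PXs u \<partial>PTs u \<partial>PU)"
      by (subst nn_integral_pmf_swap) simp
    also have "\<dots> \<le> ennreal q4"
      
      by (rule nn_integral_pmf_le_const, rule nn_integral_pmf_le_const, rule packing_satellites) (use that ikj in auto)
    finally show ?thesis .
  qed
  have cS1: "card S1 = M1 - 1" and cS2: "card S2 = M1 * K - 1"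
    using ikj by (simp_all add: S1_def S2_def a_def card_Diff_singleton card_cartesian_product)
  have sum_le: "(\<Sum>a\<in>S. ?I (F a)) \<le> ennreal (real n * q)"
    if "\<And>a. a \<in> S \<Longrightarrow> ?I (F a) \<le> ennreal q" "card S = n" "0 \<le> q" for S :: "'z set" and F n q
  proof -
    have "(\<Sum>a\<in>S. ?I (F a)) \<le> (\<Sum>a\<in>S. ennreal q)" by (intro sum_mono that)
    also have "\<dots> = ennreal (real n * q)" using that by (simp add: ennreal_mult ennreal_of_nat_eq_real_of_nat)
    finally show ?thesis .
  qed
  have "(\<integral>\<^sup>+C. \<integral>\<^sup>+bn. \<integral>\<^sup>+y. of_bool (block_err (code C bn) i k j (f1 y) (f2 y))
     \<partial>V (word (code C bn) i k j) \<partial>PB \<partial>PC) \<le>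
    (\<integral>\<^sup>+C. \<integral>\<^sup>+bn. \<integral>\<^sup>+y. S C bn y \<partial>V (xs C j) \<partial>PB \<partial>PC)"
    unfolding word by (intro nn_integral_pmf_mono pointwise)
  also have "\<dots> = ?I (\<lambda>C bn y. F1 C y) + (?I (\<lambda>C bn y. F2 C y) + ((\<Sum>a'\<in>S1. ?I (\<lambda>C bn y. F3 C y a')) +
    ((\<Sum>a'\<in>S2. ?I (\<lambda>C bn y. F4 C y a')) + (?I (\<lambda>C bn y. F5 C y) + (?I (\<lambda>C bn y. F6 C y) +
    ((\<Sum>l'\<in>{..<L}. ?I (\<lambda>C bn y. F7 C bn y l')) + (\<Sum>j'\<in>{..<M2} - {j}. ?I (\<lambda>C bn y. F8 C y j'))))))))"
    unfolding S_def by (simp add: nn_integral_add nn_integral_sum del: sum_of_bool_eq)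
  also have "\<dots> \<le> total"
    unfolding total_def I1 I2
  proof (intro add_mono order_refl I5 I6)
    show "(\<Sum>a'\<in>S1. ?I (\<lambda>C bn y. F3 C y a')) \<le> ennreal (real (M1 - 1) * q1)"
      by (rule sum_le) (use I3 cS1 pos in auto)
    show "(\<Sum>a'\<in>S2. ?I (\<lambda>C bn y. F4 C y a')) \<le> ennreal (real (M1 * K - 1) * q2)"
      by (rule sum_le) (use I4 cS2 pos in auto)
    show "(\<Sum>l'\<in>{..<L}. ?I (\<lambda>C bn y. F7 C bn y l')) \<le> (if L = 1 then 0 else ennreal (real L * q3 / real K))"
    proof (cases "L = 1")
      case True
      then show ?thesis using I7 by simp
    next
      case False
      then show ?thesis using sum_le[of "{..<L}" "\<lambda>l' C bn y. F7 C bn y l'" "q3 / real K" L] I7 pos by simp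
    qed
    show "(\<Sum>j'\<in>{..<M2} - {j}. ?I (\<lambda>C bn y. F8 C y j')) \<le> ennreal (real (M2 - 1) * q4)"
      by (rule sum_le) (use I8 ikj pos in auto)
  qed
  finally show ?thesis .
qed

text \<open>\<open>expected_block_err\<close> bounds each index triple separately, so the bound
  survives averaging over any law \<mu>. Membership of the codewords in the support is recorded
  because, for product laws on lists, it yields their length.\<close>

lemma exists_block_code:
  assumes "set_pmf \<mu> \<subseteq> {..<M1} \<times> {..<K} \<times> {..<M2}"
  shows "\<exists>c :: ('x, 'y1, 'y2) block_code. (\<forall>i k y1. bin_idx c i k y1 < K) \<and>
    (\<forall>i<M1. \<forall>k<K. \<forall>j<M2. \<exists>u\<in>set_pmf PU. word c i k j \<in> set_pmf (PX u)) \<and>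
    (\<integral>\<^sup>+(i, k, j). \<integral>\<^sup>+y. of_bool (block_err c i k j (f1 y) (f2 y)) \<partial>V (word c i k j) \<partial>\<mu>) \<le> total"
proof -
  let ?E = "\<lambda>C bn i k j. \<integral>\<^sup>+y. of_bool (block_err (code C bn) i k j (f1 y) (f2 y)) \<partial>V (word (code C bn) i k j) :: ennreal"
  have "(\<integral>\<^sup>+C. \<integral>\<^sup>+bn. \<integral>\<^sup>+(i, k, j). ?E C bn i k j \<partial>\<mu> \<partial>PB \<partial>PC) =
      (\<integral>\<^sup>+C. \<integral>\<^sup>+m. \<integral>\<^sup>+bn. (case m of (i, k, j) \<Rightarrow> ?E C bn i k j) \<partial>PB \<partial>\<mu> \<partial>PC)"
    by (subst nn_integral_pmf_swap) simp
  also have "\<dots> = (\<integral>\<^sup>+m. \<integral>\<^sup>+C. \<integral>\<^sup>+bn. (case m of (i, k, j) \<Rightarrow> ?E C bn i k j) \<partial>PB \<partial>PC \<partial>\<mu>)"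
    by (subst nn_integral_pmf_swap) simp
  also have "\<dots> \<le> total"
    by (rule nn_integral_pmf_le_const) (use assms expected_block_err in fastforce)
  finally have le: "(\<integral>\<^sup>+C. \<integral>\<^sup>+bn. \<integral>\<^sup>+(i, k, j). ?E C bn i k j \<partial>\<mu> \<partial>PB \<partial>PC) \<le> total" .
  obtain C where C: "C \<in> set_pmf PC" "(\<integral>\<^sup>+bn. \<integral>\<^sup>+(i, k, j). ?E C bn i k j \<partial>\<mu> \<partial>PB) \<le> total"
    using exists_le_nn_integral_pmf[of PC "\<lambda>C. \<integral>\<^sup>+bn. \<integral>\<^sup>+(i, k, j). ?E C bn i k j \<partial>\<mu> \<partial>PB"] le
    by (meson order_trans)
  obtain bn where bn: "bn \<in> set_pmf PB" "(\<integral>\<^sup>+(i, k, j). ?E C bn i k j \<partial>\<mu>) \<le> total"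
    using exists_le_nn_integral_pmf[of PB "\<lambda>bn. \<integral>\<^sup>+(i, k, j). ?E C bn i k j \<partial>\<mu>"] C(2)
    by (meson order_trans)
  \<comment> \<open>Beyond \<open>L\<close> the binning takes the default value 0 of
    \<open>PB\<close>, which is below \<open>K\<close> as well.\<close>
  have "bn l < K" for l
    using bn(1) pos by (auto simp: set_Pi_pmf PiE_dflt_def lessThan_empty_iff split: if_splits dest!: spec[of _ l])
  then have "\<forall>i k y1. bin_idx (code C bn) i k y1 < K" by (simp add: code_def)
  moreover have "\<exists>u\<in>set_pmf PU. word (code C bn) i k j \<in> set_pmf (PX u)" if "i < M1" "k < K" "j < M2" for i k j
  proof -
    have "C (i, k) \<in> set_pmf row_pmf"
      using C(1) that by (auto simp: set_Pi_pmf PiE_dflt_def)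
    then obtain u xs ts where "C (i, k) = (u, xs, ts)" "u \<in> set_pmf PU" "xs \<in> set_pmf (PXs u)"
      by (auto simp: row_pmf_def)
    moreover from this(3) that have "xs j \<in> set_pmf (PX u)"
      by (auto simp: set_Pi_pmf PiE_dflt_def)
    ultimately show ?thesis by (auto simp: code_def)
  qed
  ultimately show ?thesis using bn(2) by blast
qed

end

section \<open>Block-Markov coding\<close>

primrec list_pmf :: "'a pmf list \<Rightarrow> 'a list pmf" where
  "list_pmf [] = return_pmf []"
| "list_pmf (p # ps) = p \<bind> (\<lambda>x. list_pmf ps \<bind> (\<lambda>xs. return_pmf (x # xs)))"

lemma length_list_pmf: "xs \<in> set_pmf (list_pmf ps) \<Longrightarrow> length xs = length ps"
  by (induction ps arbitrary: xs) auto

text \<open>Receiver 1 has only its own estimate of the cloud part \<open>i\<close>. If that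
  estimate is right, the result is the bin index used in \<open>block_err\<close>.\<close>

definition next_idx :: "('x, 'y1, 'y2) block_code \<Rightarrow> nat \<Rightarrow> 'y1 \<Rightarrow> nat" where
  "next_idx c k y1 = bin_idx c (own_dec c k y1) k y1"

type_synonym ('x, 'y1, 'y2) list_code = "('x list, 'y1 list, 'y2 list) block_code"

definition avg_block_err :: "('x, 'y1, 'y2) dmbc \<Rightarrow> ('x, 'y1, 'y2) list_code \<Rightarrow> (nat \<times> nat \<times> nat) pmf \<Rightarrow> ennreal" where
  "avg_block_err W c \<mu> = (\<integral>\<^sup>+(i, k, j). \<integral>\<^sup>+y. of_bool (block_err c i k j (map fst y) (map snd y))
     \<partial>list_pmf (map W (word c i k j)) \<partial>measure_pmf \<mu>)"

definition block_reliable :: "('x, 'y1, 'y2) dmbc \<Rightarrow> nat \<Rightarrow> nat \<Rightarrow> nat \<Rightarrow> nat \<Rightarrow> ennreal \<Rightarrow> bool" where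
  "block_reliable W n M1 K M2 \<epsilon> \<longleftrightarrow> (\<forall>\<mu>. set_pmf \<mu> \<subseteq> {..<M1} \<times> {..<K} \<times> {..<M2} \<longrightarrow>
     (\<exists>c. (\<forall>i k j. length (word c i k j) = n) \<and> (\<forall>i k y. bin_idx c i k y < K) \<and> avg_block_err W c \<mu> \<le> \<epsilon>))"

primrec run :: "('x, 'y1, 'y2) dmbc \<Rightarrow> ('x, 'y1, 'y2) list_code list \<Rightarrow> (nat \<times> nat) list \<Rightarrow> nat \<Rightarrow>
    ('y1 \<times> 'y2) list list pmf" where
  "run W [] ms k = return_pmf []"
| "run W (c # cs) ms k =
     list_pmf (map W (word c (fst (hd ms)) k (snd (hd ms)))) \<bind> (\<lambda>y.
     run W cs (tl ms) (next_idx c k (map fst y)) \<bind> (\<lambda>ys. return_pmf (y # ys)))"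

primrec run_err :: "('x, 'y1, 'y2) list_code list \<Rightarrow> (nat \<times> nat) list \<Rightarrow> nat \<Rightarrow>
    ('y1 \<times> 'y2) list list \<Rightarrow> bool" where
  "run_err [] ms k ys \<longleftrightarrow> False"
| "run_err (c # cs) ms k ys \<longleftrightarrow>
     block_err c (fst (hd ms)) k (snd (hd ms)) (map fst (hd ys)) (map snd (hd ys)) \<or>
     run_err cs (tl ms) (next_idx c k (map fst (hd ys))) (tl ys)"

text \<open>
  The bin index entering a block need not be uniform. Hence the code of each block is chosen for the
  actual joint distribution of its indices, which is determined by the codes of the earlier blocks.
\<close>

lemma exists_run:
  fixes W :: "('x, 'y1, 'y2) dmbc" and \<epsilon> :: ennreal
  assumes ex: "\<And>\<mu>. set_pmf \<mu> \<subseteq> {..<M1} \<times> {..<K} \<times> {..<M2} \<Longrightarrow> \<exists>c :: ('x, 'y1, 'y2) list_code. P c \<and>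
      avg_block_err W c \<mu> \<le> \<epsilon>"
    and idx: "\<And>c i k y. P c \<Longrightarrow> bin_idx c i k y < K"
    and supp: "\<And>ms k. (ms, k) \<in> set_pmf \<mu> \<Longrightarrow> length ms = B \<and> set ms \<subseteq> {..<M1} \<times> {..<M2} \<and> k < K"
  shows "\<exists>cs. length cs = B \<and> (\<forall>c\<in>set cs. P c) \<and>
     (\<integral>\<^sup>+(ms, k). \<integral>\<^sup>+ys. of_bool (run_err cs ms k ys) \<partial>run W cs ms k \<partial>measure_pmf \<mu>) \<le> of_nat B * \<epsilon>"
  using supp
proof (induction B arbitrary: \<mu>)
  case 0
  then show ?case by (intro exI[of _ "[]"]) (simp add: case_prod_unfold)
next
  case (Suc B)
  define \<mu>1 where "\<mu>1 = map_pmf (\<lambda>(ms, k). (fst (hd ms), k, snd (hd ms))) \<mu>"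
  have hd_in: "hd ms \<in> {..<M1} \<times> {..<M2}" if "(ms, k) \<in> set_pmf \<mu>" for ms k
    using Suc.prems[OF that] by (metis hd_in_set in_mono length_0_conv nat.simps(3))
  have "set_pmf \<mu>1 \<subseteq> {..<M1} \<times> {..<K} \<times> {..<M2}"
    using hd_in Suc.prems by (fastforce simp: \<mu>1_def mem_Times_iff)
  then obtain c :: "('x, 'y1, 'y2) list_code" where c: "P c"
    "avg_block_err W c \<mu>1 \<le> \<epsilon>" using ex by blast
  let ?w = "\<lambda>ms k. list_pmf (map W (word c (fst (hd ms)) k (snd (hd ms))))"
  \<comment> \<open>The joint law of the remaining messages and of the index entering the next
    block. It depends on the code \<open>c\<close> just chosen, so the codes are picked from the
    first block on.\<close>
  define \<mu>2 where "\<mu>2 = \<mu> \<bind> (\<lambda>(ms, k). map_pmf (\<lambda>y. (tl ms, next_idx c k (map fst y))) (?w ms k))"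
  have "\<exists>cs. length cs = B \<and> (\<forall>c\<in>set cs. P c) \<and>
     (\<integral>\<^sup>+(ms, k). \<integral>\<^sup>+ys. of_bool (run_err cs ms k ys) \<partial>run W cs ms k \<partial>measure_pmf \<mu>2) \<le> of_nat B * \<epsilon>"
  proof (rule Suc.IH)
    fix ms k assume "(ms, k) \<in> set_pmf \<mu>2"
    then obtain ms' k' y where "(ms', k') \<in> set_pmf \<mu>" "ms = tl ms'" "k = next_idx c k' y"
      by (auto simp: \<mu>2_def)
    with Suc.prems[of ms' k'] show "length ms = B \<and> set ms \<subseteq> {..<M1} \<times> {..<M2} \<and> k < K"
      using idx[OF c(1)] list.set_sel(2)[of ms'] by (cases ms') (auto simp: next_idx_def)
  qed
  then obtain cs where cs: "length cs = B" "\<forall>c\<in>set cs. P c"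
     "(\<integral>\<^sup>+(ms, k). \<integral>\<^sup>+ys. of_bool (run_err cs ms k ys) \<partial>run W cs ms k \<partial>measure_pmf \<mu>2) \<le> of_nat B * \<epsilon>"
    by blast
  have "(\<integral>\<^sup>+(ms, k). \<integral>\<^sup>+ys. of_bool (run_err (c # cs) ms k ys) \<partial>run W (c # cs) ms k \<partial>measure_pmf \<mu>) \<le>
    (\<integral>\<^sup>+(ms, k). \<integral>\<^sup>+y. \<integral>\<^sup>+ys. of_bool (block_err c (fst (hd ms)) k (snd (hd ms)) (map fst y) (map snd y)) +
       of_bool (run_err cs (tl ms) (next_idx c k (map fst y)) ys)
       \<partial>run W cs (tl ms) (next_idx c k (map fst y)) \<partial>?w ms k \<partial>measure_pmf \<mu>)"
    by (intro nn_integral_pmf_mono) (auto intro!: nn_integral_pmf_mono simp: of_bool_def)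
  also have "\<dots> = avg_block_err W c \<mu>1 +
     (\<integral>\<^sup>+(ms, k). \<integral>\<^sup>+ys. of_bool (run_err cs ms k ys) \<partial>run W cs ms k \<partial>measure_pmf \<mu>2)"
    by (simp add: avg_block_err_def nn_integral_add \<mu>1_def \<mu>2_def case_prod_unfold)
  also have "\<dots> \<le> \<epsilon> + of_nat B * \<epsilon>" by (intro add_mono c cs)
  also have "\<dots> = of_nat (Suc B) * \<epsilon>" by (simp add: distrib_right)
  finally show ?case using cs c by (intro exI[of _ "c # cs"]) simp
qed

section \<open>Cutting outputs into blocks and decoding block by block\<close>

definition chunks :: "nat \<Rightarrow> nat \<Rightarrow> 'a list \<Rightarrow> 'a list list" where
  "chunks n b ys = map (\<lambda>i. take n (drop (i * n) ys)) [0..<b]"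

lemma chunks_concat:
  assumes "\<forall>y\<in>set bs. length y = n"
  shows "chunks n (length bs) (concat bs @ zs) = bs"
  using assms
proof (induction bs)
  case (Cons y bs)
  have "map (\<lambda>i. take n (drop (i * n) (concat (y # bs) @ zs))) [0..<Suc (length bs)] =
    take n (y @ concat bs @ zs) # map (\<lambda>i. take n (drop (Suc i * n) (y @ concat bs @ zs))) [0..<length bs]"
    by (simp only: map_upt_Suc) simp
  also have "\<dots> = y # chunks n (length bs) (concat bs @ zs)"
    using Cons.prems by (simp add: chunks_def)
  finally show ?case using Cons by (simp add: chunks_def)
qed (simp add: chunks_def)

text \<open>The list \<open>bs\<close> may be shorter than that of the codes: the value is the index
  after the blocks observed so far, which Receiver 1 can compute alone.\<close>

primrec idx_state :: "('x, 'y1, 'y2) list_code list \<Rightarrow> nat \<Rightarrow> 'y1 list list \<Rightarrow> nat" where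
  "idx_state [] k bs = k"
| "idx_state (c # cs) k bs = (if bs = [] then k else idx_state cs (next_idx c k (hd bs)) (tl bs))"

primrec own_decs :: "('x, 'y1, 'y2) list_code list \<Rightarrow> nat \<Rightarrow> 'y1 list list \<Rightarrow> nat list" where
  "own_decs [] k bs = []"
| "own_decs (c # cs) k bs = own_dec c k (hd bs) # own_decs cs (next_idx c k (hd bs)) (tl bs)"

text \<open>A satellite is decoded only with the bin index found in the following cloud. The last
  block has no successor, so the result is one entry shorter than the list of codes.\<close>

fun sat_decs :: "('x, 'y1, 'y2) list_code list \<Rightarrow> 'y2 list list \<Rightarrow> nat list" where
  "sat_decs (c # c' # cs) bs =
     sat_dec c (fst (cloud_dec c (hd bs))) (snd (cloud_dec c (hd bs))) (snd (cloud_dec c' (hd (tl bs)))) (hd bs)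
     # sat_decs (c' # cs) (tl bs)"
| "sat_decs _ bs = []"

lemma own_decs_correct:
  assumes "\<not> run_err cs ms k ys" "length ms = length cs" "length ys = length cs"
  shows "own_decs cs k (map (map fst) ys) = map fst ms"
  using assms
proof (induction cs arbitrary: ms k ys)
  case (Cons c cs)
  then obtain m ms' y ys' where "ms = m # ms'" "ys = y # ys'" by (metis length_Suc_conv)
  with Cons show ?case by (simp add: block_err_def)
qed simp

lemma sat_decs_correct:
  assumes "\<not> run_err cs ms k ys" "length ms = length cs" "length ys = length cs"
  shows "sat_decs cs (map (map snd) ys) = butlast (map snd ms)"
  using assms
proof (induction cs "map (map snd) ys" arbitrary: ms k ys rule: sat_decs.induct)
  case (1 c c' cs)
  then obtain m m' ms' y y' ys' where eq: "ms = m # m' # ms'" "ys = y # y' # ys'"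
    by (metis length_Suc_conv)
  have "sat_decs (c' # cs) (map (map snd) (tl ys)) = butlast (map snd (tl ms))"
    by (rule 1(1)[of _ _ "next_idx c k (map fst y)"]) (use 1 eq in \<open>simp_all add: map_tl\<close>)
  with 1(2) eq show ?case by (simp add: block_err_def next_idx_def)
next
  case ("2_2" c)
  then show ?case by (cases ms) auto
qed auto

lemma idx_state_less:
  assumes "\<forall>c\<in>set cs. \<forall>i k y. bin_idx c i k y < K" "k < K"
  shows "idx_state cs k bs < K"
  using assms by (induction cs arbitrary: k bs) (auto simp: next_idx_def)

section \<open>Transmission with feedback as an adaptive process\<close>

primrec adapt :: "('x, 'y1, 'y2) dmbc \<Rightarrow> (('y1 \<times> 'y2) list \<Rightarrow> 'x) \<Rightarrow> ('y1 \<times> 'y2) list \<Rightarrow> nat \<Rightarrow>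
    ('y1 \<times> 'y2) list pmf" where
  "adapt W F h 0 = return_pmf h"
| "adapt W F h (Suc n) = W (F h) \<bind> (\<lambda>y. adapt W F (h @ [y]) n)"

lemma adapt_add: "adapt W F h (m + n) = adapt W F h m \<bind> (\<lambda>h'. adapt W F h' n)"
  by (induction m arbitrary: h) (simp_all add: bind_return_pmf bind_assoc_pmf)

lemma adapt_Suc_right: "adapt W F h (Suc n) = adapt W F h n \<bind> (\<lambda>h'. W (F h') \<bind> (\<lambda>y. return_pmf (h' @ [y])))"
  using adapt_add[of W F h n 1] by simp

lemma length_transmit: "ys \<in> set_pmf (transmit W c m1 m2 n) \<Longrightarrow> length ys = n"
  by (induction n arbitrary: ys) (auto simp: Let_def)

text \<open>\<open>transmit\<close> extends a history at its end, while \<open>run\<close> peels off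
  the first block. \<open>adapt\<close> carries the history along and, by \<open>adapt_add\<close>,
  can be split at any time; it mediates between the two.\<close>

lemma transmit_eq_adapt:
  "transmit W c m1 m2 n = adapt W (\<lambda>h. enc c (Suc (length h)) m1 m2
     (map (\<lambda>s. fb_enc c s (map fst (take s h))) [1..<Suc (length h)])) [] n"
proof (induction n)
  case (Suc n)
  show ?case
    unfolding transmit.simps adapt_Suc_right Suc[symmetric]
    by (rule bind_pmf_cong) (auto dest!: length_transmit simp: Let_def case_prod_unfold)
qed simp

text \<open>Causality: later channel uses do not disturb the law of earlier outputs. This disposes
  of the padding when the blocklength is not a multiple of the block size.\<close>

lemma transmit_take: "map_pmf (take m) (transmit W c m1 m2 (m + d)) = transmit W c m1 m2 m"
proof (induction d)
  case 0
  have "map_pmf (take m) (transmit W c m1 m2 m) = map_pmf id (transmit W c m1 m2 m)"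
    by (rule map_pmf_cong) (auto dest: length_transmit)
  then show ?case by (simp add: pmf.map_id)
next
  case (Suc d)
  have "map_pmf (take m) (transmit W c m1 m2 (m + Suc d)) =
    transmit W c m1 m2 (m + d) \<bind> (\<lambda>ys. W (enc c (Suc (m + d)) m1 m2
       (map (\<lambda>s. fb_enc c s (map fst (take s ys))) [1..<Suc (m + d)])) \<bind> (\<lambda>y. return_pmf (take m ys)))"
    by (auto simp: map_bind_pmf Let_def case_prod_unfold dest: length_transmit intro!: bind_pmf_cong)
  also have "\<dots> = map_pmf (take m) (transmit W c m1 m2 (m + d))"
    by (simp add: map_pmf_def)
  finally show ?case using Suc by simp
qed

text \<open>Within a block the input ignores the outputs of that same block, so the block sees a
  product channel.\<close>

lemma adapt_block:
  fixes W :: "('x, 'y1, 'y2) dmbc"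
  assumes "\<And>zs. length zs < length x \<Longrightarrow> F (h @ zs) = x ! length zs"
  shows "adapt W F h (length x) = list_pmf (map W x) \<bind> (\<lambda>zs. return_pmf (h @ zs))"
  using assms
proof (induction x arbitrary: h)
  case (Cons a x)
  have "adapt W F (h @ [y]) (length x) = list_pmf (map W x) \<bind> (\<lambda>zs. return_pmf ((h @ [y]) @ zs))" for y
  proof (rule Cons.IH)
    fix zs :: "('y1 \<times> 'y2) list" assume "length zs < length x"
    then show "F ((h @ [y]) @ zs) = x ! length zs" using Cons.prems[of "y # zs"] by simp
  qed
  then show ?case using Cons.prems[of "[]"] by (simp add: bind_assoc_pmf bind_return_pmf)
qed (simp add: bind_return_pmf)

lemma adapt_run:
  fixes W :: "('x, 'y1, 'y2) dmbc" and cs :: "('x, 'y1, 'y2) list_code list"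
  assumes "\<And>bs zs. length bs < length cs \<Longrightarrow> \<forall>y\<in>set bs. length y = n \<Longrightarrow> length zs < n \<Longrightarrow>
      F (h @ concat bs @ zs) = word (cs ! length bs) (fst (ms ! length bs))
        (idx_state cs k (map (map fst) bs)) (snd (ms ! length bs)) ! length zs"
    and "length ms = length cs" and len: "\<forall>c\<in>set cs. \<forall>i k j. length (word c i k j) = n"
  shows "adapt W F h (length cs * n) = map_pmf (\<lambda>bs. h @ concat bs) (run W cs ms k)"
  using assms
proof (induction cs arbitrary: h ms k)
  case (Cons c cs)
  obtain m ms' where ms: "ms = m # ms'" using Cons.prems(2) by (cases ms) auto
  let ?x = "word c (fst m) k (snd m)"
  have n: "length ?x = n" using Cons.prems(3) by simp
  have block: "adapt W F h n = list_pmf (map W ?x) \<bind> (\<lambda>zs. return_pmf (h @ zs))"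
    using adapt_block[of ?x F h W] Cons.prems(1)[of "[]"] n ms by simp
  have rest: "adapt W F (h @ y) (length cs * n) = map_pmf (\<lambda>bs. (h @ y) @ concat bs) (run W cs ms' (next_idx c k (map fst y)))"
    if "length y = n" for y
  proof (rule Cons.IH)
    fix bs :: "('y1 \<times> 'y2) list list" and zs :: "('y1 \<times> 'y2) list"
    assume "length bs < length cs" "\<forall>y\<in>set bs. length y = n" "length zs < n"
    then show "F ((h @ y) @ concat bs @ zs) = word (cs ! length bs) (fst (ms' ! length bs))
        (idx_state cs (next_idx c k (map fst y)) (map (map fst) bs)) (snd (ms' ! length bs)) ! length zs"
      using Cons.prems(1)[of "y # bs" zs] that ms by simp
  qed (use Cons.prems ms in auto)
  have "adapt W F h (length (c # cs) * n) = list_pmf (map W ?x) \<bind> (\<lambda>zs. adapt W F (h @ zs) (length cs * n))"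
    using adapt_add[of W F h n "length cs * n"] block by (simp add: bind_assoc_pmf bind_return_pmf)
  also have "\<dots> = list_pmf (map W ?x) \<bind> (\<lambda>y. map_pmf (\<lambda>bs. (h @ y) @ concat bs) (run W cs ms' (next_idx c k (map fst y))))"
    by (rule bind_pmf_cong) (use rest n in \<open>auto dest: length_list_pmf\<close>)
  finally show ?case by (simp add: ms map_bind_pmf map_pmf_def bind_assoc_pmf bind_return_pmf)
qed simp

lemma length_run: "ys \<in> set_pmf (run W cs ms k) \<Longrightarrow> length ys = length cs"
  by (induction cs arbitrary: ms k ys) auto

lemma length_run_blocks:
  assumes "ys \<in> set_pmf (run W cs ms k)" "\<forall>c\<in>set cs. \<forall>i k j. length (word c i k j) = n" "y \<in> set ys"
  shows "length y = n"
  using assms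
proof (induction cs arbitrary: ms k ys)
  case (Cons c cs)
  then show ?case using length_list_pmf[of y] by auto
qed simp

text \<open>The fallback 1 keeps the decoders inside the message set, as \<open>valid_code\<close>
  demands, on lists that encode no message.\<close>

definition unindex :: "nat \<Rightarrow> (nat \<Rightarrow> nat list) \<Rightarrow> nat list \<Rightarrow> nat" where
  "unindex r g l = (if l \<in> g ` {1..r} then inv_into {1..r} g l else 1)"

text \<open>Feedback is nontrivial only at the end of a block that has a successor; at all other
  times the alphabet is a singleton. The appended pair \<open>(0, 0)\<close> is dummy content of the
  last block, which only delivers a bin index. Times start at 1 and list positions at 0: the symbol
  of time \<open>b * n\<close> is \<open>vs ! (b * n - 1)\<close>, and \<open>t - 1\<close> locates
  time \<open>t\<close> in its block.\<close>

definition multi_code :: "nat \<Rightarrow> nat \<Rightarrow> nat \<Rightarrow> nat \<Rightarrow> (nat \<Rightarrow> nat list) \<Rightarrow> (nat \<Rightarrow> nat list) \<Rightarrow>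
    ('x, 'y1, 'y2) list_code list \<Rightarrow> ('x, 'y1, 'y2) fb_code" where
  "multi_code n K r1 r2 g1 g2 cs = \<lparr>
     fb_alphabet = \<lambda>t. if n dvd t \<and> t div n < length cs then {..<K} else {0},
     fb_enc = \<lambda>t ys. if n dvd t \<and> t div n < length cs then idx_state cs 0 (chunks n (t div n) ys) else 0,
     enc = \<lambda>t m1 m2 vs. let b = (t - 1) div n; ms = zip (g1 m1) (g2 m2) @ [(0, 0)] in
       word (cs ! b) (fst (ms ! b)) (if b = 0 then 0 else vs ! (b * n - 1)) (snd (ms ! b)) ! ((t - 1) mod n),
     dec1 = \<lambda>ys. unindex r1 g1 (butlast (own_decs cs 0 (chunks n (length cs) ys))),
     dec2 = \<lambda>ys. unindex r2 g2 (sat_decs cs (chunks n (length cs) ys))\<rparr>"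

lemma chunks_append_take:
  assumes "length ys \<ge> b * n"
  shows "chunks n b (take (b * n) ys) = chunks n b ys"
proof -
  have "take n (drop (i * n) (take (b * n) ys)) = take n (drop (i * n) ys)" if "i < b" for i
  proof -
    have "n + i * n \<le> b * n" using that by (metis Suc_leI mult_Suc mult_le_mono1)
    then show ?thesis by (simp add: drop_take min_def)
  qed
  then show ?thesis by (auto simp: chunks_def)
qed

lemma transmit_multi_code:
  fixes cs :: "('x, 'y1, 'y2) list_code list" and W :: "('x, 'y1, 'y2) dmbc"
  assumes n: "n > 0" and len: "\<forall>c\<in>set cs. \<forall>i k j. length (word c i k j) = n"
    and B: "length (g1 m1) = B" "length (g2 m2) = B" "length cs = Suc B"
  shows "transmit W (multi_code n K r1 r2 g1 g2 cs) m1 m2 (length cs * n) =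
    map_pmf concat (run W cs (zip (g1 m1) (g2 m2) @ [(0, 0)]) 0)"
proof -
  let ?c = "multi_code n K r1 r2 g1 g2 cs"
  let ?ms = "zip (g1 m1) (g2 m2) @ [(0, 0)]"
  define F where "F h = enc ?c (Suc (length h)) m1 m2
     (map (\<lambda>s. fb_enc ?c s (map fst (take s h))) [1..<Suc (length h)])" for h :: "('y1 \<times> 'y2) list"
  have "adapt W F [] (length cs * n) = map_pmf (\<lambda>bs. [] @ concat bs) (run W cs ?ms 0)"
  proof (rule adapt_run)
    fix bs :: "('y1 \<times> 'y2) list list" and zs :: "('y1 \<times> 'y2) list"
    assume bs: "length bs < length cs" "\<forall>y\<in>set bs. length y = n" and zs: "length zs < n"
    let ?h = "concat bs @ zs" and ?b = "length bs"
    have lc: "length (concat bs) = ?b * n"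
      using bs(2) by (induction bs) auto
    have div: "length ?h div n = ?b" and mod: "length ?h mod n = length zs" using lc zs by auto
    have st: "(if ?b = 0 then 0 else map (\<lambda>s. fb_enc ?c s (map fst (take s ?h))) [1..<Suc (length ?h)] ! (?b * n - 1))
      = idx_state cs 0 (map (map fst) bs)"
    proof (cases "?b = 0")
      case True then show ?thesis by (cases cs) auto
    next
      case False
      then have pos: "?b * n > 0" using n by simp
      have "map (\<lambda>s. fb_enc ?c s (map fst (take s ?h))) [1..<Suc (length ?h)] ! (?b * n - 1) =
        fb_enc ?c (?b * n) (map fst (take (?b * n) ?h))"
      proof -
        have "?b * n - 1 < length ?h" using pos lc by (simp add: diff_less trans_less_add1)
        then show ?thesis using pos by (subst nth_map) (simp_all del: upt_Suc add: nth_upt)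
      qed
      also have "\<dots> = idx_state cs 0 (chunks n ?b (map fst (concat bs)))"
        using lc bs n by (simp add: multi_code_def)
      also have "chunks n ?b (map fst (concat bs)) = map (map fst) bs"
        using chunks_concat[of "map (map fst) bs" n "[]"] bs by (simp add: map_concat)
      finally show ?thesis using False by simp
    qed
    have "F ?h = word (cs ! ?b) (fst (?ms ! ?b)) (if ?b = 0 then 0 else
       map (\<lambda>s. fb_enc ?c s (map fst (take s ?h))) [1..<Suc (length ?h)] ! (?b * n - 1)) (snd (?ms ! ?b)) ! length zs"
      unfolding F_def using div mod by (simp add: multi_code_def Let_def)
    then show "F ([] @ ?h) = word (cs ! ?b) (fst (?ms ! ?b))
        (idx_state cs 0 (map (map fst) bs)) (snd (?ms ! ?b)) ! length zs" using st by simp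
  qed (use assms in auto)
  then show ?thesis unfolding transmit_eq_adapt F_def by simp
qed

lemma num_msgs_pos: "0 \<le> R \<Longrightarrow> 1 \<le> num_msgs N R"
  by (simp add: num_msgs_def le_nat_iff le_floor_iff ge_one_powr_ge_zero)

text \<open>Messages are injected into lists of \<open>B\<close> block messages, and
  \<open>Suc B\<close> blocks are used. Channel uses beyond \<open>Suc B * n\<close> are padding, so
  that \<open>N\<close> can be arbitrary.\<close>

lemma multi_block:
  fixes W :: "('x, 'y1, 'y2) dmbc"
  assumes ex: "block_reliable W n M1 K M2 (ennreal \<epsilon>)"
    and pos: "n > 0" "K > 0" "M1 > 0" "M2 > 0" "\<epsilon> \<ge> 0" "R1 \<ge> 0" "R2 \<ge> 0"
    and r1: "num_msgs N R1 \<le> M1 ^ B" and r2: "num_msgs N R2 \<le> M2 ^ B"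
    and fb: "real (K ^ B) \<le> 2 powr (real N * RFB)" and N: "Suc B * n \<le> N"
  shows "\<exists>c :: ('x, 'y1, 'y2) fb_code. valid_code N RFB R1 R2 c \<and> error_prob W N R1 R2 c \<le> real (Suc B) * \<epsilon>"
proof -
  define S1 where "S1 = {1..num_msgs N R1}"
  define S2 where "S2 = {1..num_msgs N R2}"
  have S: "finite S1" "S1 \<noteq> {}" "finite S2" "S2 \<noteq> {}" "1 \<in> S1" "1 \<in> S2"
    using num_msgs_pos[OF pos(6), of N] num_msgs_pos[OF pos(7), of N] by (auto simp: S1_def S2_def)
  have "\<exists>g. g ` S1 \<subseteq> {l. set l \<subseteq> {..<M1} \<and> length l = B} \<and> inj_on g S1"
    using r1 by (intro card_le_inj) (auto simp: S1_def finite_lists_length_eq card_lists_length_eq)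
  then obtain g1 where g1: "g1 ` S1 \<subseteq> {l. set l \<subseteq> {..<M1} \<and> length l = B}" "inj_on g1 S1" by blast
  have "\<exists>g. g ` S2 \<subseteq> {l. set l \<subseteq> {..<M2} \<and> length l = B} \<and> inj_on g S2"
    using r2 by (intro card_le_inj) (auto simp: S2_def finite_lists_length_eq card_lists_length_eq)
  then obtain g2 where g2: "g2 ` S2 \<subseteq> {l. set l \<subseteq> {..<M2} \<and> length l = B}" "inj_on g2 S2" by blast
  define MS where "MS m1 m2 = zip (g1 m1) (g2 m2) @ [(0, 0)]" for m1 m2
  define PM where "PM = pair_pmf (pmf_of_set S1) (pmf_of_set S2)"
  have PM: "set_pmf PM = S1 \<times> S2" using S by (simp add: PM_def)
  have g1l: "length (g1 m) = B" "set (g1 m) \<subseteq> {..<M1}" if "m \<in> S1" for m using g1 that by auto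
  have g2l: "length (g2 m) = B" "set (g2 m) \<subseteq> {..<M2}" if "m \<in> S2" for m using g2 that by auto
  have "\<exists>cs. length cs = Suc B \<and> (\<forall>c\<in>set cs. (\<forall>i k j. length (word c i k j) = n) \<and> (\<forall>i k y. bin_idx c i k y < K)) \<and>
     (\<integral>\<^sup>+(ms, k). \<integral>\<^sup>+ys. of_bool (run_err cs ms k ys) \<partial>run W cs ms k \<partial>measure_pmf (map_pmf (\<lambda>(m1, m2). (MS m1 m2, 0)) PM))
       \<le> of_nat (Suc B) * ennreal \<epsilon>"
  proof (rule exists_run)
    fix \<mu> :: "(nat \<times> nat \<times> nat) pmf"
    assume "set_pmf \<mu> \<subseteq> {..<M1} \<times> {..<K} \<times> {..<M2}"
    with ex show "\<exists>c :: ('x, 'y1, 'y2) list_code. ((\<forall>i k j. length (word c i k j) = n) \<and> (\<forall>i k y. bin_idx c i k y < K)) \<and>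
      avg_block_err W c \<mu> \<le> ennreal \<epsilon>" unfolding block_reliable_def by blast
  next
    fix ms :: "(nat \<times> nat) list" and k :: nat
    assume "(ms, k) \<in> set_pmf (map_pmf (\<lambda>(m1, m2). (MS m1 m2, 0)) PM)"
    then obtain m1 m2 where m: "m1 \<in> S1" "m2 \<in> S2" "ms = MS m1 m2" "k = 0" by (auto simp: PM)
    have "set (zip (g1 m1) (g2 m2)) \<subseteq> {..<M1} \<times> {..<M2}"
      using g1l[OF m(1)] g2l[OF m(2)] by (auto dest: set_zip_leftD set_zip_rightD)
    then show "length ms = Suc B \<and> set ms \<subseteq> {..<M1} \<times> {..<M2} \<and> k < K"
      using m g1l g2l pos by (auto simp: MS_def)
  qed auto
  then obtain cs where cs: "length cs = Suc B" "\<forall>c\<in>set cs. \<forall>i k j. length (word c i k j) = n"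
    "\<forall>c\<in>set cs. \<forall>i k y. bin_idx c i k y < K"
    "(\<integral>\<^sup>+(m1, m2). \<integral>\<^sup>+ys. of_bool (run_err cs (MS m1 m2) 0 ys) \<partial>run W cs (MS m1 m2) 0 \<partial>measure_pmf PM)
       \<le> of_nat (Suc B) * ennreal \<epsilon>"
    by (auto simp: case_prod_unfold)
  define c where "c = multi_code n K (num_msgs N R1) (num_msgs N R2) g1 g2 cs"
  have unindex_in: "unindex (num_msgs N R1) g1 l \<in> S1" "unindex (num_msgs N R2) g2 l \<in> S2" for l
    using S inv_into_into[of l g1 S1] inv_into_into[of l g2 S2]
    unfolding unindex_def S1_def[symmetric] S2_def[symmetric] by auto
  have unindex: "m \<in> S1 \<Longrightarrow> unindex (num_msgs N R1) g1 (g1 m) = m" "m \<in> S2 \<Longrightarrow> unindex (num_msgs N R2) g2 (g2 m) = m" for m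
    using g1(2) g2(2) unfolding unindex_def S1_def[symmetric] S2_def[symmetric] by auto
  have "(\<Prod>t=1..N. card (fb_alphabet c t)) = (\<Prod>t\<in>{1..N}. if n dvd t \<and> t div n < Suc B then K else 1)"
    by (intro prod.cong) (auto simp: c_def multi_code_def cs)
  also have "\<dots> = (\<Prod>t\<in>{t\<in>{1..N}. n dvd t \<and> t div n < Suc B}. K)"
    by (simp add: prod.If_cases Int_def)
  \<comment> \<open>The condition \<open>t div n < Suc B\<close> excludes the end of the last block
    and the padding, which leaves exactly \<open>B\<close> feedback times.\<close>
  also have "{t\<in>{1..N}. n dvd t \<and> t div n < Suc B} = (\<lambda>b. b * n) ` {1..B}"
  proof (intro equalityI subsetI)
    fix t assume "t \<in> {t\<in>{1..N}. n dvd t \<and> t div n < Suc B}"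
    then have "t = (t div n) * n" "t div n \<in> {1..B}" using pos
      by (auto simp: Suc_le_eq div_greater_zero_iff dvd_imp_le)
    then show "t \<in> (\<lambda>b. b * n) ` {1..B}" by blast
  next
    fix t assume "t \<in> (\<lambda>b. b * n) ` {1..B}"
    then obtain b where "t = b * n" "b \<in> {1..B}" by blast
    then have b: "t = b * n" "1 \<le> b" "b \<le> B" by auto
    have "b * n \<le> Suc B * n" using b by (intro mult_le_mono1) simp
    with b pos N show "t \<in> {t\<in>{1..N}. n dvd t \<and> t div n < Suc B}" by auto
  qed
  also have "(\<Prod>t\<in>(\<lambda>b. b * n) ` {1..B}. K) = K ^ B"
    using pos by (simp add: card_image inj_on_def)
  finally have fb_card: "(\<Prod>t=1..N. card (fb_alphabet c t)) = K ^ B" .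
  have valid: "valid_code N RFB R1 R2 c"
    unfolding valid_code_def fb_card
  proof (intro conjI)
    show "\<forall>t\<in>{1..N}. finite (fb_alphabet c t)" by (simp add: c_def multi_code_def)
    show "real (K ^ B) \<le> 2 powr (real N * RFB)" by fact
    show "\<forall>t\<in>{1..N}. \<forall>ys. length ys = t \<longrightarrow> fb_enc c t ys \<in> fb_alphabet c t"
      using idx_state_less[OF cs(3)] pos by (auto simp: c_def multi_code_def)
    show "\<forall>ys. length ys = N \<longrightarrow> dec1 c ys \<in> {1..num_msgs N R1}"
      "\<forall>ys. length ys = N \<longrightarrow> dec2 c ys \<in> {1..num_msgs N R2}"
      using unindex_in by (auto simp: c_def multi_code_def S1_def S2_def)
  qed
  have correct: "dec1 c (map fst ys) = m1 \<and> dec2 c (map snd ys) = m2"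
    if "m1 \<in> S1" "m2 \<in> S2" "take (Suc B * n) ys = concat bs" "length ys = N"
      "\<not> run_err cs (MS m1 m2) 0 bs" "bs \<in> set_pmf (run W cs (MS m1 m2) 0)" for ys bs m1 m2
  proof -
    have lb: "length bs = Suc B" using length_run[OF that(6)] cs by simp
    have ln: "\<forall>y\<in>set bs. length y = n" using length_run_blocks[OF that(6)] cs by blast
    have ch: "chunks n (Suc B) (map f ys) = map (map f) bs" for f :: "'y1 \<times> 'y2 \<Rightarrow> 'z"
    proof -
      have "chunks n (Suc B) (map f ys) = chunks n (Suc B) (take (Suc B * n) (map f ys))"
        using N that by (subst chunks_append_take) auto
      also have "take (Suc B * n) (map f ys) = concat (map (map f) bs) @ []"
        using that by (simp only: take_map map_concat append_Nil2)
      also have "chunks n (Suc B) \<dots> = map (map f) bs"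
        using chunks_concat[of "map (map f) bs" n "[]"] ln lb by simp
      finally show ?thesis .
    qed
    have lm: "length (MS m1 m2) = length cs" "length bs = length cs"
      using that g1l g2l cs lb by (auto simp: MS_def)
    \<comment> \<open>The trailing 0 is the decision in the dummy block; \<open>dec1\<close> removes
      it by \<open>butlast\<close>.\<close>
    have "own_decs cs 0 (map (map fst) bs) = g1 m1 @ [0]"
      using own_decs_correct[OF that(5) lm] that g1l g2l by (simp add: MS_def)
    moreover have "sat_decs cs (map (map snd) bs) = g2 m2"
      using sat_decs_correct[OF that(5) lm] that g1l g2l by (simp add: MS_def)
    ultimately show ?thesis using that unindex cs(1) by (simp add: c_def multi_code_def ch)
  qed
  have step: "(\<integral>\<^sup>+ys. of_bool (dec1 c (map fst ys) \<noteq> m1 \<or> dec2 c (map snd ys) \<noteq> m2) \<partial>transmit W c m1 m2 N) \<le>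
     (\<integral>\<^sup>+ys. of_bool (run_err cs (MS m1 m2) 0 ys) \<partial>run W cs (MS m1 m2) 0 :: ennreal)"
    if m: "m1 \<in> S1" "m2 \<in> S2" for m1 m2
  proof -
    obtain d where d: "N = Suc B * n + d" using N le_Suc_ex by blast
    have eq: "map_pmf (take (Suc B * n)) (transmit W c m1 m2 N) = map_pmf concat (run W cs (MS m1 m2) 0)"
      unfolding d transmit_take MS_def c_def cs(1)[symmetric]
      by (rule transmit_multi_code) (use pos cs m g1l g2l in auto)
    \<comment> \<open>Success is expressed through the first \<open>Suc B * n\<close> outputs alone,
      so that \<open>transmit_take\<close> applies although the decoders receive all
      \<open>N\<close> outputs.\<close>
    define D where "D h \<longleftrightarrow> (\<exists>bs\<in>set_pmf (run W cs (MS m1 m2) 0). h = concat bs \<and> \<not> run_err cs (MS m1 m2) 0 bs)" for h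
    have "(\<integral>\<^sup>+ys. of_bool (dec1 c (map fst ys) \<noteq> m1 \<or> dec2 c (map snd ys) \<noteq> m2) \<partial>transmit W c m1 m2 N) \<le>
      (\<integral>\<^sup>+ys. of_bool (\<not> D (take (Suc B * n) ys)) \<partial>transmit W c m1 m2 N)"
    proof (rule nn_integral_pmf_mono)
      fix ys assume "ys \<in> set_pmf (transmit W c m1 m2 N)"
      then have "length ys = N" by (rule length_transmit)
      then show "of_bool (dec1 c (map fst ys) \<noteq> m1 \<or> dec2 c (map snd ys) \<noteq> m2) \<le> (of_bool (\<not> D (take (Suc B * n) ys)) :: ennreal)"
        using correct[OF m] by (auto simp: D_def of_bool_def)
    qed
    also have "\<dots> = (\<integral>\<^sup>+h. of_bool (\<not> D h) \<partial>map_pmf (take (Suc B * n)) (transmit W c m1 m2 N))" by simp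
    also have "\<dots> = (\<integral>\<^sup>+bs. of_bool (\<not> D (concat bs)) \<partial>run W cs (MS m1 m2) 0)" unfolding eq by simp
    also have "\<dots> \<le> (\<integral>\<^sup>+bs. of_bool (run_err cs (MS m1 m2) 0 bs) \<partial>run W cs (MS m1 m2) 0)"
      by (rule nn_integral_pmf_mono) (auto simp: D_def of_bool_def)
    finally show ?thesis .
  qed
  have "ennreal (error_prob W N R1 R2 c) =
    (\<integral>\<^sup>+(m1, m2). \<integral>\<^sup>+ys. of_bool (dec1 c (map fst ys) \<noteq> m1 \<or> dec2 c (map snd ys) \<noteq> m2) \<partial>transmit W c m1 m2 N \<partial>PM)"
    unfolding error_prob_def nn_integral_of_bool_pmf[symmetric] S1_def[symmetric] S2_def[symmetric] PM_def[symmetric]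
    by (simp add: case_prod_unfold)
  also have "\<dots> \<le> (\<integral>\<^sup>+(m1, m2). \<integral>\<^sup>+ys. of_bool (run_err cs (MS m1 m2) 0 ys) \<partial>run W cs (MS m1 m2) 0 \<partial>PM)"
    by (rule nn_integral_pmf_mono) (use step PM in auto)
  also have "\<dots> \<le> of_nat (Suc B) * ennreal \<epsilon>" by (rule cs)
  also have "\<dots> = ennreal (real (Suc B) * \<epsilon>)"
    using pos by (simp add: ennreal_mult ennreal_of_nat_eq_real_of_nat del: of_nat_Suc)
  finally have "error_prob W N R1 R2 c \<le> real (Suc B) * \<epsilon>"
    using pos by (simp add: ennreal_le_iff del: of_nat_Suc)
  with valid show ?thesis by blast
qed

section \<open>Products of letters\<close>

lemma pmf_bind_map_Pair:
  "pmf (p \<bind> (\<lambda>x. map_pmf (Pair x) (K x))) (x, y) = pmf p x * pmf (K x) y"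
proof -
  have "ennreal (pmf (p \<bind> (\<lambda>x. map_pmf (Pair x) (K x))) (x, y)) =
    (\<integral>\<^sup>+x'. ennreal (pmf (map_pmf (Pair x') (K x')) (x, y)) \<partial>measure_pmf p)"
    by (simp add: ennreal_pmf_bind)
  also have "\<dots> = (\<integral>\<^sup>+x'. ennreal (pmf (K x) y) * indicator {x} x' \<partial>measure_pmf p)"
  proof (rule nn_integral_cong)
    fix x'
    have "pmf (map_pmf (Pair x') (K x')) (x, y) = (if x' = x then pmf (K x) y else 0)"
    proof (cases "x' = x")
      case True
      then show ?thesis using pmf_map_inj'[of "Pair x" "K x" y] by (simp add: inj_def)
    next
      case False
      then show ?thesis by (auto simp: pmf_eq_0_set_pmf)
    qed
    then show "ennreal (pmf (map_pmf (Pair x') (K x')) (x, y)) = ennreal (pmf (K x) y) * indicator {x} x'"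
      by (simp add: indicator_def)
  qed
  also have "\<dots> = ennreal (pmf p x * pmf (K x) y)"
    by (simp add: nn_integral_cmult emeasure_pmf_single ennreal_mult mult.commute)
  finally show ?thesis by simp
qed

lemma pmf_list_pmf:
  "length ps = length xs \<Longrightarrow> pmf (list_pmf ps) xs = prod_list (map2 pmf ps xs)"
proof (induction ps xs rule: list_induct2)
  case (Cons p ps x xs)
  have "list_pmf (p # ps) = map_pmf (\<lambda>(x, xs). x # xs) (p \<bind> (\<lambda>x. map_pmf (Pair x) (list_pmf ps)))"
    by (simp add: map_bind_pmf map_pmf_def bind_assoc_pmf bind_return_pmf)
  moreover have "inj (\<lambda>(x, xs). x # xs)" by (auto simp: inj_def)
  ultimately have "pmf (list_pmf (p # ps)) (x # xs) = pmf (p \<bind> (\<lambda>x. map_pmf (Pair x) (list_pmf ps))) (x, xs)"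
    using pmf_map_inj'[of "\<lambda>(x, xs). x # xs" "p \<bind> (\<lambda>x. map_pmf (Pair x) (list_pmf ps))" "(x, xs)"] by simp
  then show ?case using Cons by (simp add: pmf_bind_map_Pair)
qed simp

text \<open>Drawing a list and then a second one through a memoryless kernel is the same as drawing
  independent pairs. Repeated use turns a whole block into independent letters.\<close>

lemma nn_integral_replicate_chain:
  "(\<integral>\<^sup>+zs. \<integral>\<^sup>+ws. F zs ws \<partial>list_pmf (map K zs) \<partial>replicate_pmf n p) =
   (\<integral>\<^sup>+us. F (map fst us) (map snd us) \<partial>replicate_pmf n (p \<bind> (\<lambda>z. map_pmf (Pair z) (K z))))"
proof (induction n arbitrary: F)
  case (Suc n)
  have "(\<integral>\<^sup>+zs. \<integral>\<^sup>+ws. F zs ws \<partial>list_pmf (map K zs) \<partial>replicate_pmf (Suc n) p) =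
    (\<integral>\<^sup>+z. \<integral>\<^sup>+zs. \<integral>\<^sup>+w. \<integral>\<^sup>+ws. F (z # zs) (w # ws) \<partial>list_pmf (map K zs) \<partial>K z \<partial>replicate_pmf n p \<partial>p)"
    by simp
  also have "\<dots> = (\<integral>\<^sup>+z. \<integral>\<^sup>+w. \<integral>\<^sup>+zs. \<integral>\<^sup>+ws. F (z # zs) (w # ws) \<partial>list_pmf (map K zs) \<partial>replicate_pmf n p \<partial>K z \<partial>p)"
    by (subst nn_integral_pmf_swap) simp
  also have "\<dots> = (\<integral>\<^sup>+z. \<integral>\<^sup>+w. \<integral>\<^sup>+us. F (z # map fst us) (w # map snd us)
      \<partial>replicate_pmf n (p \<bind> (\<lambda>z. map_pmf (Pair z) (K z))) \<partial>K z \<partial>p)"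
    by (subst Suc) simp
  finally show ?case by simp
qed simp

section \<open>Likelihood-ratio tests on lists: packing and tail bounds\<close>

lemma nn_integral_pmf_cmult:
  fixes f :: "'a \<Rightarrow> ennreal"
  shows "(\<integral>\<^sup>+x. c * f x \<partial>measure_pmf p) = c * (\<integral>\<^sup>+x. f x \<partial>measure_pmf p)"
  by (rule nn_integral_cmult) simp

lemma list_packing:
  fixes g :: "'a \<Rightarrow> 'v \<Rightarrow> 'b \<Rightarrow> real"
  assumes le: "\<And>a b. (\<integral>\<^sup>+v. ennreal (g a v b) \<partial>measure_pmf (P a)) \<le> 1" and nn: "\<And>a v b. 0 \<le> g a v b"
  shows "(\<integral>\<^sup>+vs. ennreal (prod_list (map (\<lambda>(a, v, b). g a v b) (zip as (zip vs bs)))) \<partial>list_pmf (map P as)) \<le> 1"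
proof (induction as arbitrary: bs)
  case (Cons a as)
  have nnp: "0 \<le> prod_list (map (\<lambda>(a, v, b). g a v b) xs)" for xs
    by (induction xs) (auto simp: nn)
  show ?case
  proof (cases bs)
    case (Cons b bs')
    have "(\<integral>\<^sup>+vs. ennreal (prod_list (map (\<lambda>(a, v, b). g a v b) (zip (a # as) (zip vs bs)))) \<partial>list_pmf (map P (a # as))) =
      (\<integral>\<^sup>+v. \<integral>\<^sup>+vs. ennreal (g a v b) * ennreal (prod_list (map (\<lambda>(a, v, b). g a v b) (zip as (zip vs bs'))))
         \<partial>list_pmf (map P as) \<partial>measure_pmf (P a))"
      by (simp add: Cons ennreal_mult nn nnp)
    also have "\<dots> \<le> (\<integral>\<^sup>+v. ennreal (g a v b) * 1 \<partial>measure_pmf (P a))"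
      by (intro nn_integral_pmf_mono) (unfold nn_integral_pmf_cmult, intro mult_left_mono Cons.IH, simp)
    also have "\<dots> \<le> 1" using le by simp
    finally show ?thesis .
  qed simp
qed simp

text \<open>Markov's inequality for a product whose mean is at most 1. The lists may differ in
  length, since the packing assumptions of \<open>one_shot\<close> range over all output
  lists.\<close>

lemma list_packing_test:
  fixes g :: "'a \<Rightarrow> 'v \<Rightarrow> 'b \<Rightarrow> real"
  assumes le: "\<And>a b. (\<integral>\<^sup>+v. ennreal (g a v b) \<partial>measure_pmf (P a)) \<le> 1" and nn: "\<And>a v b. 0 \<le> g a v b"
    and "\<theta> > 0"
  shows "(\<integral>\<^sup>+vs. of_bool (prod_list (map (\<lambda>(a, v, b). g a v b) (zip as (zip vs bs))) > \<theta>) \<partial>list_pmf (map P as)) \<le> ennreal (1 / \<theta>)"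
proof -
  have "(\<integral>\<^sup>+vs. of_bool (prod_list (map (\<lambda>(a, v, b). g a v b) (zip as (zip vs bs))) > \<theta>) \<partial>list_pmf (map P as)) \<le>
     (\<integral>\<^sup>+vs. ennreal (1 / \<theta>) * ennreal (prod_list (map (\<lambda>(a, v, b). g a v b) (zip as (zip vs bs)))) \<partial>list_pmf (map P as))"
    using assms(3) by (intro nn_integral_pmf_mono) (auto simp: of_bool_def ennreal_mult[symmetric] ennreal_1[symmetric] simp del: ennreal_1 intro!: ennreal_leI)
  also have "\<dots> \<le> ennreal (1 / \<theta>) * 1"
    unfolding nn_integral_pmf_cmult by (intro mult_left_mono list_packing le nn) simp
  finally show ?thesis by simp
qed

lemma nn_integral_prod_list_replicate:
  fixes h :: "'a \<Rightarrow> real"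
  assumes "\<And>z. 0 \<le> h z"
  shows "(\<integral>\<^sup>+zs. ennreal (prod_list (map h zs)) \<partial>replicate_pmf n p) = (\<integral>\<^sup>+z. ennreal (h z) \<partial>measure_pmf p) ^ n"
proof (induction n)
  case (Suc n)
  have nn: "0 \<le> prod_list (map h zs)" for zs by (induction zs) (auto simp: assms)
  have "(\<integral>\<^sup>+zs. ennreal (prod_list (map h zs)) \<partial>replicate_pmf (Suc n) p) =
     (\<integral>\<^sup>+z. \<integral>\<^sup>+zs. ennreal (h z) * ennreal (prod_list (map h zs)) \<partial>replicate_pmf n p \<partial>p)"
    by (simp add: ennreal_mult assms nn)
  also have "\<dots> = (\<integral>\<^sup>+z. ennreal (h z) * (\<integral>\<^sup>+z. ennreal (h z) \<partial>measure_pmf p) ^ n \<partial>p)"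
    by (simp add: nn_integral_cmult Suc)
  finally show ?case by (simp add: nn_integral_multc)
qed simp

text \<open>The exponential moment \<phi> satisfies \<open>\<phi> 0 = 1\<close> and has derivative
  \<open>- \<delta>\<close> at 0, so it drops below 1 at some small positive \<open>s\<close>. Its
  value there is the rate \<open>c\<close>.\<close>

lemma chernoff:
  fixes f :: "'a \<Rightarrow> real"
  assumes fin: "finite (set_pmf p)" and "\<delta> > 0"
  shows "\<exists>c. 0 \<le> c \<and> c < 1 \<and> (\<forall>n. (\<integral>\<^sup>+zs. of_bool (sum_list (map f zs) \<le> real n * (measure_pmf.expectation p f - \<delta>))
     \<partial>replicate_pmf n p) \<le> ennreal (c ^ n))"
proof -
  define \<mu> where "\<mu> = measure_pmf.expectation p f"
  have \<mu>: "\<mu> = (\<Sum>z\<in>set_pmf p. pmf p z * f z)"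
    unfolding \<mu>_def by (subst integral_measure_pmf[OF fin]) auto
  define \<phi> where "\<phi> s = (\<Sum>z\<in>set_pmf p. pmf p z * exp (- s * (f z - \<mu> + \<delta>)))" for s
  have sum1: "(\<Sum>z\<in>set_pmf p. pmf p z) = 1" using fin by (intro sum_pmf_eq_1) auto
  have "(\<Sum>z\<in>set_pmf p. pmf p z * (- (f z - \<mu> + \<delta>))) = - \<mu> + \<mu> * 1 - \<delta> * 1"
    unfolding sum1[symmetric] by (subst (1) \<mu>) (simp add: sum_distrib_left sum.distrib sum_subtractf algebra_simps sum_negf)
  then have d: "(\<Sum>z\<in>set_pmf p. pmf p z * (- (f z - \<mu> + \<delta>))) = - \<delta>" by simp
  have "(\<phi> has_real_derivative (\<Sum>z\<in>set_pmf p. pmf p z * (- (f z - \<mu> + \<delta>)))) (at 0)"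
    unfolding \<phi>_def by (auto intro!: derivative_eq_intros sum.cong)
  then have "(\<phi> has_real_derivative - \<delta>) (at 0)" by (simp only: d)
  from DERIV_neg_dec_right[OF this] assms(2) obtain d where d: "d > 0" "\<And>h. 0 < h \<Longrightarrow> h < d \<Longrightarrow> \<phi> (0 + h) < \<phi> 0"
    by auto
  have "\<phi> 0 = 1" using sum1 by (simp add: \<phi>_def)
  with d(2)[of "d / 2"] d(1) have "\<phi> (d / 2) < 1" and s: "d / 2 > 0" by simp_all
  define s where "s = d / 2"
  have lt: "\<phi> s < 1" and spos: "s > 0" using \<open>\<phi> (d / 2) < 1\<close> s by (auto simp: s_def)
  have nn: "0 \<le> \<phi> s" unfolding \<phi>_def by (intro sum_nonneg) auto
  define h where "h z = exp (- s * (f z - \<mu> + \<delta>))" for z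
  have int: "(\<integral>\<^sup>+z. ennreal (h z) \<partial>measure_pmf p) = ennreal (\<phi> s)"
    unfolding \<phi>_def h_def
    by (subst nn_integral_measure_pmf_finite[OF fin]) (simp_all add: ennreal_mult[symmetric] mult.commute sum_ennreal)
  have prod: "prod_list (map h zs) = exp (- s * (sum_list (map f zs) - real (length zs) * (\<mu> - \<delta>)))" for zs
    by (induction zs) (simp_all add: h_def exp_add[symmetric] algebra_simps)
  have "(\<integral>\<^sup>+zs. of_bool (sum_list (map f zs) \<le> real n * (\<mu> - \<delta>)) \<partial>replicate_pmf n p) \<le> ennreal (\<phi> s ^ n)" for n
  proof -
    have "(\<integral>\<^sup>+zs. of_bool (sum_list (map f zs) \<le> real n * (\<mu> - \<delta>)) \<partial>replicate_pmf n p) \<le>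
      (\<integral>\<^sup>+zs. ennreal (prod_list (map h zs)) \<partial>replicate_pmf n p)"
    proof (rule nn_integral_pmf_mono)
      fix zs assume "zs \<in> set_pmf (replicate_pmf n p)"
      then have "length zs = n" by (simp add: set_replicate_pmf)
      then show "of_bool (sum_list (map f zs) \<le> real n * (\<mu> - \<delta>)) \<le> ennreal (prod_list (map h zs))"
        unfolding prod using spos
        by (auto simp: of_bool_def ennreal_1[symmetric] mult_nonneg_nonpos simp del: ennreal_1 intro!: ennreal_leI)
    qed
    also have "\<dots> = ennreal (\<phi> s ^ n)"
      by (subst nn_integral_prod_list_replicate) (auto simp: h_def[symmetric] int ennreal_power nn, simp add: h_def)
    finally show ?thesis .
  qed
  then show ?thesis using lt nn unfolding \<mu>_def by blast
qed

text \<open>The density of \<open>J\<close> with respect to the product of its marginals; the mean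
  of its logarithm under \<open>J\<close> is the mutual information.\<close>

definition dens :: "('a \<times> 'b) pmf \<Rightarrow> 'a \<times> 'b \<Rightarrow> real" where
  "dens J w = pmf J w / (pmf (map_pmf fst J) (fst w) * pmf (map_pmf snd J) (snd w))"

lemma dens_nonneg: "0 \<le> dens J w"
  by (simp add: dens_def)

lemma dens_pos: "w \<in> set_pmf J \<Longrightarrow> 0 < dens J w"
  unfolding dens_def by (intro divide_pos_pos mult_pos_pos pmf_positive) auto

text \<open>The factor for \<open>a\<close> cancels, and summing \<open>pmf J (a, b)\<close> over
  \<open>a\<close> gives the marginal at \<open>b\<close>. This is the packing property: a codeword
  drawn independently of \<open>b\<close> has mean ratio at most 1.\<close>

lemma nn_integral_dens_le:
  "(\<integral>\<^sup>+a. ennreal (dens J (a, b)) \<partial>map_pmf fst J) \<le> 1"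
proof (cases "pmf (map_pmf snd J) b = 0")
  case True
  then show ?thesis by (simp add: dens_def)
next
  case False
  then have pos: "pmf (map_pmf snd J) b > 0" by (simp add: pmf_nonneg order.not_eq_order_implies_strict)
  let ?c = "ennreal (1 / pmf (map_pmf snd J) b)"
  have "(\<integral>\<^sup>+a. ennreal (dens J (a, b)) \<partial>map_pmf fst J) =
    (\<integral>\<^sup>+a. ennreal (pmf (map_pmf fst J) a) * ennreal (dens J (a, b)) \<partial>count_space UNIV)"
    by (rule nn_integral_measure_pmf)
  also have "\<dots> \<le> (\<integral>\<^sup>+a. ?c * ennreal (pmf J (a, b)) \<partial>count_space UNIV)"
    by (intro nn_integral_mono) (auto simp: dens_def ennreal_mult[symmetric] intro!: ennreal_leI)
  also have "\<dots> = ?c * (\<integral>\<^sup>+a. ennreal (pmf J (a, b)) \<partial>count_space UNIV)"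
    by (rule nn_integral_cmult) simp
  also have "(\<integral>\<^sup>+a. ennreal (pmf J (a, b)) \<partial>count_space UNIV) = emeasure J ((\<lambda>a. (a, b)) ` UNIV)"
    by (rule nn_integral_pmf') (auto simp: inj_on_def)
  also have "(\<lambda>a. (a, b)) ` UNIV = snd -` {b}" by force
  also have "emeasure J (snd -` {b}) = ennreal (pmf (map_pmf snd J) b)"
    by (simp add: emeasure_pmf_single[symmetric])
  also have "?c * ennreal (pmf (map_pmf snd J) b) = 1" using pos by (simp add: ennreal_mult[symmetric])
  finally show ?thesis .
qed

lemma powr_log_prod_list:
  assumes "\<And>z. z \<in> set zs \<Longrightarrow> 0 < r z"
  shows "prod_list (map r zs) = 2 powr sum_list (map (\<lambda>z. log 2 (r z)) zs)"
  using assms by (induction zs) (auto simp: powr_add)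

text \<open>
  One channel use with time-sharing variable \<open>q\<close>. The variable \<open>v\<close> stands for the pair \<open>(U, Q)\<close>, so
  that the kernels \<open>PX\<close> and \<open>PT\<close> need not mention \<open>q\<close>.
\<close>

type_synonym ('q, 'v, 'x, 'y1, 'y2, 't) letter = "((('q \<times> 'v) \<times> 'x) \<times> ('y1 \<times> 'y2)) \<times> 't"

locale letters =
  fixes PQ :: "'q pmf" and PV :: "'q \<Rightarrow> 'v pmf" and PX :: "'v \<Rightarrow> 'x pmf"
    and W :: "('x, 'y1, 'y2) dmbc" and PT :: "'v \<Rightarrow> 'y1 \<Rightarrow> 't pmf"
begin

definition JV :: "'q \<Rightarrow> ('v \<times> 'y1 \<times> 'y2) pmf" where
  "JV q = PV q \<bind> (\<lambda>v. PX v \<bind> (\<lambda>x. map_pmf (Pair v) (W x)))"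

definition JT :: "'v \<Rightarrow> ('x \<times> ('y1 \<times> 'y2) \<times> 't) pmf" where
  "JT v = PX v \<bind> (\<lambda>x. W x \<bind> (\<lambda>y. map_pmf (\<lambda>t. (x, y, t)) (PT v (fst y))))"

definition J1 :: "'q \<Rightarrow> ('v \<times> 'y1) pmf" where "J1 q = map_pmf (\<lambda>(v, y). (v, fst y)) (JV q)"
definition J2 :: "'q \<Rightarrow> ('v \<times> 'y2) pmf" where "J2 q = map_pmf (\<lambda>(v, y). (v, snd y)) (JV q)"
definition J3 :: "'v \<Rightarrow> ('t \<times> 'y2) pmf" where "J3 v = map_pmf (\<lambda>(x, y, t). (t, snd y)) (JT v)"
definition J4 :: "'v \<Rightarrow> ('x \<times> ('t \<times> 'y2)) pmf" where "J4 v = map_pmf (\<lambda>(x, y, t). (x, (t, snd y))) (JT v)"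
definition J5 :: "'v \<Rightarrow> ('t \<times> 'y1) pmf" where "J5 v = map_pmf (\<lambda>(x, y, t). (t, fst y)) (JT v)"
definition PTV :: "'v \<Rightarrow> 't pmf" where "PTV v = map_pmf (\<lambda>(x, y, t). t) (JT v)"

lemma fst_J: "map_pmf fst (J1 q) = PV q" "map_pmf fst (J2 q) = PV q" "map_pmf fst (J3 v) = PTV v"
  "map_pmf fst (J4 v) = PX v" "map_pmf fst (J5 v) = PTV v"
  by (simp_all add: J1_def J2_def J3_def J4_def J5_def PTV_def JV_def JT_def pmf.map_comp o_def
     case_prod_unfold map_bind_pmf map_pmf_const bind_return_pmf')

text \<open>The tuples are nested to the left so that each use of
  \<open>nn_integral_replicate_chain\<close> in \<open>nn_integral_block\<close> appends one
  coordinate.\<close>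

definition L :: "('q, 'v, 'x, 'y1, 'y2, 't) letter pmf" where
  "L = PQ \<bind> (\<lambda>q. map_pmf (Pair q) (PV q)) \<bind> (\<lambda>z. map_pmf (Pair z) (PX (snd z)))
     \<bind> (\<lambda>z. map_pmf (Pair z) (W (snd z))) \<bind> (\<lambda>z. map_pmf (Pair z) (PT (snd (fst (fst z))) (fst (snd z))))"

definition "lq z = fst (fst (fst (fst z)))" for z :: "('q, 'v, 'x, 'y1, 'y2, 't) letter"
definition "lv z = snd (fst (fst (fst z)))" for z :: "('q, 'v, 'x, 'y1, 'y2, 't) letter"
definition "lx z = snd (fst (fst z))" for z :: "('q, 'v, 'x, 'y1, 'y2, 't) letter"
definition "ly z = snd (fst z)" for z :: "('q, 'v, 'x, 'y1, 'y2, 't) letter"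
definition "lt z = snd z" for z :: "('q, 'v, 'x, 'y1, 'y2, 't) letter"
lemmas l_defs = lq_def lv_def lx_def ly_def lt_def

lemma set_L: "z \<in> set_pmf L \<longleftrightarrow> lq z \<in> set_pmf PQ \<and> lv z \<in> set_pmf (PV (lq z)) \<and> lx z \<in> set_pmf (PX (lv z)) \<and>
   ly z \<in> set_pmf (W (lx z)) \<and> lt z \<in> set_pmf (PT (lv z) (fst (ly z)))"
  by (cases z) (auto simp: L_def l_defs image_iff)

definition "r1 z = dens (J1 (lq z)) (lv z, fst (ly z))" for z
definition "r2 z = dens (J2 (lq z)) (lv z, snd (ly z))" for z
definition "r3 z = dens (J3 (lv z)) (lt z, snd (ly z))" for z
definition "r4 z = dens (J4 (lv z)) (lx z, (lt z, snd (ly z)))" for z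
definition "r5 z = dens (J5 (lv z)) (lt z, fst (ly z))" for z
lemmas r_defs = r1_def r2_def r3_def r4_def r5_def

lemma set_JT: "z \<in> set_pmf L \<Longrightarrow> (lx z, ly z, lt z) \<in> set_pmf (JT (lv z))"
  unfolding JT_def by (auto simp: set_L) 

lemma set_JV: "z \<in> set_pmf L \<Longrightarrow> (lv z, ly z) \<in> set_pmf (JV (lq z))"
  unfolding JV_def by (auto simp: set_L) 

lemma r_pos:
  assumes "z \<in> set_pmf L"
  shows "0 < r1 z" "0 < r2 z" "0 < r3 z" "0 < r4 z" "0 < r5 z"
  unfolding r_defs
  by (intro dens_pos; use set_JT[OF assms] set_JV[OF assms] in
    \<open>force simp: J1_def J2_def J3_def J4_def J5_def\<close>)+

lemma J5_eq: "J5 v = map_pmf (\<lambda>(y, t). (t, y)) (map_pmf (\<lambda>(x, y, t). fst y) (JT v) \<bind> (\<lambda>y. map_pmf (Pair y) (PT v y)))"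
  unfolding J5_def JT_def
  by (simp add: map_bind_pmf map_pmf_def[symmetric] bind_map_pmf pmf.map_comp o_def case_prod_unfold bind_assoc_pmf map_pmf_const bind_return_pmf)

text \<open>\<open>r5\<close> is the ratio of the description kernel to its average
  \<open>PTV\<close>. Thus the covering condition of \<open>one_shot\<close>, which compares two
  pmfs, becomes a threshold on a product of values of \<open>r5\<close>.\<close>

lemma pmf_PT_eq:
  assumes "z \<in> set_pmf L"
  shows "pmf (PT (lv z) (fst (ly z))) (lt z) = r5 z * pmf (PTV (lv z)) (lt z)"
proof -
  let ?Y = "map_pmf (\<lambda>(x, y, t). fst y) (JT (lv z))"
  have "pmf (J5 (lv z)) (lt z, fst (ly z)) = pmf ?Y (fst (ly z)) * pmf (PT (lv z) (fst (ly z))) (lt z)"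
    unfolding J5_eq
    using pmf_map_inj'[of "\<lambda>(y, t). (t, y)" "?Y \<bind> (\<lambda>y. map_pmf (Pair y) (PT (lv z) y))" "(fst (ly z), lt z)"]
    by (simp add: pmf_bind_map_Pair inj_def)
  moreover have "map_pmf snd (J5 (lv z)) = ?Y" by (simp add: J5_def pmf.map_comp o_def case_prod_unfold)
  moreover have "pmf ?Y (fst (ly z)) > 0" using set_JT[OF assms] by (intro pmf_positive) force
  moreover have "pmf (PTV (lv z)) (lt z) > 0" using set_JT[OF assms] unfolding PTV_def by (intro pmf_positive) force
  ultimately show ?thesis by (simp add: r5_def dens_def fst_J)
qed

lemma nn_integral_block:
  "(\<integral>\<^sup>+qs. \<integral>\<^sup>+vs. \<integral>\<^sup>+xs. \<integral>\<^sup>+ys. \<integral>\<^sup>+ts. F qs vs xs ys ts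
     \<partial>list_pmf (map2 PT vs (map fst ys)) \<partial>list_pmf (map W xs) \<partial>list_pmf (map PX vs) \<partial>list_pmf (map PV qs) \<partial>replicate_pmf n PQ) =
   (\<integral>\<^sup>+zs. F (map lq zs) (map lv zs) (map lx zs) (map ly zs) (map lt zs) \<partial>replicate_pmf n L)"
proof -
  let ?P1 = "PQ \<bind> (\<lambda>q. map_pmf (Pair q) (PV q))"
  let ?P2 = "?P1 \<bind> (\<lambda>z. map_pmf (Pair z) (PX (snd z)))"
  let ?P3 = "?P2 \<bind> (\<lambda>z. map_pmf (Pair z) (W (snd z)))"
  have map2: "map2 PT (map f us) (map g us) = map (\<lambda>u. PT (f u) (g u)) us" for f :: "'u \<Rightarrow> 'v" and g us
    by (induction us) auto
  have "(\<integral>\<^sup>+qs. \<integral>\<^sup>+vs. \<integral>\<^sup>+xs. \<integral>\<^sup>+ys. \<integral>\<^sup>+ts. F qs vs xs ys ts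
     \<partial>list_pmf (map2 PT vs (map fst ys)) \<partial>list_pmf (map W xs) \<partial>list_pmf (map PX vs) \<partial>list_pmf (map PV qs) \<partial>replicate_pmf n PQ) =
    (\<integral>\<^sup>+us. \<integral>\<^sup>+xs. \<integral>\<^sup>+ys. \<integral>\<^sup>+ts. F (map fst us) (map snd us) xs ys ts
     \<partial>list_pmf (map2 PT (map snd us) (map fst ys)) \<partial>list_pmf (map W xs) \<partial>list_pmf (map (\<lambda>u. PX (snd u)) us) \<partial>replicate_pmf n ?P1)"
    by (subst nn_integral_replicate_chain) (simp add: o_def)
  also have "\<dots> = (\<integral>\<^sup>+us. \<integral>\<^sup>+ys. \<integral>\<^sup>+ts. F (map fst (map fst us)) (map snd (map fst us)) (map snd us) ys ts
     \<partial>list_pmf (map2 PT (map snd (map fst us)) (map fst ys)) \<partial>list_pmf (map (\<lambda>u. W (snd u)) us) \<partial>replicate_pmf n ?P2)"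
    by (subst nn_integral_replicate_chain) (simp add: o_def)
  also have "\<dots> = (\<integral>\<^sup>+us. \<integral>\<^sup>+ts. F (map fst (map fst (map fst us))) (map snd (map fst (map fst us))) (map snd (map fst us)) (map snd us) ts
     \<partial>list_pmf (map (\<lambda>u. PT (snd (fst (fst u))) (fst (snd u))) us) \<partial>replicate_pmf n ?P3)"
    by (subst nn_integral_replicate_chain) (simp add: o_def map2)
  also have "\<dots> = (\<integral>\<^sup>+us. F (map fst (map fst (map fst (map fst us)))) (map snd (map fst (map fst (map fst us))))
      (map snd (map fst (map fst us))) (map snd (map fst us)) (map snd us) \<partial>replicate_pmf n L)"
    unfolding L_def by (subst nn_integral_replicate_chain) simp
  finally show ?thesis by (simp add: l_defs[abs_def] o_def)
qed

abbreviation "prod_over r zs \<equiv> prod_list (map r zs)"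

definition A1 :: "real \<Rightarrow> 'q list \<Rightarrow> 'v list \<Rightarrow> 'y1 list \<Rightarrow> bool" where
  "A1 \<theta> qs vs ys \<longleftrightarrow> prod_over (\<lambda>(q, v, y). dens (J1 q) (v, y)) (zip qs (zip vs ys)) > \<theta>"
definition A2 :: "real \<Rightarrow> 'q list \<Rightarrow> 'v list \<Rightarrow> 'y2 list \<Rightarrow> bool" where
  "A2 \<theta> qs vs ys \<longleftrightarrow> prod_over (\<lambda>(q, v, y). dens (J2 q) (v, y)) (zip qs (zip vs ys)) > \<theta>"
definition A3 :: "real \<Rightarrow> 'v list \<Rightarrow> 't list \<Rightarrow> 'y2 list \<Rightarrow> bool" where
  "A3 \<theta> vs ts ys \<longleftrightarrow> prod_over (\<lambda>(v, t, y). dens (J3 v) (t, y)) (zip vs (zip ts ys)) > \<theta>"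
definition A4 :: "real \<Rightarrow> 'v list \<Rightarrow> 'x list \<Rightarrow> 't list \<Rightarrow> 'y2 list \<Rightarrow> bool" where
  "A4 \<theta> vs xs ts ys \<longleftrightarrow> prod_over (\<lambda>(v, x, y). dens (J4 v) (x, y)) (zip vs (zip xs (zip ts ys))) > \<theta>"

lemma block_one_shot:
  assumes pos: "M1 > 0" "K > 0" "N > 0" "M2 > 0" "\<gamma> > 0" "\<theta>5 \<ge> 1" "\<theta>1 > 0" "\<theta>2 > 0" "\<theta>3 > 0" "\<theta>4 > 0"
  shows "one_shot (list_pmf (map PV qs)) (\<lambda>vs. list_pmf (map PX vs)) (\<lambda>vs. list_pmf (map PTV vs))
     (A1 \<theta>1 qs) (A2 \<theta>2 qs) (A3 \<theta>3) (A4 \<theta>4) (1 / \<theta>1) (1 / \<theta>2) (1 / \<theta>3) (1 / \<theta>4) \<theta>5 \<gamma> M1 K N M2"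
proof
  show "(\<integral>\<^sup>+u. of_bool (A1 \<theta>1 qs u y) \<partial>list_pmf (map PV qs)) \<le> ennreal (1 / \<theta>1)" for y
    unfolding A1_def by (rule list_packing_test)
      (use pos in \<open>auto simp: dens_nonneg nn_integral_dens_le fst_J(1)[symmetric] simp del: nn_integral_map_pmf\<close>)
  show "(\<integral>\<^sup>+u. of_bool (A2 \<theta>2 qs u y) \<partial>list_pmf (map PV qs)) \<le> ennreal (1 / \<theta>2)" for y
    unfolding A2_def by (rule list_packing_test)
      (use pos in \<open>auto simp: dens_nonneg nn_integral_dens_le fst_J(2)[symmetric] simp del: nn_integral_map_pmf\<close>)
  show "(\<integral>\<^sup>+t. of_bool (A3 \<theta>3 u t y) \<partial>list_pmf (map PTV u)) \<le> ennreal (1 / \<theta>3)" for u y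
    unfolding A3_def by (rule list_packing_test)
      (use pos in \<open>auto simp: dens_nonneg nn_integral_dens_le fst_J(3)[symmetric] simp del: nn_integral_map_pmf\<close>)
  show "(\<integral>\<^sup>+x. of_bool (A4 \<theta>4 u x t y) \<partial>list_pmf (map PX u)) \<le> ennreal (1 / \<theta>4)" for u t y
    unfolding A4_def by (rule list_packing_test)
      (use pos in \<open>auto simp: dens_nonneg nn_integral_dens_le fst_J(4)[symmetric] simp del: nn_integral_map_pmf\<close>)
qed (use pos in auto)

definition Eavg :: "nat \<Rightarrow> real \<Rightarrow> real \<Rightarrow> real \<Rightarrow> real \<Rightarrow> real \<Rightarrow> real \<Rightarrow> ennreal" where
  "Eavg n \<gamma> \<theta>1 \<theta>2 \<theta>3 \<theta>4 \<theta>5 =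
     (\<integral>\<^sup>+zs. of_bool (prod_over r1 zs \<le> \<theta>1) \<partial>replicate_pmf n L) +
     (\<integral>\<^sup>+zs. of_bool (prod_over r2 zs \<le> \<theta>2) \<partial>replicate_pmf n L) +
     ennreal (1 / \<gamma>) * ((\<integral>\<^sup>+zs. of_bool (prod_over r3 zs \<le> \<theta>3) \<partial>replicate_pmf n L) +
       (\<integral>\<^sup>+zs. of_bool (prod_over r4 zs \<le> \<theta>4) \<partial>replicate_pmf n L)) +
     (\<integral>\<^sup>+zs. of_bool (prod_over r5 zs > \<theta>5) \<partial>replicate_pmf n L)"

text \<open>Here \<open>N\<close> is the size of the description codebook, called \<open>L\<close>
  in \<open>one_shot\<close>; in this locale \<open>L\<close> is the law of a letter.\<close>

definition block_bound :: "nat \<Rightarrow> nat \<Rightarrow> nat \<Rightarrow> nat \<Rightarrow> nat \<Rightarrow> real \<Rightarrow> real \<Rightarrow> real \<Rightarrow> real \<Rightarrow> real \<Rightarrow> real \<Rightarrow> ennreal" where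
  "block_bound n M1 K N M2 \<gamma> \<theta>1 \<theta>2 \<theta>3 \<theta>4 \<theta>5 =
     Eavg n \<gamma> \<theta>1 \<theta>2 \<theta>3 \<theta>4 \<theta>5 + (ennreal (real (M1 - 1) * (1 / \<theta>1)) + ennreal (real (M1 * K - 1) * (1 / \<theta>2)) +
       ennreal ((1 - 1 / \<theta>5) ^ N) + ennreal \<gamma> + (if N = 1 then 0 else ennreal (real N * (1 / \<theta>3) / real K)) +
       ennreal (real (M2 - 1) * (1 / \<theta>4)))"

lemma prod_over_PT:
  assumes "set zs \<subseteq> set_pmf L"
  shows "pmf (list_pmf (map2 PT (map lv zs) (map fst (map ly zs)))) (map lt zs) =
    prod_over r5 zs * pmf (list_pmf (map PTV (map lv zs))) (map lt zs)"
proof -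
  have "prod_list (map2 pmf (map2 PT (map lv zs) (map fst (map ly zs))) (map lt zs)) =
    prod_over r5 zs * prod_list (map2 pmf (map PTV (map lv zs)) (map lt zs))"
    using assms by (induction zs) (simp_all add: pmf_PT_eq)
  then show ?thesis by (simp add: pmf_list_pmf)
qed

lemma zip_letters:
  "prod_over (\<lambda>(q, v, y). dens (J1 q) (v, y)) (zip (map lq zs) (zip (map lv zs) (map fst (map ly zs)))) = prod_over r1 zs"
  "prod_over (\<lambda>(q, v, y). dens (J2 q) (v, y)) (zip (map lq zs) (zip (map lv zs) (map snd (map ly zs)))) = prod_over r2 zs"
  "prod_over (\<lambda>(v, t, y). dens (J3 v) (t, y)) (zip (map lv zs) (zip (map lt zs) (map snd (map ly zs)))) = prod_over r3 zs"
  "prod_over (\<lambda>(v, x, y). dens (J4 v) (x, y)) (zip (map lv zs) (zip (map lx zs) (zip (map lt zs) (map snd (map ly zs))))) = prod_over r4 zs"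
  by (induction zs) (simp_all add: r_defs)

lemma A_letters:
  "A1 \<theta> (map lq zs) (map lv zs) (map fst (map ly zs)) \<longleftrightarrow> prod_over r1 zs > \<theta>"
  "A2 \<theta> (map lq zs) (map lv zs) (map snd (map ly zs)) \<longleftrightarrow> prod_over r2 zs > \<theta>"
  "A3 \<theta> (map lv zs) (map lt zs) (map snd (map ly zs)) \<longleftrightarrow> prod_over r3 zs > \<theta>"
  "A4 \<theta> (map lv zs) (map lx zs) (map lt zs) (map snd (map ly zs)) \<longleftrightarrow> prod_over r4 zs > \<theta>"
  unfolding A1_def A2_def A3_def A4_def zip_letters by (rule refl)+

text \<open>The time-sharing sequence is random as well. Its average turns the error events into
  events on independent letters, and then a sequence no worse than the average is fixed.\<close>

lemma reliable_block:
  assumes pos: "M1 > 0" "K > 0" "N > 0" "M2 > 0" "\<gamma> > 0" "\<theta>5 \<ge> 1" "\<theta>1 > 0" "\<theta>2 > 0" "\<theta>3 > 0" "\<theta>4 > 0"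
  shows "block_reliable W n M1 K M2 (block_bound n M1 K N M2 \<gamma> \<theta>1 \<theta>2 \<theta>3 \<theta>4 \<theta>5)"
    (is "block_reliable _ _ _ _ _ ?b")
proof -
  interpret O: one_shot "list_pmf (map PV qs)" "\<lambda>vs. list_pmf (map PX vs)" "\<lambda>xs. list_pmf (map W xs)" "map fst" "map snd"
      "\<lambda>vs ys. list_pmf (map2 PT vs ys)" "\<lambda>vs. list_pmf (map PTV vs)"
     "A1 \<theta>1 qs" "A2 \<theta>2 qs" "A3 \<theta>3" "A4 \<theta>4" "1 / \<theta>1" "1 / \<theta>2" "1 / \<theta>3" "1 / \<theta>4" \<theta>5 \<gamma> M1 K N M2 for qs
    by (rule block_one_shot[OF assms])
  let ?R = "replicate_pmf n PQ"
  have e1: "(\<integral>\<^sup>+qs. O.e1 qs \<partial>?R) = (\<integral>\<^sup>+zs. of_bool (prod_over r1 zs \<le> \<theta>1) \<partial>replicate_pmf n L)"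
    using nn_integral_block[where F="\<lambda>qs vs xs ys ts. of_bool (\<not> A1 \<theta>1 qs vs (map fst ys))" and n=n]
    by (simp add: O.e1_def A_letters not_less del: map_map)
  have e2: "(\<integral>\<^sup>+qs. O.e2 qs \<partial>?R) = (\<integral>\<^sup>+zs. of_bool (prod_over r2 zs \<le> \<theta>2) \<partial>replicate_pmf n L)"
    using nn_integral_block[where F="\<lambda>qs vs xs ys ts. of_bool (\<not> A2 \<theta>2 qs vs (map snd ys))" and n=n]
    by (simp add: O.e2_def A_letters not_less del: map_map)
  have "(\<integral>\<^sup>+qs. O.e34 qs \<partial>?R) = (\<integral>\<^sup>+zs. of_bool (prod_over r3 zs \<le> \<theta>3 \<or> prod_over r4 zs \<le> \<theta>4) \<partial>replicate_pmf n L)"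
    using nn_integral_block[where F="\<lambda>qs vs xs ys ts. of_bool (\<not> A3 \<theta>3 vs ts (map snd ys) \<or> \<not> A4 \<theta>4 vs xs ts (map snd ys))" and n=n]
    by (simp add: O.e34_def O.bad_def A_letters not_less del: map_map)
  also have "\<dots> \<le> (\<integral>\<^sup>+zs. of_bool (prod_over r3 zs \<le> \<theta>3) + of_bool (prod_over r4 zs \<le> \<theta>4) \<partial>replicate_pmf n L)"
    by (intro nn_integral_pmf_mono of_bool_ennreal_disj_le)
  finally have e34: "(\<integral>\<^sup>+qs. O.e34 qs \<partial>?R) \<le> (\<integral>\<^sup>+zs. of_bool (prod_over r3 zs \<le> \<theta>3) \<partial>replicate_pmf n L) +
       (\<integral>\<^sup>+zs. of_bool (prod_over r4 zs \<le> \<theta>4) \<partial>replicate_pmf n L)"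
    by (simp add: nn_integral_add)
  have "(\<integral>\<^sup>+qs. O.e5 qs \<partial>?R) = (\<integral>\<^sup>+zs. of_bool (\<not> pmf (list_pmf (map2 PT (map lv zs) (map fst (map ly zs)))) (map lt zs)
      \<le> \<theta>5 * pmf (list_pmf (map PTV (map lv zs))) (map lt zs)) \<partial>replicate_pmf n L)"
    using nn_integral_block[where F="\<lambda>qs vs xs ys ts. of_bool (\<not> pmf (list_pmf (map2 PT vs (map fst ys))) ts \<le> \<theta>5 * pmf (list_pmf (map PTV vs)) ts)" and n=n]
    by (simp add: O.e5_def del: map_map)
  also have "\<dots> \<le> (\<integral>\<^sup>+zs. of_bool (prod_over r5 zs > \<theta>5) \<partial>replicate_pmf n L)"
  proof (rule nn_integral_pmf_mono)
    fix zs assume "zs \<in> set_pmf (replicate_pmf n L)"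
    then have "set zs \<subseteq> set_pmf L" by (auto simp: set_replicate_pmf)
    from prod_over_PT[OF this] show "of_bool (\<not> pmf (list_pmf (map2 PT (map lv zs) (map fst (map ly zs)))) (map lt zs)
      \<le> \<theta>5 * pmf (list_pmf (map PTV (map lv zs))) (map lt zs)) \<le> (of_bool (prod_over r5 zs > \<theta>5) :: ennreal)"
      by (auto simp: of_bool_def not_le intro: mult_right_mono simp del: map_map) (meson mult_right_mono not_le pmf_nonneg)
  qed
  finally have e5: "(\<integral>\<^sup>+qs. O.e5 qs \<partial>?R) \<le> (\<integral>\<^sup>+zs. of_bool (prod_over r5 zs > \<theta>5) \<partial>replicate_pmf n L)" .
  have "(\<integral>\<^sup>+qs. O.total qs \<partial>?R) = (\<integral>\<^sup>+qs. O.e1 qs \<partial>?R) + (\<integral>\<^sup>+qs. O.e2 qs \<partial>?R) +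
     ennreal (1 / \<gamma>) * (\<integral>\<^sup>+qs. O.e34 qs \<partial>?R) + (\<integral>\<^sup>+qs. O.e5 qs \<partial>?R) +
     (ennreal (real (M1 - 1) * (1 / \<theta>1)) + ennreal (real (M1 * K - 1) * (1 / \<theta>2)) +
       ennreal ((1 - 1 / \<theta>5) ^ N) + ennreal \<gamma> + (if N = 1 then 0 else ennreal (real N * (1 / \<theta>3) / real K)) +
       ennreal (real (M2 - 1) * (1 / \<theta>4)))"
    unfolding O.total_def by (simp add: nn_integral_add nn_integral_cmult algebra_simps del: of_nat_diff)
  also have "\<dots> \<le> block_bound n M1 K N M2 \<gamma> \<theta>1 \<theta>2 \<theta>3 \<theta>4 \<theta>5"
    unfolding block_bound_def Eavg_def e1 e2 by (intro add_mono mult_left_mono e34 e5 order_refl) simp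
  finally have average: "(\<integral>\<^sup>+qs. O.total qs \<partial>?R) \<le> ?b" .
  show ?thesis
    unfolding block_reliable_def
  proof (intro allI impI)
    fix \<mu> :: "(nat \<times> nat \<times> nat) pmf"
    assume \<mu>: "set_pmf \<mu> \<subseteq> {..<M1} \<times> {..<K} \<times> {..<M2}"
    obtain qs where qs: "qs \<in> set_pmf (replicate_pmf n PQ)" "O.total qs \<le> ?b"
      using exists_le_nn_integral_pmf[of "replicate_pmf n PQ" O.total] average by (meson order_trans)
    obtain c :: "('x, 'y1, 'y2) list_code" where c: "\<forall>i k y. bin_idx c i k y < K"
      "\<And>i k j. i < M1 \<Longrightarrow> k < K \<Longrightarrow> j < M2 \<Longrightarrow> \<exists>vs\<in>set_pmf (list_pmf (map PV qs)). word c i k j \<in> set_pmf (list_pmf (map PX vs))"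
      "avg_block_err W c \<mu> \<le> O.total qs"
      using O.exists_block_code[OF \<mu>, of qs] unfolding avg_block_err_def by blast
    \<comment> \<open>Outside the index range the support statement gives no control of the length,
      so arbitrary words of length \<open>n\<close> are put there; the average over \<mu> never
      meets them.\<close>
    define c' where "c' = c\<lparr>word := \<lambda>i k j. if i < M1 \<and> k < K \<and> j < M2 then word c i k j else replicate n undefined\<rparr>"
    have "length qs = n" using qs(1) by (simp add: set_replicate_pmf)
    then have "\<forall>i k j. length (word c' i k j) = n"
      using c(2) by (fastforce simp: c'_def dest!: length_list_pmf)
    moreover have "\<forall>i k y. bin_idx c' i k y < K" using c(1) by (simp add: c'_def)
    moreover have "avg_block_err W c' \<mu> = avg_block_err W c \<mu>"
      unfolding avg_block_err_def using \<mu> by (intro nn_integral_pmf_cong) (auto simp: c'_def block_err_def)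
    ultimately show "\<exists>c. (\<forall>i k j. length (word c i k j) = n) \<and> (\<forall>i k y. bin_idx c i k y < K) \<and> avg_block_err W c \<mu> \<le> ?b"
      using c(3) qs(2) order_trans by (intro exI[of _ c']) auto
  qed
qed

end

section \<open>Achievable rates\<close>

context letters
begin

abbreviation "info r \<equiv> measure_pmf.expectation L (\<lambda>z. log 2 (r z))"

lemma lower_tail:
  assumes fin: "finite (set_pmf L)" and "\<delta> > 0" and pos: "\<And>z. z \<in> set_pmf L \<Longrightarrow> 0 < r z"
  shows "\<exists>c. 0 \<le> c \<and> c < 1 \<and> (\<forall>n. (\<integral>\<^sup>+zs. of_bool (prod_over r zs \<le> 2 powr (real n * (info r - \<delta>)))
     \<partial>replicate_pmf n L) \<le> ennreal (c ^ n))"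
proof -
  from chernoff[OF fin \<open>\<delta> > 0\<close>, of "\<lambda>z. log 2 (r z)"] obtain c where c: "0 \<le> c" "c < 1"
    "\<And>n. (\<integral>\<^sup>+zs. of_bool (sum_list (map (\<lambda>z. log 2 (r z)) zs) \<le> real n * (info r - \<delta>)) \<partial>replicate_pmf n L) \<le> ennreal (c ^ n)"
    by blast
  have "(\<integral>\<^sup>+zs. of_bool (prod_over r zs \<le> 2 powr (real n * (info r - \<delta>))) \<partial>replicate_pmf n L) =
     (\<integral>\<^sup>+zs. of_bool (sum_list (map (\<lambda>z. log 2 (r z)) zs) \<le> real n * (info r - \<delta>)) \<partial>replicate_pmf n L)" for n
  proof (rule nn_integral_pmf_cong)
    fix zs assume "zs \<in> set_pmf (replicate_pmf n L)"
    then have "prod_over r zs = 2 powr sum_list (map (\<lambda>z. log 2 (r z)) zs)"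
      by (intro powr_log_prod_list pos) (auto simp: set_replicate_pmf)
    then show "of_bool (prod_over r zs \<le> 2 powr (real n * (info r - \<delta>))) =
      (of_bool (sum_list (map (\<lambda>z. log 2 (r z)) zs) \<le> real n * (info r - \<delta>)) :: ennreal)" by simp
  qed
  with c show ?thesis by auto
qed

lemma upper_tail:
  assumes fin: "finite (set_pmf L)" and "\<delta> > 0" and pos: "\<And>z. z \<in> set_pmf L \<Longrightarrow> 0 < r z"
  shows "\<exists>c. 0 \<le> c \<and> c < 1 \<and> (\<forall>n. (\<integral>\<^sup>+zs. of_bool (prod_over r zs > 2 powr (real n * (info r + \<delta>)))
     \<partial>replicate_pmf n L) \<le> ennreal (c ^ n))"
proof -
  from chernoff[OF fin \<open>\<delta> > 0\<close>, of "\<lambda>z. - log 2 (r z)"] obtain c where c: "0 \<le> c" "c < 1"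
    "\<And>n. (\<integral>\<^sup>+zs. of_bool (sum_list (map (\<lambda>z. - log 2 (r z)) zs) \<le> real n * (- info r - \<delta>)) \<partial>replicate_pmf n L) \<le> ennreal (c ^ n)"
    by auto
  have "(\<integral>\<^sup>+zs. of_bool (prod_over r zs > 2 powr (real n * (info r + \<delta>))) \<partial>replicate_pmf n L) \<le>
     (\<integral>\<^sup>+zs. of_bool (sum_list (map (\<lambda>z. - log 2 (r z)) zs) \<le> real n * (- info r - \<delta>)) \<partial>replicate_pmf n L)" for n
  proof (rule nn_integral_pmf_mono)
    fix zs assume "zs \<in> set_pmf (replicate_pmf n L)"
    then have "prod_over r zs = 2 powr sum_list (map (\<lambda>z. log 2 (r z)) zs)"
      by (intro powr_log_prod_list pos) (auto simp: set_replicate_pmf)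
    moreover have "sum_list (map (\<lambda>z. - log 2 (r z)) zs) = - sum_list (map (\<lambda>z. log 2 (r z)) zs)"
      by (induction zs) auto
    ultimately show "of_bool (prod_over r zs > 2 powr (real n * (info r + \<delta>))) \<le>
      (of_bool (sum_list (map (\<lambda>z. - log 2 (r z)) zs) \<le> real n * (- info r - \<delta>)) :: ennreal)"
      by (auto simp: of_bool_def algebra_simps)
  qed
  from order_trans[OF this c(3)] c(1,2) show ?thesis by blast
qed

text \<open>Thresholds lie \<delta> away from the mean log ratios and codebook sizes another
  \<delta> further, so tails and packing terms decay exponentially and covering fails with
  probability at most \<open>exp (- (2 powr (real n * \<delta>)))\<close>. The factors 4 and 2 leave
  room for rounding. The second alternative in \<open>cov\<close> is the scheme with a single
  description.\<close>

lemma block_codes: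
  fixes M1 K N M2 :: "nat \<Rightarrow> nat"
  assumes fin: "finite (set_pmf L)" and "\<delta> > 0" "\<epsilon> > 0"
    and pos: "\<And>n. M1 n > 0" "\<And>n. K n > 0" "\<And>n. N n > 0" "\<And>n. M2 n > 0"
    and s1: "\<And>n. real (M1 n - 1) \<le> 2 powr (real n * (info r1 - 2 * \<delta>))"
    and s2: "\<And>n. real (M1 n * K n - 1) \<le> 4 * 2 powr (real n * (info r2 - 2 * \<delta>))"
    and s4: "\<And>n. real (M2 n - 1) \<le> 2 powr (real n * (info r4 - 2 * \<delta>))"
    and cov: "(info r5 \<ge> 0 \<and> (\<forall>n. 2 powr (real n * (info r5 + 2 * \<delta>)) \<le> real (N n) \<and>
        real (N n) \<le> 2 * 2 powr (real n * (info r3 - 2 * \<delta>)) * real (K n))) \<or>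
      (\<forall>n. N n = 1) \<and> (\<forall>z\<in>set_pmf L. r5 z \<le> 1)"
  shows "\<forall>\<^sub>F n in sequentially. block_reliable W n (M1 n) (K n) (M2 n) (ennreal \<epsilon>)"
proof -
  obtain c1 where c1: "0 \<le> c1" "c1 < 1" "\<And>n. (\<integral>\<^sup>+zs. of_bool (prod_over r1 zs \<le> 2 powr (real n * (info r1 - \<delta>)))
     \<partial>replicate_pmf n L) \<le> ennreal (c1 ^ n)" using lower_tail[where r=r1, OF fin \<open>\<delta> > 0\<close> r_pos(1)] by auto
  obtain c2 where c2: "0 \<le> c2" "c2 < 1" "\<And>n. (\<integral>\<^sup>+zs. of_bool (prod_over r2 zs \<le> 2 powr (real n * (info r2 - \<delta>)))
     \<partial>replicate_pmf n L) \<le> ennreal (c2 ^ n)" using lower_tail[where r=r2, OF fin \<open>\<delta> > 0\<close> r_pos(2)] by auto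
  obtain c3 where c3: "0 \<le> c3" "c3 < 1" "\<And>n. (\<integral>\<^sup>+zs. of_bool (prod_over r3 zs \<le> 2 powr (real n * (info r3 - \<delta>)))
     \<partial>replicate_pmf n L) \<le> ennreal (c3 ^ n)" using lower_tail[where r=r3, OF fin \<open>\<delta> > 0\<close> r_pos(3)] by auto
  obtain c4 where c4: "0 \<le> c4" "c4 < 1" "\<And>n. (\<integral>\<^sup>+zs. of_bool (prod_over r4 zs \<le> 2 powr (real n * (info r4 - \<delta>)))
     \<partial>replicate_pmf n L) \<le> ennreal (c4 ^ n)" using lower_tail[where r=r4, OF fin \<open>\<delta> > 0\<close> r_pos(4)] by auto
  obtain c5 where c5: "0 \<le> c5" "c5 < 1" "\<And>n. (\<integral>\<^sup>+zs. of_bool (prod_over r5 zs > 2 powr (real n * (info r5 + \<delta>)))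
     \<partial>replicate_pmf n L) \<le> ennreal (c5 ^ n)" using upper_tail[where r=r5, OF fin \<open>\<delta> > 0\<close> r_pos(5)] by auto
  \<comment> \<open>\<gamma> is the one summand that does not vanish with \<open>n\<close>; half of
    \<epsilon> makes the limit of \<open>tot\<close> smaller than \<epsilon>.\<close>
  define \<gamma> where "\<gamma> = \<epsilon> / 2"
  have \<gamma>: "\<gamma> > 0" using \<open>\<epsilon> > 0\<close> by (simp add: \<gamma>_def)
  define d where "d n = 2 powr (- (real n * \<delta>))" for n :: nat
  have d0: "d n > 0" for n by (simp add: d_def)
  define tot where "tot n = c1 ^ n + c2 ^ n + (1 / \<gamma>) * (c3 ^ n + c4 ^ n) + c5 ^ n +
     (d n + 4 * d n + exp (- (2 powr (real n * \<delta>))) + \<gamma> + 2 * d n + d n)" for n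
  have "d \<longlonglongrightarrow> 0" unfolding d_def using \<open>\<delta> > 0\<close> by real_asymp
  moreover have "(\<lambda>n. exp (- (2 powr (real n * \<delta>)))) \<longlonglongrightarrow> 0" using \<open>\<delta> > 0\<close> by real_asymp
  ultimately have "tot \<longlonglongrightarrow> 0 + 0 + (1 / \<gamma>) * (0 + 0) + 0 + (0 + 4 * 0 + 0 + \<gamma> + 2 * 0 + 0)"
    unfolding tot_def using c1(1,2) c2(1,2) c3(1,2) c4(1,2) c5(1,2)
    by (intro tendsto_intros LIMSEQ_realpow_zero) auto
  then have "tot \<longlonglongrightarrow> \<epsilon> / 2" by (simp add: \<gamma>_def)
  from order_tendstoD(2)[OF this, of \<epsilon>] have "\<forall>\<^sub>F n in sequentially. tot n < \<epsilon>" using \<open>\<epsilon> > 0\<close> by simp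
  then show ?thesis
  proof (rule eventually_mono)
    fix n
    assume n: "tot n < \<epsilon>"
    \<comment> \<open>With a single description the threshold 1 makes
      \<open>(1 - 1 / \<theta>5) ^ N n\<close> zero, and \<open>r5 \<le> 1\<close> means that it is
      never exceeded.\<close>
    define \<theta>5 where "\<theta>5 = (if (\<forall>n. N n = 1) \<and> (\<forall>z\<in>set_pmf L. r5 z \<le> 1) then 1 else 2 powr (real n * (info r5 + \<delta>)))"
    let ?\<theta>1 = "2 powr (real n * (info r1 - \<delta>))" and ?\<theta>2 = "2 powr (real n * (info r2 - \<delta>))"
    let ?\<theta>3 = "2 powr (real n * (info r3 - \<delta>))" and ?\<theta>4 = "2 powr (real n * (info r4 - \<delta>))"
    have \<theta>5: "\<theta>5 \<ge> 1" using cov \<open>\<delta> > 0\<close> by (auto simp: \<theta>5_def intro!: ge_one_powr_ge_zero)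
    have e5: "(\<integral>\<^sup>+zs. of_bool (prod_over r5 zs > \<theta>5) \<partial>replicate_pmf n L) \<le> ennreal (c5 ^ n)"
    proof (cases "(\<forall>n. N n = 1) \<and> (\<forall>z\<in>set_pmf L. r5 z \<le> 1)")
      case True
      have nn: "0 \<le> prod_over r5 zs" for zs by (induction zs) (auto simp: r5_def dens_nonneg)
      have "prod_over r5 zs \<le> 1" if "set zs \<subseteq> set_pmf L" for zs
        using that
      proof (induction zs)
        case (Cons z zs)
        then have "r5 z * prod_over r5 zs \<le> 1 * 1"
          using True nn by (intro mult_mono) auto
        then show ?case by simp
      qed simp
      then have "(\<integral>\<^sup>+zs. of_bool (prod_over r5 zs > \<theta>5) \<partial>replicate_pmf n L) \<le> 0"
        using True by (intro nn_integral_pmf_le_const) (auto simp: \<theta>5_def set_replicate_pmf of_bool_def not_less subset_iff in_lists_conv_set)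
      then show ?thesis by (meson order_trans zero_le)
    next
      case False
      then have "\<theta>5 = 2 powr (real n * (info r5 + \<delta>))" unfolding \<theta>5_def by (rule if_not_P)
      then show ?thesis using c5(3) by simp
    qed
    have pw: "2 powr (real n * (a - 2 * \<delta>)) * (1 / 2 powr (real n * (a - \<delta>))) = d n" for a
      by (simp add: d_def powr_diff[symmetric] algebra_simps)
    have b1: "real (M1 n - 1) * (1 / ?\<theta>1) \<le> d n"
      using mult_right_mono[OF s1[of n], of "1 / ?\<theta>1"] pw by simp
    have b2: "real (M1 n * K n - 1) * (1 / ?\<theta>2) \<le> 4 * d n"
      using mult_right_mono[OF s2[of n], of "1 / ?\<theta>2"] pw[of "info r2"] by simp
    have b4: "real (M2 n - 1) * (1 / ?\<theta>4) \<le> d n"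
      using mult_right_mono[OF s4[of n], of "1 / ?\<theta>4"] pw by simp
    have b5: "(1 - 1 / \<theta>5) ^ N n \<le> exp (- (2 powr (real n * \<delta>)))"
    proof (cases "(\<forall>n. N n = 1) \<and> (\<forall>z\<in>set_pmf L. r5 z \<le> 1)")
      case False
      then have N: "2 powr (real n * (info r5 + 2 * \<delta>)) \<le> real (N n)" and t: "\<theta>5 = 2 powr (real n * (info r5 + \<delta>))"
        using cov by (auto simp: \<theta>5_def)
      have "(1 - 1 / \<theta>5) ^ N n \<le> exp (- (1 / \<theta>5)) ^ N n"
        using \<theta>5 exp_ge_add_one_self[of "- (1 / \<theta>5)"] by (intro power_mono) auto
      also have "\<dots> = exp (- (real (N n) / \<theta>5))" by (simp add: exp_of_nat_mult[symmetric])
      also have "\<dots> \<le> exp (- (2 powr (real n * (info r5 + 2 * \<delta>)) / \<theta>5))"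
        using N \<theta>5 by (simp add: divide_right_mono)
      also have "2 powr (real n * (info r5 + 2 * \<delta>)) / \<theta>5 = 2 powr (real n * \<delta>)"
        unfolding t by (simp add: powr_diff[symmetric] algebra_simps)
      finally show ?thesis .
    qed (simp add: \<theta>5_def)
    have b3: "(if N n = 1 then 0 else ennreal (real (N n) * (1 / ?\<theta>3) / real (K n))) \<le> ennreal (2 * d n)"
    proof (cases "N n = 1")
      case False
      then have "real (N n) \<le> 2 * 2 powr (real n * (info r3 - 2 * \<delta>)) * real (K n)" using cov by auto
      then have "real (N n) / real (K n) \<le> 2 * 2 powr (real n * (info r3 - 2 * \<delta>))"
        using pos(2)[of n] by (simp add: field_simps)
      then have "real (N n) / real (K n) * (1 / ?\<theta>3) \<le> 2 * 2 powr (real n * (info r3 - 2 * \<delta>)) * (1 / ?\<theta>3)"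
        by (rule mult_right_mono) simp
      also have "\<dots> = 2 * d n" using pw[of "info r3"] by simp
      finally have "real (N n) * (1 / ?\<theta>3) / real (K n) \<le> 2 * d n" by (simp add: mult.commute)
      then show ?thesis using False by (simp add: ennreal_leI)
    qed simp
    have "block_bound n (M1 n) (K n) (N n) (M2 n) \<gamma> ?\<theta>1 ?\<theta>2 ?\<theta>3 ?\<theta>4 \<theta>5 \<le>
      (ennreal (c1 ^ n) + ennreal (c2 ^ n) + ennreal (1 / \<gamma>) * (ennreal (c3 ^ n) + ennreal (c4 ^ n)) + ennreal (c5 ^ n)) +
       (ennreal (d n) + ennreal (4 * d n) + ennreal (exp (- (2 powr (real n * \<delta>)))) + ennreal \<gamma> + ennreal (2 * d n) + ennreal (d n))"
      unfolding block_bound_def Eavg_def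
      by (intro add_mono mult_left_mono c1 c2 c3 c4 e5 b3 ennreal_leI b1 b2 b4 b5 order_refl) simp
    also have "\<dots> = ennreal (tot n)"
      using c1(1) c2(1) c3(1) c4(1) c5(1) d0[of n] \<gamma> unfolding tot_def
      by (simp add: ennreal_plus[symmetric] ennreal_mult[symmetric] del: ennreal_plus)
    also have "\<dots> \<le> ennreal \<epsilon>" using n by (intro ennreal_leI) simp
    finally have le: "block_bound n (M1 n) (K n) (N n) (M2 n) \<gamma> ?\<theta>1 ?\<theta>2 ?\<theta>3 ?\<theta>4 \<theta>5 \<le> ennreal \<epsilon>" .
    have \<theta>: "?\<theta>1 > 0" "?\<theta>2 > 0" "?\<theta>3 > 0" "?\<theta>4 > 0" by simp_all
    show "block_reliable W n (M1 n) (K n) (M2 n) (ennreal \<epsilon>)"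
      using reliable_block[OF pos(1,2,3,4) \<gamma> \<theta>5 \<theta>, of n] order_trans[OF _ le] unfolding block_reliable_def by blast
  qed
qed

end

section \<open>From block codes to codes of every length\<close>

lemma trivial_code:
  assumes "0 \<le> RFB" "0 \<le> R1" "0 \<le> R2"
  shows "\<exists>c. valid_code N RFB R1 R2 c"
proof -
  show ?thesis using assms num_msgs_pos
    by (intro exI[of _ "\<lparr>fb_alphabet = \<lambda>_. {0}, fb_enc = \<lambda>_ _. 0, enc = \<lambda>_ _ _ _. undefined, dec1 = \<lambda>_. 1, dec2 = \<lambda>_. 1\<rparr>"])
      (auto simp: valid_code_def ge_one_powr_ge_zero)
qed

lemma error_prob_nonneg: "0 \<le> error_prob W N R1 R2 c"
  by (simp add: error_prob_def)

text \<open>One sequence of codes has to serve all \<epsilon>. At each \<open>N\<close> a code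
  within \<open>1 / real (Suc N)\<close> of the infimum of the error probabilities is taken, and the
  infimum tends to 0 by assumption.\<close>

lemma achievableI:
  assumes "0 \<le> RFB" "0 \<le> R1" "0 \<le> R2"
    and ev: "\<And>\<epsilon>. \<epsilon> > 0 \<Longrightarrow> \<forall>\<^sub>F N in sequentially. \<exists>c. valid_code N RFB R1 R2 c \<and> error_prob W N R1 R2 c \<le> \<epsilon>"
  shows "achievable W RFB (R1, R2)"
proof -
  define S where "S N = (\<lambda>c. error_prob W N R1 R2 c) ` {c. valid_code N RFB R1 R2 c}" for N
  have ne: "S N \<noteq> {}" for N using trivial_code[OF assms(1-3), of N] by (auto simp: S_def)
  have bdd: "bdd_below (S N)" for N by (auto simp: S_def intro!: bdd_belowI[of _ 0] error_prob_nonneg)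
  have "\<exists>c. valid_code N RFB R1 R2 c \<and> error_prob W N R1 R2 c < Inf (S N) + 1 / real (Suc N)" for N
    using cInf_lessD[OF ne[of N], of "Inf (S N) + 1 / real (Suc N)"] by (auto simp: S_def)
  then obtain c where c: "\<And>N. valid_code N RFB R1 R2 (c N)" "\<And>N. error_prob W N R1 R2 (c N) < Inf (S N) + 1 / real (Suc N)"
    by metis
  have "(\<lambda>N. error_prob W N R1 R2 (c N)) \<longlonglongrightarrow> 0"
  proof (rule order_tendstoI)
    fix a :: real assume "a < 0"
    then show "\<forall>\<^sub>F N in sequentially. a < error_prob W N R1 R2 (c N)"
      using error_prob_nonneg order_less_le_trans by (intro always_eventually) blast
  next
    fix a :: real assume a: "0 < a"
    have "(\<lambda>N. 1 / real (Suc N)) \<longlonglongrightarrow> 0" by real_asymp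
    then have "\<forall>\<^sub>F N in sequentially. 1 / real (Suc N) < a / 2" using a by (intro order_tendstoD(2)) auto
    moreover have "\<forall>\<^sub>F N in sequentially. \<exists>c. valid_code N RFB R1 R2 c \<and> error_prob W N R1 R2 c \<le> a / 2"
      using ev[of "a / 2"] a by simp
    ultimately show "\<forall>\<^sub>F N in sequentially. error_prob W N R1 R2 (c N) < a"
    proof eventually_elim
      case (elim N)
      then have "Inf (S N) \<le> a / 2" using cInf_lower2[OF _ _ bdd] by (fastforce simp: S_def)
      then show ?case using c(2)[of N] elim by linarith
    qed
  qed
  then show ?thesis using assms c unfolding achievable_def by (intro conjI exI[of _ c]) auto
qed

text \<open>The case \<open>R = 0\<close> stands apart because there is then only one message, and
  the block rate \<rho> may be negative.\<close>

lemma num_msgs_le_power: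
  assumes "R = 0 \<or> 0 < R \<and> real N * R \<le> real n * \<rho> * real B" and M: "2 powr (real n * \<rho>) \<le> real M" "M > 0"
  shows "num_msgs N R \<le> M ^ B"
  using assms(1)
proof
  assume "R = 0"
  then show ?thesis using M by (simp add: num_msgs_def Suc_le_eq)
next
  assume R: "0 < R \<and> real N * R \<le> real n * \<rho> * real B"
  have "real (num_msgs N R) \<le> 2 powr (real N * R)" by (simp add: num_msgs_def)
  also have "\<dots> \<le> 2 powr (real n * \<rho> * real B)" using R by (intro powr_mono) auto
  also have "\<dots> = (2 powr (real n * \<rho>)) ^ B" by (simp add: powr_powr[symmetric] powr_realpow)
  also have "\<dots> \<le> real M ^ B" using M by (intro power_mono) auto
  finally show ?thesis by (simp flip: of_nat_power)
qed

text \<open>The extra block makes the comparison one between \<open>Suc B\<close> and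
  \<open>B\<close> blocks, and the padding adds at most \<open>Suc B * R\<close> bits, a constant.
  The gap \<open>e\<close> per letter, times \<open>n\<close>, pays for the latter.\<close>

lemma eventually_rate:
  assumes "\<rho> * real B > real (Suc B) * R" "R \<ge> 0"
  shows "\<forall>\<^sub>F n in sequentially. \<forall>N. N \<le> Suc n * Suc B \<longrightarrow> real N * R \<le> real n * \<rho> * real B"
proof -
  define e where "e = \<rho> * real B - real (Suc B) * R"
  have "e > 0" using assms by (simp add: e_def)
  have "\<forall>\<^sub>F n in sequentially. real n * e \<ge> real (Suc B) * R"
    using \<open>e > 0\<close> by real_asymp
  then show ?thesis
  proof (rule eventually_mono, intro allI impI)
    fix n N assume n: "real (Suc B) * R \<le> real n * e" and N: "N \<le> Suc n * Suc B"
    have "real N * R \<le> real (Suc n * Suc B) * R" using N assms by (intro mult_right_mono) linarith+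
    also have "\<dots> = real n * (real (Suc B) * R) + real (Suc B) * R" by (simp add: algebra_simps)
    also have "\<dots> \<le> real n * \<rho> * real B" using n by (simp add: e_def algebra_simps)
    finally show "real N * R \<le> real n * \<rho> * real B" .
  qed
qed

context letters
begin

text \<open>\<rho>1, \<rho>2 and \<kappa> are the rates of one block for the cloud message, the
  satellite and the bin index. The bound on \<kappa> is the covering rate minus the rate decodable
  inside a bin, with margins; the second alternative uses neither bins nor feedback.\<close>

lemma achievable_rates:
  assumes fin: "finite (set_pmf L)" and "\<delta> > 0" and R: "0 \<le> R1" "0 \<le> R2" "0 \<le> RFB"
    and \<rho>1: "R1 = 0 \<or> R1 < \<rho>1" "\<rho>1 \<le> info r1 - 2 * \<delta>"
    and \<rho>2: "R2 = 0 \<or> R2 < \<rho>2" "\<rho>2 \<le> info r4 - 2 * \<delta>"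
    and cov: "(0 < \<kappa> \<and> \<kappa> < RFB \<and> info r5 - info r3 + 4 * \<delta> \<le> \<kappa> \<and> \<rho>1 + \<kappa> \<le> info r2 - 2 * \<delta> \<and>
        \<kappa> \<le> info r2 - 2 * \<delta> \<and> 0 \<le> info r5) \<or>
      (\<rho>1 \<le> info r2 - 2 * \<delta> \<and> (\<forall>z\<in>set_pmf L. r5 z \<le> 1))"
  shows "achievable W RFB (R1, R2)"
proof (rule achievableI)
  fix \<epsilon> :: real assume \<epsilon>: "\<epsilon> > 0"
  define triv where "triv \<longleftrightarrow> \<rho>1 \<le> info r2 - 2 * \<delta> \<and> (\<forall>z\<in>set_pmf L. r5 z \<le> 1)"
  \<comment> \<open>The added 1 guarantees at least one message even for negative \<rho>1, and still
    leaves at most \<open>2 powr (real n * \<rho>1)\<close> competitors.\<close>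
  define M1 where "M1 n = nat \<lfloor>2 powr (real n * \<rho>1)\<rfloor> + 1" for n :: nat
  define M2 where "M2 n = nat \<lfloor>2 powr (real n * \<rho>2)\<rfloor> + 1" for n :: nat
  define K where "K n = (if triv then 1 else nat \<lfloor>2 powr (real n * \<kappa>)\<rfloor> + 1)" for n :: nat
  define N where "N n = (if triv then 1 else nat \<lceil>2 powr (real n * (info r5 + 2 * \<delta>))\<rceil>)" for n :: nat
  have fl: "real (nat \<lfloor>x\<rfloor> + 1) \<ge> x" "real (nat \<lfloor>x\<rfloor>) \<le> x" if "x > 0" for x :: real
    using that by linarith+
  have M: "2 powr (real n * \<rho>1) \<le> real (M1 n)" "2 powr (real n * \<rho>2) \<le> real (M2 n)" for n
    unfolding M1_def M2_def by (intro fl; simp)+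
  have pos: "M1 n > 0" "K n > 0" "N n > 0" "M2 n > 0" for n
    by (simp_all add: M1_def M2_def K_def N_def)
  have Kle: "real (K n) \<le> 2 * 2 powr (real n * \<kappa>)" "2 powr (real n * \<kappa>) \<le> real (K n)" if "\<not> triv" for n
  proof -
    have "1 \<le> 2 powr (real n * \<kappa>)" using that cov by (intro ge_one_powr_ge_zero) (auto simp: triv_def)
    then show "real (K n) \<le> 2 * 2 powr (real n * \<kappa>)" "2 powr (real n * \<kappa>) \<le> real (K n)"
      using that unfolding K_def by simp_all linarith+
  qed
  have blocks: "\<forall>\<^sub>F n in sequentially. block_reliable W n (M1 n) (K n) (M2 n) (ennreal e)" if "e > 0" for e
  proof (rule block_codes[OF fin \<open>\<delta> > 0\<close> \<open>e > 0\<close>])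
    fix n
    show "M1 n > 0" "K n > 0" "N n > 0" "M2 n > 0" by (rule pos)+
    have M1le: "real (M1 n - 1) \<le> 2 powr (real n * \<rho>1)" by (simp add: M1_def)
    also have "\<dots> \<le> 2 powr (real n * (info r1 - 2 * \<delta>))" using \<rho>1 by (intro powr_mono mult_left_mono) auto
    finally show "real (M1 n - 1) \<le> 2 powr (real n * (info r1 - 2 * \<delta>))" .
    have "real (M2 n - 1) \<le> 2 powr (real n * \<rho>2)" by (simp add: M2_def)
    also have "\<dots> \<le> 2 powr (real n * (info r4 - 2 * \<delta>))" using \<rho>2 by (intro powr_mono mult_left_mono) auto
    finally show "real (M2 n - 1) \<le> 2 powr (real n * (info r4 - 2 * \<delta>))" .
    show "real (M1 n * K n - 1) \<le> 4 * 2 powr (real n * (info r2 - 2 * \<delta>))"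
    proof (cases triv)
      case True
      have "real (M1 n * K n - 1) \<le> 2 powr (real n * \<rho>1)" using M1le True by (simp add: K_def)
      also have "\<dots> \<le> 2 powr (real n * (info r2 - 2 * \<delta>))"
        using True by (intro powr_mono mult_left_mono) (auto simp: triv_def)
      also have "\<dots> \<le> 4 * 2 powr (real n * (info r2 - 2 * \<delta>))" by simp
      finally show ?thesis .
    next
      case False
      then have c: "\<rho>1 + \<kappa> \<le> info r2 - 2 * \<delta>" "\<kappa> \<le> info r2 - 2 * \<delta>" using cov by (auto simp: triv_def)
      have "real (M1 n * K n - 1) \<le> real (M1 n) * real (K n)"
        unfolding of_nat_mult[symmetric] of_nat_le_iff by simp
      \<comment> \<open>The 1 from rounding contributes the term with \<kappa> alone. As \<rho>1 may
        be negative, \<open>\<kappa> \<le> info r2 - 2 * \<delta>\<close> is a condition of its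
        own.\<close>
      also have "\<dots> \<le> (2 powr (real n * \<rho>1) + 1) * (2 * 2 powr (real n * \<kappa>))"
        using M1le pos(1)[of n] Kle(1)[OF False, of n] by (intro mult_mono) auto
      also have "\<dots> = 2 * 2 powr (real n * (\<rho>1 + \<kappa>)) + 2 * 2 powr (real n * \<kappa>)"
        by (simp add: algebra_simps powr_add)
      also have "\<dots> \<le> 2 * 2 powr (real n * (info r2 - 2 * \<delta>)) + 2 * 2 powr (real n * (info r2 - 2 * \<delta>))"
        using c by (intro add_mono mult_left_mono powr_mono) auto
      finally show ?thesis by simp
    qed
  next
    show "(info r5 \<ge> 0 \<and> (\<forall>n. 2 powr (real n * (info r5 + 2 * \<delta>)) \<le> real (N n) \<and>
        real (N n) \<le> 2 * 2 powr (real n * (info r3 - 2 * \<delta>)) * real (K n))) \<or>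
      (\<forall>n. N n = 1) \<and> (\<forall>z\<in>set_pmf L. r5 z \<le> 1)"
    proof (cases triv)
      case True
      then show ?thesis by (auto simp: N_def triv_def)
    next
      case False
      then have c: "0 \<le> info r5" "info r5 - info r3 + 4 * \<delta> \<le> \<kappa>" using cov by (auto simp: triv_def)
      have "2 powr (real n * (info r5 + 2 * \<delta>)) \<le> real (N n) \<and>
        real (N n) \<le> 2 * 2 powr (real n * (info r3 - 2 * \<delta>)) * real (K n)" for n
      proof
        show "2 powr (real n * (info r5 + 2 * \<delta>)) \<le> real (N n)" using False by (simp add: N_def le_of_int_ceiling)
        have "1 \<le> 2 powr (real n * (info r5 + 2 * \<delta>))" using c \<open>\<delta> > 0\<close> by (intro ge_one_powr_ge_zero) auto
        then have "real (N n) \<le> 2 * 2 powr (real n * (info r5 + 2 * \<delta>))"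
          using False unfolding N_def by simp linarith
        also have "\<dots> \<le> 2 * 2 powr (real n * (info r3 - 2 * \<delta>) + real n * \<kappa>)"
          unfolding distrib_left[symmetric] using c by (intro mult_left_mono powr_mono) auto
        also have "\<dots> = 2 * 2 powr (real n * (info r3 - 2 * \<delta>)) * 2 powr (real n * \<kappa>)" by (simp add: powr_add)
        also have "\<dots> \<le> 2 * 2 powr (real n * (info r3 - 2 * \<delta>)) * real (K n)"
          using Kle(2)[OF False] by (intro mult_left_mono) auto
        finally show "real (N n) \<le> 2 * 2 powr (real n * (info r3 - 2 * \<delta>)) * real (K n)" .
      qed
      then show ?thesis using c by blast
    qed
  qed
  \<comment> \<open>\<open>B\<close> has to be so large that losing one block in
    \<open>Suc B\<close> fits into the gap between \<open>R\<close> and \<rho>.\<close>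
  have exB: "\<exists>B0. \<forall>B\<ge>B0. \<rho> * real B > real (Suc B) * R" if "R < \<rho>" for R \<rho> :: real
  proof -
    have "\<forall>\<^sub>F B in sequentially. \<rho> * real B > real (Suc B) * R" using that by real_asymp
    then show ?thesis by (simp add: eventually_sequentially)
  qed
  have "\<exists>B0. \<forall>B\<ge>B0. R1 = 0 \<or> \<rho>1 * real B > real (Suc B) * R1" using exB[of R1 \<rho>1] \<rho>1 by blast
  then obtain B1 where B1: "\<forall>B\<ge>B1. R1 = 0 \<or> \<rho>1 * real B > real (Suc B) * R1" by blast
  have "\<exists>B0. \<forall>B\<ge>B0. R2 = 0 \<or> \<rho>2 * real B > real (Suc B) * R2" using exB[of R2 \<rho>2] \<rho>2 by blast
  then obtain B2 where B2: "\<forall>B\<ge>B2. R2 = 0 \<or> \<rho>2 * real B > real (Suc B) * R2" by blast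
  define B where "B = max B1 B2"
  have B: "R1 = 0 \<or> \<rho>1 * real B > real (Suc B) * R1" "R2 = 0 \<or> \<rho>2 * real B > real (Suc B) * R2"
    using B1 B2 by (auto simp: B_def simp del: of_nat_Suc)
  have rate1: "\<forall>\<^sub>F n in sequentially. \<forall>N. N \<le> Suc n * Suc B \<longrightarrow> R1 = 0 \<or> 0 < R1 \<and> real N * R1 \<le> real n * \<rho>1 * real B"
    using eventually_rate[where R=R1 and B=B and \<rho>=\<rho>1] B(1) R by (cases "R1 = 0") (auto elim!: eventually_mono)
  have rate2: "\<forall>\<^sub>F n in sequentially. \<forall>N. N \<le> Suc n * Suc B \<longrightarrow> R2 = 0 \<or> 0 < R2 \<and> real N * R2 \<le> real n * \<rho>2 * real B"
    using eventually_rate[where R=R2 and B=B and \<rho>=\<rho>2] B(2) R by (cases "R2 = 0") (auto elim!: eventually_mono)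
  have fb: "\<forall>\<^sub>F n in sequentially. real (K n) \<le> 2 powr (real n * RFB)"
  proof (cases triv)
    case True
    then show ?thesis using R by (simp add: K_def ge_one_powr_ge_zero)
  next
    case False
    then have "\<kappa> < RFB" using cov by (auto simp: triv_def)
    \<comment> \<open>The 1 in the exponent is the factor 2 by which rounding may enlarge
      \<open>K n\<close>.\<close>
    then have "\<forall>\<^sub>F n in sequentially. 1 + real n * \<kappa> \<le> real n * RFB" by real_asymp
    then show ?thesis
    proof eventually_elim
      case (elim n)
      have "real (K n) \<le> 2 powr (1 + real n * \<kappa>)" using Kle(1)[OF False] by (simp add: powr_add)
      also have "\<dots> \<le> 2 powr (real n * RFB)" using elim by (intro powr_mono) auto
      finally show ?case .
    qed
  qed
  have "\<epsilon> / real (Suc B) > 0" using \<epsilon> by simp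
  from blocks[OF this] rate1 rate2 fb eventually_gt_at_top[of "0::nat"]
  have "\<forall>\<^sub>F n in sequentially. \<forall>N. Suc B * n \<le> N \<and> N \<le> Suc n * Suc B \<longrightarrow>
     (\<exists>c :: ('x, 'y1, 'y2) fb_code. valid_code N RFB R1 R2 c \<and> error_prob W N R1 R2 c \<le> \<epsilon>)"
  proof eventually_elim
    case (elim n)
    show ?case
    proof (intro allI impI)
      fix N assume N: "Suc B * n \<le> N \<and> N \<le> Suc n * Suc B"
      have "real (K n ^ B) \<le> (2 powr (real n * RFB)) ^ B" using elim(4) by (simp add: power_mono)
      also have "\<dots> = 2 powr (real n * RFB * real B)" by (simp add: powr_powr[symmetric] powr_realpow)
      also have "\<dots> \<le> 2 powr (real N * RFB)"
      proof (intro powr_mono)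
        have "real (n * B) \<le> real N" using N by (subst of_nat_le_iff) (simp add: mult.commute)
        from mult_right_mono[OF this, of RFB] show "real n * RFB * real B \<le> real N * RFB"
          using R by (simp add: mult_ac)
      qed simp
      finally have K: "real (K n ^ B) \<le> 2 powr (real N * RFB)" .
      have "\<exists>c :: ('x, 'y1, 'y2) fb_code. valid_code N RFB R1 R2 c \<and>
          error_prob W N R1 R2 c \<le> real (Suc B) * (\<epsilon> / real (Suc B))"
      proof (rule multi_block)
        show "num_msgs N R1 \<le> M1 n ^ B" using elim(2) N M(1)[of n] pos(1)[of n] by (intro num_msgs_le_power[of _ _ n \<rho>1]) auto
        show "num_msgs N R2 \<le> M2 n ^ B" using elim(3) N M(2)[of n] pos(4)[of n] by (intro num_msgs_le_power[of _ _ n \<rho>2]) auto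
        show "block_reliable W n (M1 n) (K n) (M2 n) (ennreal (\<epsilon> / real (Suc B)))" by (rule elim(1))
        show "0 < n" "0 < K n" "0 < M1 n" "0 < M2 n" using elim(5) pos by auto
        show "0 \<le> \<epsilon> / real (Suc B)" using \<epsilon> by simp
        show "Suc B * n \<le> N" using N by blast
      qed (fact K R)+
      then show "\<exists>c :: ('x, 'y1, 'y2) fb_code. valid_code N RFB R1 R2 c \<and> error_prob W N R1 R2 c \<le> \<epsilon>"
        by (simp del: of_nat_Suc)
    qed
  qed
  \<comment> \<open>A given blocklength \<open>N\<close> is served with block size
    \<open>N div Suc B\<close>, so every large \<open>N\<close> falls into one of the windows
    treated above.\<close>
  moreover have "filterlim (\<lambda>N. N div Suc B) sequentially sequentially"
    unfolding filterlim_at_top eventually_sequentially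
    by (auto simp: less_eq_div_iff_mult_less_eq simp del: mult_Suc_right)
  ultimately have "\<forall>\<^sub>F N in sequentially. \<forall>N'. Suc B * (N div Suc B) \<le> N' \<and> N' \<le> Suc (N div Suc B) * Suc B \<longrightarrow>
     (\<exists>c :: ('x, 'y1, 'y2) fb_code. valid_code N' RFB R1 R2 c \<and> error_prob W N' R1 R2 c \<le> \<epsilon>)"
    by (rule eventually_compose_filterlim)
  then show "\<forall>\<^sub>F N in sequentially. \<exists>c :: ('x, 'y1, 'y2) fb_code. valid_code N RFB R1 R2 c \<and> error_prob W N R1 R2 c \<le> \<epsilon>"
  proof eventually_elim
    case (elim N)
    have "N < Suc (N div Suc B) * Suc B" using dividend_less_div_times[of "Suc B" N] by simp
    then show ?case using elim[rule_format, of N] times_div_less_eq_dividend[of "Suc B" N] by simp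
  qed
qed (use R in auto)

end

section \<open>Information quantities of a single letter\<close>

text \<open>From \<open>ln x \<le> x - 1\<close>. The information inequalities below all arise by
  exhibiting a ratio of mean at most 1.\<close>

lemma gibbs:
  assumes fin: "finite (set_pmf p)" and pos: "\<And>z. z \<in> set_pmf p \<Longrightarrow> 0 < r z"
    and le: "(\<integral>\<^sup>+z. ennreal (r z) \<partial>measure_pmf p) \<le> 1"
  shows "measure_pmf.expectation p (\<lambda>z. log 2 (r z)) \<le> 0"
proof -
  have sum1: "(\<Sum>z\<in>set_pmf p. pmf p z) = 1" using fin by (intro sum_pmf_eq_1) auto
  have "(\<integral>\<^sup>+z. ennreal (r z) \<partial>measure_pmf p) = (\<Sum>z\<in>set_pmf p. ennreal (pmf p z * r z))"
    using pos by (subst nn_integral_measure_pmf_finite[OF fin])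
      (auto intro!: sum.cong simp: ennreal_mult less_imp_le mult.commute)
  also have "\<dots> = ennreal (\<Sum>z\<in>set_pmf p. pmf p z * r z)"
    using pos by (intro sum_ennreal) (simp add: less_imp_le)
  finally have "ennreal (\<Sum>z\<in>set_pmf p. pmf p z * r z) = (\<integral>\<^sup>+z. ennreal (r z) \<partial>measure_pmf p)" ..
  with le have le1: "(\<Sum>z\<in>set_pmf p. pmf p z * r z) \<le> 1"
    by (metis ennreal_le_1)
  have "measure_pmf.expectation p (\<lambda>z. log 2 (r z)) = (\<Sum>z\<in>set_pmf p. pmf p z * log 2 (r z))"
    by (subst integral_measure_pmf[OF fin]) auto
  also have "\<dots> \<le> (\<Sum>z\<in>set_pmf p. pmf p z * ((r z - 1) / ln 2))"
    using pos by (intro sum_mono mult_left_mono) (auto simp: log_def divide_right_mono ln_le_minus_one)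
  also have "\<dots> = ((\<Sum>z\<in>set_pmf p. pmf p z * r z) - (\<Sum>z\<in>set_pmf p. pmf p z)) / ln 2"
    by (simp add: sum_divide_distrib sum_subtractf[symmetric] algebra_simps diff_divide_distrib)
  also have "\<dots> \<le> 0" using le1 sum1 by (simp add: divide_nonpos_pos)
  finally show ?thesis .
qed

lemma nn_integral_ratio_le:
  assumes "\<And>t. 0 \<le> g t"
  shows "(\<integral>\<^sup>+t. ennreal (g t / pmf p t) \<partial>measure_pmf p) \<le> (\<integral>\<^sup>+t. ennreal (g t) \<partial>count_space UNIV)"
proof -
  have "(\<integral>\<^sup>+t. ennreal (g t / pmf p t) \<partial>measure_pmf p) = (\<integral>\<^sup>+t. ennreal (pmf p t) * ennreal (g t / pmf p t) \<partial>count_space UNIV)"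
    by (rule nn_integral_measure_pmf)
  also have "\<dots> \<le> (\<integral>\<^sup>+t. ennreal (g t) \<partial>count_space UNIV)"
    using assms by (intro nn_integral_mono) (auto simp: ennreal_mult[symmetric] intro!: ennreal_leI)
  finally show ?thesis .
qed

lemma nn_integral_pmf_marginal:
  assumes "inj f" and "f ` UNIV = h -` {b}"
  shows "(\<integral>\<^sup>+t. ennreal (pmf J (f t)) \<partial>count_space UNIV) = ennreal (pmf (map_pmf h J) b)"
proof -
  have "(\<integral>\<^sup>+t. ennreal (pmf J (f t)) \<partial>count_space UNIV) = emeasure J (f ` UNIV)"
    using assms(1) by (rule nn_integral_pmf')
  also have "\<dots> = ennreal (pmf (map_pmf h J) b)"
    unfolding assms(2) by (simp add: emeasure_pmf_single[symmetric])
  finally show ?thesis .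
qed

lemma nn_integral_pmf_divide_marginal:
  assumes "inj f" and "f ` UNIV = h -` {b}"
  shows "(\<integral>\<^sup>+t. ennreal (pmf J (f t) / pmf (map_pmf h J) b) \<partial>count_space UNIV) \<le> 1"
proof -
  let ?c = "pmf (map_pmf h J) b"
  have "(\<integral>\<^sup>+t. ennreal (pmf J (f t) / ?c) \<partial>count_space UNIV) = (\<integral>\<^sup>+t. ennreal (1 / ?c) * ennreal (pmf J (f t)) \<partial>count_space UNIV)"
    by (simp add: ennreal_mult[symmetric])
  also have "\<dots> = ennreal (1 / ?c) * (\<integral>\<^sup>+t. ennreal (pmf J (f t)) \<partial>count_space UNIV)"
    by (rule nn_integral_cmult) simp
  also have "\<dots> = ennreal (1 / ?c * ?c)"
    unfolding nn_integral_pmf_marginal[OF assms] by (simp add: ennreal_mult[symmetric])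
  also have "\<dots> \<le> 1" by simp
  finally show ?thesis .
qed

context letters
begin

text \<open>The counterpart of \<open>J4\<close> without the description. The mean logarithm of
  \<open>r6\<close> is I(X;Y2|U,Q), the rate left to the satellite when T is erased.\<close>

definition J6 :: "'v \<Rightarrow> ('x \<times> 'y2) pmf" where "J6 v = map_pmf (\<lambda>(x, y, t). (x, snd y)) (JT v)"
definition "r6 z = dens (J6 (lv z)) (lx z, snd (ly z))" for z

lemma fst_J6: "map_pmf fst (J6 v) = PX v"
  by (simp add: J6_def JT_def pmf.map_comp o_def case_prod_unfold map_bind_pmf map_pmf_const bind_return_pmf')

lemma snd_J: "map_pmf snd (J3 v) = map_pmf snd (J6 v)" "map_pmf snd (J4 v) = J3 v"
   "map_pmf (\<lambda>w. (fst w, snd (snd w))) (J4 v) = J6 v"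
  by (simp_all add: J3_def J4_def J6_def pmf.map_comp o_def case_prod_unfold)

lemma r6_pos: "z \<in> set_pmf L \<Longrightarrow> 0 < r6 z"
  unfolding r6_def J6_def by (intro dens_pos) (auto intro!: rev_image_eqI[OF set_JT])

lemma nn_integral_L:
  "(\<integral>\<^sup>+z. F z \<partial>L) = (\<integral>\<^sup>+q. \<integral>\<^sup>+v. \<integral>\<^sup>+x. \<integral>\<^sup>+y. \<integral>\<^sup>+t. F ((((q, v), x), y), t)
     \<partial>PT v (fst y) \<partial>W x \<partial>PX v \<partial>PV q \<partial>PQ)"
  unfolding L_def by simp

text \<open>Integrating over \<open>t\<close> cancels the kernel \<open>PT\<close> in the
  denominator and leaves the total mass of \<open>g\<close>, a competing subprobability law for T.
  Via \<open>gibbs\<close> each use states that a divergence of \<open>PT\<close> from such a law is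
  nonnegative.\<close>

lemma expected_ratio_le:
  assumes "\<And>z. z \<in> set_pmf L \<Longrightarrow> r z = g (lv z) (lx z) (ly z) (lt z) / pmf (PT (lv z) (fst (ly z))) (lt z)"
    and "\<And>v x y t. 0 \<le> g v x y t"
    and "\<And>v x y. (\<integral>\<^sup>+t. ennreal (g v x y t) \<partial>count_space UNIV) \<le> 1"
  shows "(\<integral>\<^sup>+z. ennreal (r z) \<partial>L) \<le> 1"
proof -
  have "(\<integral>\<^sup>+z. ennreal (r z) \<partial>L) = (\<integral>\<^sup>+z. ennreal (g (lv z) (lx z) (ly z) (lt z) / pmf (PT (lv z) (fst (ly z))) (lt z)) \<partial>L)"
    by (rule nn_integral_pmf_cong) (simp add: assms(1))
  also have "\<dots> = (\<integral>\<^sup>+q. \<integral>\<^sup>+v. \<integral>\<^sup>+x. \<integral>\<^sup>+y. \<integral>\<^sup>+t. ennreal (g v x y t / pmf (PT v (fst y)) t)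
     \<partial>PT v (fst y) \<partial>W x \<partial>PX v \<partial>PV q \<partial>PQ)"
    unfolding nn_integral_L by (simp add: l_defs)
  also have "\<dots> \<le> 1"
    by (rule nn_integral_pmf_le_const, rule nn_integral_pmf_le_const, rule nn_integral_pmf_le_const,
        rule nn_integral_pmf_le_const) (use assms(2,3) in \<open>auto intro: order_trans[OF nn_integral_ratio_le]\<close>)
  finally show ?thesis .
qed

lemma pmf_PTV_pos: "z \<in> set_pmf L \<Longrightarrow> 0 < pmf (PTV (lv z)) (lt z)"
  unfolding PTV_def by (intro pmf_positive) (auto simp: pmf.map_comp intro!: rev_image_eqI[OF set_JT])

lemma pmf_PT_pos: "z \<in> set_pmf L \<Longrightarrow> 0 < pmf (PT (lv z) (fst (ly z))) (lt z)"
  by (intro pmf_positive) (simp add: set_L)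

lemma r5_eq: "z \<in> set_pmf L \<Longrightarrow> r5 z = pmf (PT (lv z) (fst (ly z))) (lt z) / pmf (PTV (lv z)) (lt z)"
  using pmf_PT_eq[of z] pmf_PTV_pos[of z] by (simp add: field_simps)

lemma pmf_J3_pos: "z \<in> set_pmf L \<Longrightarrow> 0 < pmf (J3 (lv z)) (lt z, snd (ly z))"
  unfolding J3_def by (intro pmf_positive) (auto simp: pmf.map_comp intro!: rev_image_eqI[OF set_JT])

lemma pmf_J4_pos: "z \<in> set_pmf L \<Longrightarrow> 0 < pmf (J4 (lv z)) (lx z, (lt z, snd (ly z)))"
  unfolding J4_def by (intro pmf_positive) (auto simp: pmf.map_comp intro!: rev_image_eqI[OF set_JT])

lemma pmf_J6_pos: "z \<in> set_pmf L \<Longrightarrow> 0 < pmf (J6 (lv z)) (lx z, snd (ly z))"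
  unfolding J6_def by (intro pmf_positive) (auto simp: pmf.map_comp intro!: rev_image_eqI[OF set_JT])

lemma pmf_snd_J6_pos: "z \<in> set_pmf L \<Longrightarrow> 0 < pmf (map_pmf snd (J6 (lv z))) (snd (ly z))"
  unfolding J6_def by (intro pmf_positive) (auto simp: pmf.map_comp intro!: rev_image_eqI[OF set_JT])

lemma pmf_PX_pos: "z \<in> set_pmf L \<Longrightarrow> 0 < pmf (PX (lv z)) (lx z)"
  by (intro pmf_positive) (simp add: set_L)

lemmas pmf_letter_pos = pmf_PTV_pos pmf_PT_pos pmf_J3_pos pmf_J4_pos pmf_J6_pos pmf_snd_J6_pos pmf_PX_pos

text \<open>The common factor \<open>1 / PTV\<close> cancels; what remains is the law of T given (v,
  y1) over its law given (v, y2).\<close>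

lemma r5_over_r3:
  assumes "z \<in> set_pmf L"
  shows "r5 z / r3 z = pmf (PT (lv z) (fst (ly z))) (lt z) * pmf (map_pmf snd (J6 (lv z))) (snd (ly z))
     / pmf (J3 (lv z)) (lt z, snd (ly z))"
  using pmf_letter_pos[OF assms] by (simp add: r5_eq[OF assms] r3_def dens_def fst_J snd_J)

lemma info_diff:
  assumes fin: "finite (set_pmf L)" and pos: "\<And>z. z \<in> set_pmf L \<Longrightarrow> 0 < a z" "\<And>z. z \<in> set_pmf L \<Longrightarrow> 0 < b z"
  shows "info (\<lambda>z. a z / b z) = info a - info b"
proof -
  have "info (\<lambda>z. a z / b z) = measure_pmf.expectation L (\<lambda>z. log 2 (a z) - log 2 (b z))"
    by (intro integral_cong_AE AE_pmfI) (simp_all add: log_divide pos less_imp_neq[OF pos(1), symmetric] less_imp_neq[OF pos(2), symmetric])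
  also have "\<dots> = info a - info b"
    by (intro Bochner_Integration.integral_diff integrable_measure_pmf_finite fin)
  finally show ?thesis .
qed

lemma info5_nonneg:
  assumes fin: "finite (set_pmf L)"
  shows "0 \<le> info r5"
proof -
  have "info (\<lambda>z. 1 / r5 z) \<le> 0"
  proof (rule gibbs[OF fin])
    show "(\<integral>\<^sup>+z. ennreal (1 / r5 z) \<partial>L) \<le> 1"
      by (rule expected_ratio_le[where g="\<lambda>v x y t. pmf (PTV v) t"]) (simp_all add: r5_eq nn_integral_pmf)
  qed (use r_pos in simp)
  moreover have "info (\<lambda>z. 1 / r5 z) = info (\<lambda>z. 1) - info r5"
    using r_pos by (intro info_diff fin) auto
  ultimately show ?thesis by simp
qed

text \<open>The competing law is that of T given (v, y2), so the inequality is the nonnegativity of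
  I(T;Y1|U,Y2,Q).\<close>

lemma info3_le_info5:
  assumes fin: "finite (set_pmf L)"
  shows "info r3 \<le> info r5"
proof -
  have "info (\<lambda>z. r3 z / r5 z) \<le> 0"
  proof (rule gibbs[OF fin])
    show "(\<integral>\<^sup>+z. ennreal (r3 z / r5 z) \<partial>L) \<le> 1"
    proof (rule expected_ratio_le[where g="\<lambda>v x y t. pmf (J3 v) (t, snd y) / pmf (map_pmf snd (J3 v)) (snd y)"])
      fix z assume z: "z \<in> set_pmf L"
      show "r3 z / r5 z = pmf (J3 (lv z)) (lt z, snd (ly z)) / pmf (map_pmf snd (J3 (lv z))) (snd (ly z)) /
         pmf (PT (lv z) (fst (ly z))) (lt z)"
        using pmf_letter_pos[OF z] by (simp add: r5_eq[OF z] r3_def dens_def fst_J snd_J)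
    next
      fix v x y
      show "(\<integral>\<^sup>+t. ennreal (pmf (J3 v) (t, snd y) / pmf (map_pmf snd (J3 v)) (snd y)) \<partial>count_space UNIV) \<le> 1"
        for y :: "'y1 \<times> 'y2"
        by (rule nn_integral_pmf_divide_marginal) (auto simp: inj_def)
    qed simp
  qed (use r_pos in simp)
  moreover have "info (\<lambda>z. r3 z / r5 z) = info r3 - info r5"
    using r_pos by (intro info_diff fin) auto
  ultimately show ?thesis by simp
qed

text \<open>
  Both gaps compare a description with no description: replacing \<open>T\<close> by a constant costs Receiver 2
  at most the rate saved by not sending it.
\<close>

lemma info4_gap:
  assumes fin: "finite (set_pmf L)"
  shows "info r4 - info r6 \<le> info r5 - info r3"
proof -
  have "info (\<lambda>z. (r4 z / r6 z) / (r5 z / r3 z)) \<le> 0"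
  proof (rule gibbs[OF fin])
    let ?m = "\<lambda>v. map_pmf (\<lambda>w. (fst w, snd (snd w))) (J4 v)"
    show "(\<integral>\<^sup>+z. ennreal ((r4 z / r6 z) / (r5 z / r3 z)) \<partial>L) \<le> 1"
    \<comment> \<open>\<open>r4 / r6\<close> is the law of T given (v, x, y2) over its law given (v,
      y2). The latter also divides \<open>PT\<close> in \<open>r5 / r3\<close> and cancels, so the
      competitor of \<open>PT\<close> is the law given (v, x, y2).\<close>
    proof (rule expected_ratio_le[where g="\<lambda>v x y t. pmf (J4 v) (x, (t, snd y)) / pmf (?m v) (x, snd y)"])
      fix z assume z: "z \<in> set_pmf L"
      show "(r4 z / r6 z) / (r5 z / r3 z) = pmf (J4 (lv z)) (lx z, (lt z, snd (ly z))) / pmf (?m (lv z)) (lx z, snd (ly z)) /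
         pmf (PT (lv z) (fst (ly z))) (lt z)"
        unfolding r5_over_r3[OF z] snd_J(3)
        using pmf_letter_pos[OF z] by (simp add: r4_def r6_def dens_def fst_J fst_J6 snd_J)
    next
      fix v x
      show "(\<integral>\<^sup>+t. ennreal (pmf (J4 v) (x, (t, snd y)) / pmf (?m v) (x, snd y)) \<partial>count_space UNIV) \<le> 1"
        for y :: "'y1 \<times> 'y2"
        by (rule nn_integral_pmf_divide_marginal) (auto simp: inj_def)
    qed simp
  qed (use r_pos r6_pos in simp)
  moreover have "info (\<lambda>z. (r4 z / r6 z) / (r5 z / r3 z)) = (info r4 - info r6) - (info r5 - info r3)"
    using r_pos r6_pos by (subst info_diff[OF fin]; simp add: info_diff[OF fin])
  ultimately show ?thesis by simp
qed

end

text \<open>The probability of an observed value depends only on the level set through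
  \<open>z\<close>, so tuples may be reordered and coordinates repeated.\<close>

lemma pmf_map_eq_cong:
  assumes "\<And>z'. z' \<in> set_pmf p \<Longrightarrow> f z' = f z \<longleftrightarrow> g z' = g z"
  shows "pmf (map_pmf f p) (f z) = pmf (map_pmf g p) (g z)"
proof -
  have "measure p (f -` {f z}) = measure p (g -` {g z})"
    using assms by (intro measure_pmf.finite_measure_eq_AE) (auto simp: AE_measure_pmf_iff)
  then show ?thesis by (simp add: pmf.rep_eq)
qed

lemma dens_map_prod:
  assumes "inj f" "inj g"
  shows "dens (map_pmf (map_prod f g) J) (f a, g b) = dens J (a, b)"
proof -
  have "map_pmf fst (map_pmf (map_prod f g) J) = map_pmf f (map_pmf fst J)"
    "map_pmf snd (map_pmf (map_prod f g) J) = map_pmf g (map_pmf snd J)"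
    by (simp_all add: pmf.map_comp o_def)
  moreover have "inj (map_prod f g)" using assms by (rule prod.inj_map)
  ultimately show ?thesis
    using assms pmf_map_inj'[of "map_prod f g" J "(a, b)"] by (simp add: dens_def pmf_map_inj')
qed

lemma dens_const:
  assumes "b \<in> set_pmf P"
  shows "dens (map_pmf (Pair a) P) (a, b) = 1"
proof -
  have "map_pmf fst (map_pmf (Pair a) P) = return_pmf a" "map_pmf snd (map_pmf (Pair a) P) = P"
    by (simp_all add: pmf.map_comp o_def pmf.map_ident map_pmf_const)
  moreover have "pmf (map_pmf (Pair a) P) (a, b) = pmf P b" by (rule pmf_map_inj') (simp add: inj_def)
  moreover have "pmf P b > 0" using assms by (rule pmf_positive)
  ultimately show ?thesis by (simp add: dens_def)
qed

section \<open>Letter ratios as quotients of marginals, and erasure of the description\<close>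

context letters
begin

text \<open>As functions of a letter, such probabilities form the four-term quotients that appear in
  \<open>cond_mutual_info_eq\<close>.\<close>

definition marg :: "(('q, 'v, 'x, 'y1, 'y2, 't) letter \<Rightarrow> 'z) \<Rightarrow> ('q, 'v, 'x, 'y1, 'y2, 't) letter \<Rightarrow> real"
  where "marg f z = pmf (map_pmf f L) (f z)"

lemma L_given_q: "map_pmf (\<lambda>z. (lq z, (lv z, ly z))) L = PQ \<bind> (\<lambda>q. map_pmf (Pair q) (JV q))"
  unfolding L_def JV_def l_defs
  by (simp add: map_pmf_def bind_assoc_pmf bind_return_pmf)

lemma L_given_v: "map_pmf (\<lambda>z. (lv z, (lx z, ly z, lt z))) L = PQ \<bind> PV \<bind> (\<lambda>v. map_pmf (Pair v) (JT v))"
  unfolding L_def JT_def l_defs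
  by (simp add: map_pmf_def bind_assoc_pmf bind_return_pmf)

lemma marg_q:
  "marg (\<lambda>z. (lq z, g (lv z, ly z))) z = pmf PQ (lq z) * pmf (map_pmf g (JV (lq z))) (g (lv z, ly z))"
proof -
  have "map_pmf (\<lambda>z. (lq z, g (lv z, ly z))) L = map_pmf (\<lambda>(q, w). (q, g w)) (map_pmf (\<lambda>z. (lq z, (lv z, ly z))) L)"
    by (simp add: pmf.map_comp o_def)
  also have "\<dots> = PQ \<bind> (\<lambda>q. map_pmf (Pair q) (map_pmf g (JV q)))"
    unfolding L_given_q by (simp add: map_bind_pmf pmf.map_comp o_def)
  finally show ?thesis by (simp add: marg_def pmf_bind_map_Pair)
qed

lemma marg_v:
  "marg (\<lambda>z. (lv z, g (lx z, ly z, lt z))) z = pmf (PQ \<bind> PV) (lv z) * pmf (map_pmf g (JT (lv z))) (g (lx z, ly z, lt z))"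
proof -
  have "map_pmf (\<lambda>z. (lv z, g (lx z, ly z, lt z))) L = map_pmf (\<lambda>(q, w). (q, g w)) (map_pmf (\<lambda>z. (lv z, (lx z, ly z, lt z))) L)"
    by (simp add: pmf.map_comp o_def)
  also have "\<dots> = PQ \<bind> PV \<bind> (\<lambda>v. map_pmf (Pair v) (map_pmf g (JT v)))"
    unfolding L_given_v by (simp add: map_bind_pmf pmf.map_comp o_def)
  finally show ?thesis by (simp add: marg_def pmf_bind_map_Pair)
qed

lemma marg_unit: "marg f z = marg (\<lambda>z. (f z, ())) z"
  unfolding marg_def by (rule pmf_map_eq_cong) simp

text \<open>All four probabilities carry the factor \<open>pmf PQ (lq z)\<close>, which cancels two
  against two. The later versions given \<open>lv\<close> work in the same way.\<close>

lemma r1_eq_marg: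
  assumes "z \<in> set_pmf L"
  shows "marg (\<lambda>z. (lq z, (lv z, fst (ly z)))) z * marg lq z / (marg (\<lambda>z. (lq z, lv z)) z * marg (\<lambda>z. (lq z, fst (ly z))) z) = r1 z"
proof -
  have "marg lq z = pmf PQ (lq z)"
    using marg_q[of "\<lambda>_. ()" z] by (simp add: marg_unit[of lq] map_pmf_const)
  moreover have "marg (\<lambda>z. (lq z, (lv z, fst (ly z)))) z = pmf PQ (lq z) * pmf (J1 (lq z)) (lv z, fst (ly z))"
    using marg_q[of "\<lambda>(v, y). (v, fst y)" z] by (simp add: J1_def)
  moreover have "marg (\<lambda>z. (lq z, lv z)) z = pmf PQ (lq z) * pmf (map_pmf fst (J1 (lq z))) (lv z)"
    using marg_q[of "\<lambda>(v, y). v" z] by (simp add: J1_def pmf.map_comp o_def case_prod_unfold)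
  moreover have "marg (\<lambda>z. (lq z, fst (ly z))) z = pmf PQ (lq z) * pmf (map_pmf snd (J1 (lq z))) (fst (ly z))"
    using marg_q[of "\<lambda>(v, y). fst y" z] by (simp add: J1_def pmf.map_comp o_def case_prod_unfold)
  moreover have "pmf PQ (lq z) > 0" using assms by (intro pmf_positive) (simp add: set_L)
  ultimately show ?thesis by (simp add: r1_def dens_def)
qed

lemma r2_eq_marg:
  assumes "z \<in> set_pmf L"
  shows "marg (\<lambda>z. (lq z, (lv z, snd (ly z)))) z * marg lq z / (marg (\<lambda>z. (lq z, lv z)) z * marg (\<lambda>z. (lq z, snd (ly z))) z) = r2 z"
proof -
  have "marg lq z = pmf PQ (lq z)"
    using marg_q[of "\<lambda>_. ()" z] by (simp add: marg_unit[of lq] map_pmf_const)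
  moreover have "marg (\<lambda>z. (lq z, (lv z, snd (ly z)))) z = pmf PQ (lq z) * pmf (J2 (lq z)) (lv z, snd (ly z))"
    using marg_q[of "\<lambda>(v, y). (v, snd y)" z] by (simp add: J2_def)
  moreover have "marg (\<lambda>z. (lq z, lv z)) z = pmf PQ (lq z) * pmf (map_pmf fst (J2 (lq z))) (lv z)"
    using marg_q[of "\<lambda>(v, y). v" z] by (simp add: J2_def pmf.map_comp o_def case_prod_unfold)
  moreover have "marg (\<lambda>z. (lq z, snd (ly z))) z = pmf PQ (lq z) * pmf (map_pmf snd (J2 (lq z))) (snd (ly z))"
    using marg_q[of "\<lambda>(v, y). snd y" z] by (simp add: J2_def pmf.map_comp o_def case_prod_unfold)
  moreover have "pmf PQ (lq z) > 0" using assms by (intro pmf_positive) (simp add: set_L)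
  ultimately show ?thesis by (simp add: r2_def dens_def)
qed

lemma pmf_lv_pos: "z \<in> set_pmf L \<Longrightarrow> 0 < pmf (PQ \<bind> PV) (lv z)"
  by (intro pmf_positive) (auto simp: set_L)

lemma r4_eq_marg:
  assumes "z \<in> set_pmf L"
  shows "marg (\<lambda>z. (lv z, (lx z, (lt z, snd (ly z))))) z * marg lv z / (marg (\<lambda>z. (lv z, lx z)) z * marg (\<lambda>z. (lv z, (lt z, snd (ly z)))) z) = r4 z"
proof -
  let ?P = "pmf (PQ \<bind> PV) (lv z)"
  have "marg lv z = ?P"
    using marg_v[of "\<lambda>_. ()" z] by (simp add: marg_unit[of lv] map_pmf_const)
  moreover have "marg (\<lambda>z. (lv z, (lx z, (lt z, snd (ly z))))) z = ?P * pmf (J4 (lv z)) (lx z, (lt z, snd (ly z)))"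
    using marg_v[of "\<lambda>(x, y, t). (x, (t, snd y))" z] by (simp add: J4_def)
  moreover have "marg (\<lambda>z. (lv z, lx z)) z = ?P * pmf (map_pmf fst (J4 (lv z))) (lx z)"
    using marg_v[of "\<lambda>(x, y, t). x" z] by (simp add: J4_def pmf.map_comp o_def case_prod_unfold)
  moreover have "marg (\<lambda>z. (lv z, (lt z, snd (ly z)))) z = ?P * pmf (map_pmf snd (J4 (lv z))) (lt z, snd (ly z))"
    using marg_v[of "\<lambda>(x, y, t). (t, snd y)" z] by (simp add: J4_def pmf.map_comp o_def case_prod_unfold)
  ultimately show ?thesis using pmf_lv_pos[OF assms] by (simp add: r4_def dens_def)
qed

text \<open>Here the Markov property enters: given v and both outputs, T is drawn by
  \<open>PT\<close> from the first output alone. This turns the conditional information given (U,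
  Y2, Q) into a difference.\<close>

lemma r5_r3_eq_marg:
  assumes z: "z \<in> set_pmf L"
  shows "marg (\<lambda>z. (lv z, (lt z, ly z))) z * marg (\<lambda>z. (lv z, snd (ly z))) z /
     (marg (\<lambda>z. (lv z, (lt z, snd (ly z)))) z * marg (\<lambda>z. (lv z, ly z)) z) = r5 z / r3 z"
proof -
  let ?P = "pmf (PQ \<bind> PV) (lv z)"
  let ?Y = "map_pmf (\<lambda>(x, y, t). y) (JT (lv z))"
  have "map_pmf (\<lambda>(x, y, t). (y, t)) (JT (lv z)) = ?Y \<bind> (\<lambda>y. map_pmf (Pair y) (PT (lv z) (fst y)))"
    unfolding JT_def
    by (simp add: map_bind_pmf map_pmf_def bind_assoc_pmf bind_return_pmf)
  then have "pmf (map_pmf (\<lambda>(x, y, t). (y, t)) (JT (lv z))) (ly z, lt z) = pmf ?Y (ly z) * pmf (PT (lv z) (fst (ly z))) (lt z)"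
    by (simp add: pmf_bind_map_Pair)
  moreover have "marg (\<lambda>z. (lv z, (lt z, ly z))) z = marg (\<lambda>z. (lv z, (ly z, lt z))) z"
    unfolding marg_def by (rule pmf_map_eq_cong) auto
  ultimately have "marg (\<lambda>z. (lv z, (lt z, ly z))) z = ?P * (pmf ?Y (ly z) * pmf (PT (lv z) (fst (ly z))) (lt z))"
    using marg_v[of "\<lambda>(x, y, t). (y, t)" z] by simp
  moreover have "marg (\<lambda>z. (lv z, snd (ly z))) z = ?P * pmf (map_pmf snd (J6 (lv z))) (snd (ly z))"
    using marg_v[of "\<lambda>(x, y, t). snd y" z] by (simp add: J6_def pmf.map_comp o_def case_prod_unfold)
  moreover have "marg (\<lambda>z. (lv z, (lt z, snd (ly z)))) z = ?P * pmf (J3 (lv z)) (lt z, snd (ly z))"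
    using marg_v[of "\<lambda>(x, y, t). (t, snd y)" z] by (simp add: J3_def)
  moreover have "marg (\<lambda>z. (lv z, ly z)) z = ?P * pmf ?Y (ly z)"
    using marg_v[of "\<lambda>(x, y, t). y" z] by simp
  moreover have "pmf ?Y (ly z) > 0" by (intro pmf_positive) (auto intro!: rev_image_eqI[OF set_JT[OF z]])
  ultimately show ?thesis unfolding r5_over_r3[OF z] using pmf_lv_pos[OF z] by simp
qed

text \<open>
  Erasing \<open>T\<close> with probability \<open>e\<close>, by a time-sharing bit known to all, creates slack in the bounds on
  the description rate; \<open>e = 1\<close> removes the feedback altogether.
\<close>

definition eQ :: "real \<Rightarrow> (bool \<times> 'q) pmf" where "eQ e = pair_pmf (bernoulli_pmf e) PQ"
definition eV :: "bool \<times> 'q \<Rightarrow> (bool \<times> 'v) pmf" where "eV q = map_pmf (Pair (fst q)) (PV (snd q))"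
definition eX :: "bool \<times> 'v \<Rightarrow> 'x pmf" where "eX v = PX (snd v)"
definition eT :: "'t \<Rightarrow> bool \<times> 'v \<Rightarrow> 'y1 \<Rightarrow> 't pmf" where
  "eT t0 v y = (if fst v then return_pmf t0 else PT (snd v) y)"

text \<open>The bit is copied into \<open>v\<close>, so the description kernel sees it. Erasing
  leaves \<open>r1\<close> and \<open>r2\<close> unchanged, makes \<open>r3\<close> and
  \<open>r5\<close> constantly 1 and turns \<open>r4\<close> into \<open>r6\<close>; hence every
  information quantity is affine in \<open>e\<close>.\<close>

lemma achievable_erased:
  assumes fin: "finite (set_pmf L)" and e: "0 \<le> e" "e \<le> 1" and "\<delta> > 0" and R: "0 \<le> R1" "0 \<le> R2" "0 \<le> RFB"
    and \<rho>: "R1 = 0 \<or> R1 < \<rho>" "\<rho> \<le> info r1 - 2 * \<delta>"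
    and \<sigma>: "R2 = 0 \<or> R2 < \<sigma>" "\<sigma> \<le> (1 - e) * info r4 + e * info r6 - 2 * \<delta>"
    and cov: "(0 < \<kappa> \<and> \<kappa> < RFB \<and> (1 - e) * (info r5 - info r3) + 4 * \<delta> \<le> \<kappa> \<and> \<rho> + \<kappa> \<le> info r2 - 2 * \<delta> \<and>
        \<kappa> \<le> info r2 - 2 * \<delta>) \<or> (e = 1 \<and> \<rho> \<le> info r2 - 2 * \<delta>)"
  shows "achievable W RFB (R1, R2)"
proof -
  \<comment> \<open>Any value can stand for an erased description, because the time-sharing bit
    reveals the erasure.\<close>
  fix t0 :: 't
  interpret E: letters "eQ e" eV eX W "eT t0" .
  define \<iota> where "\<iota> b z = (((((b, lq z), (b, lv z)), lx z), ly z), if b then t0 else lt z)" for b z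
  have \<iota>: "E.lq (\<iota> b z) = (b, lq z)" "E.lv (\<iota> b z) = (b, lv z)" "E.lx (\<iota> b z) = lx z" "E.ly (\<iota> b z) = ly z"
    "E.lt (\<iota> b z) = (if b then t0 else lt z)" for b z
    by (simp_all add: E.l_defs \<iota>_def)
  have EL: "E.L = bernoulli_pmf e \<bind> (\<lambda>b. map_pmf (\<iota> b) L)"
  proof -
    have "E.L = bernoulli_pmf e \<bind> (\<lambda>b. PQ \<bind> (\<lambda>q. PV q \<bind> (\<lambda>v. PX v \<bind> (\<lambda>x. W x \<bind> (\<lambda>y.
        eT t0 (b, v) (fst y) \<bind> (\<lambda>t. return_pmf (((((b, q), (b, v)), x), y), t)))))))"
      unfolding E.L_def by (simp add: eQ_def eV_def eX_def pair_pmf_def map_pmf_def bind_assoc_pmf bind_return_pmf)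
    also have "\<dots> = bernoulli_pmf e \<bind> (\<lambda>b. map_pmf (\<iota> b) L)"
    proof (rule bind_pmf_cong[OF refl])
      fix b
      show "PQ \<bind> (\<lambda>q. PV q \<bind> (\<lambda>v. PX v \<bind> (\<lambda>x. W x \<bind> (\<lambda>y.
        eT t0 (b, v) (fst y) \<bind> (\<lambda>t. return_pmf (((((b, q), (b, v)), x), y), t)))))) = map_pmf (\<iota> b) L"
        by (cases b) (simp_all add: L_def eT_def \<iota>_def l_defs map_pmf_def bind_assoc_pmf bind_return_pmf)
    qed
    finally show ?thesis .
  qed
  have finE: "finite (set_pmf E.L)" unfolding EL using fin by auto
  have ex: "measure_pmf.expectation E.L F =
    (1 - e) * measure_pmf.expectation L (\<lambda>z. F (\<iota> False z)) + e * measure_pmf.expectation L (\<lambda>z. F (\<iota> True z))" for F :: "_ \<Rightarrow> real"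
    unfolding EL using fin e
    by (subst pmf_expectation_bind[of UNIV]) (auto simp: UNIV_bool)
  have EJT: "E.JT (b, v) = (if b then map_pmf (\<lambda>(x, y, t). (x, y, t0)) (JT v) else JT v)" for b v
    by (simp add: E.JT_def JT_def eX_def eT_def map_pmf_def bind_assoc_pmf bind_return_pmf)
  have EJV: "E.JV (b, q) = map_pmf (\<lambda>(v, y). ((b, v), y)) (JV q)" for b q
    by (simp add: E.JV_def JV_def eX_def eV_def map_pmf_def bind_assoc_pmf bind_return_pmf)
  have EJ1: "E.J1 (b, q) = map_pmf (map_prod (Pair b) id) (J1 q)" for b q
    by (simp add: E.J1_def J1_def EJV pmf.map_comp o_def case_prod_unfold)
  have EJ2: "E.J2 (b, q) = map_pmf (map_prod (Pair b) id) (J2 q)" for b q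
    by (simp add: E.J2_def J2_def EJV pmf.map_comp o_def case_prod_unfold)
  have inj: "inj (Pair b)" for b :: 'b1 by (simp add: inj_def)
  have r1: "E.r1 (\<iota> b z) = r1 z" for b z
    using dens_map_prod[of "Pair b" id "J1 (lq z)" "lv z" "fst (ly z)"] by (simp add: E.r1_def r1_def \<iota> EJ1 inj)
  have r2: "E.r2 (\<iota> b z) = r2 z" for b z
    using dens_map_prod[of "Pair b" id "J2 (lq z)" "lv z" "snd (ly z)"] by (simp add: E.r2_def r2_def \<iota> EJ2 inj)
  have F: "E.r3 (\<iota> False z) = r3 z" "E.r4 (\<iota> False z) = r4 z" "E.r5 (\<iota> False z) = r5 z" for z
    by (simp_all add: E.r_defs r_defs \<iota> E.J3_def J3_def E.J4_def J4_def E.J5_def J5_def EJT)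
  have T3: "E.r3 (\<iota> True z) = 1" if z: "z \<in> set_pmf L" for z
  proof -
    have J: "E.J3 (True, lv z) = map_pmf (Pair t0) (map_pmf (\<lambda>(x, y, t). snd y) (JT (lv z)))"
      by (simp add: E.J3_def EJT pmf.map_comp o_def case_prod_unfold)
    have "snd (ly z) \<in> set_pmf (map_pmf (\<lambda>(x, y, t). snd y) (JT (lv z)))"
      by (auto intro!: rev_image_eqI[OF set_JT[OF z]])
    from dens_const[OF this, of t0] show ?thesis by (simp add: E.r3_def \<iota> J del: set_map_pmf)
  qed
  have T5: "E.r5 (\<iota> True z) = 1" if z: "z \<in> set_pmf L" for z
  proof -
    have J: "E.J5 (True, lv z) = map_pmf (Pair t0) (map_pmf (\<lambda>(x, y, t). fst y) (JT (lv z)))"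
      by (simp add: E.J5_def EJT pmf.map_comp o_def case_prod_unfold)
    have "fst (ly z) \<in> set_pmf (map_pmf (\<lambda>(x, y, t). fst y) (JT (lv z)))"
      by (auto intro!: rev_image_eqI[OF set_JT[OF z]])
    from dens_const[OF this, of t0] show ?thesis by (simp add: E.r5_def \<iota> J del: set_map_pmf)
  qed
  have T4: "E.r4 (\<iota> True z) = r6 z" for z
  proof -
    have "E.J4 (True, lv z) = map_pmf (map_prod id (Pair t0)) (J6 (lv z))"
      by (simp add: E.J4_def J6_def EJT pmf.map_comp o_def case_prod_unfold)
    then show ?thesis using dens_map_prod[of id "Pair t0" "J6 (lv z)" "lx z" "snd (ly z)"]
      by (simp add: E.r4_def r6_def \<iota> inj)
  qed
  have zero: "measure_pmf.expectation L (\<lambda>z. log 2 (g z)) = 0" if "\<And>z. z \<in> set_pmf L \<Longrightarrow> g z = 1" for g :: "_ \<Rightarrow> real"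
    using that by (subst integral_measure_pmf[OF fin]) auto
  have i1: "E.info E.r1 = info r1" and i2: "E.info E.r2 = info r2"
    by (simp_all add: ex r1 r2 algebra_simps)
  have i3: "E.info E.r3 = (1 - e) * info r3" and i5: "E.info E.r5 = (1 - e) * info r5"
    using zero[OF T3] zero[OF T5] by (simp_all add: ex F)
  have i4: "E.info E.r4 = (1 - e) * info r4 + e * info r6"
    by (simp add: ex F T4)
  show ?thesis
  proof (rule E.achievable_rates[OF finE \<open>\<delta> > 0\<close> R])
    show "R1 = 0 \<or> R1 < \<rho>" "R2 = 0 \<or> R2 < \<sigma>" by fact+
    show "\<rho> \<le> E.info E.r1 - 2 * \<delta>" "\<sigma> \<le> E.info E.r4 - 2 * \<delta>" using \<rho> \<sigma> by (simp_all add: i1 i4)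
    show "(0 < \<kappa> \<and> \<kappa> < RFB \<and> E.info E.r5 - E.info E.r3 + 4 * \<delta> \<le> \<kappa> \<and> \<rho> + \<kappa> \<le> E.info E.r2 - 2 * \<delta> \<and>
        \<kappa> \<le> E.info E.r2 - 2 * \<delta> \<and> 0 \<le> E.info E.r5) \<or>
      (\<rho> \<le> E.info E.r2 - 2 * \<delta> \<and> (\<forall>z\<in>set_pmf E.L. E.r5 z \<le> 1))"
      using cov
    proof
      assume "0 < \<kappa> \<and> \<kappa> < RFB \<and> (1 - e) * (info r5 - info r3) + 4 * \<delta> \<le> \<kappa> \<and> \<rho> + \<kappa> \<le> info r2 - 2 * \<delta> \<and>
        \<kappa> \<le> info r2 - 2 * \<delta>"
      then show ?thesis using E.info5_nonneg[OF finE] unfolding i2 i3 i5 by (simp add: right_diff_distrib)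
    next
      assume 1: "e = 1 \<and> \<rho> \<le> info r2 - 2 * \<delta>"
      have "set_pmf (bernoulli_pmf 1) = {True}" by (auto simp: set_pmf_iff) (metis (full_types) pmf_bernoulli_False diff_self zero_le_one order_refl)
      then have "set_pmf E.L = \<iota> True ` set_pmf L" using 1 arg_cong[OF EL, of set_pmf] by simp
      then have "\<forall>z\<in>set_pmf E.L. E.r5 z \<le> 1" using T5 by auto
      moreover have "\<rho> \<le> E.info E.r2 - 2 * \<delta>" unfolding i2 using 1 by blast
      ultimately show ?thesis by blast
    qed
  qed
qed

end

section \<open>Mutual informations as mean log ratios\<close>

lemma distributed_pmf:
  "distributed (measure_pmf p) (count_space UNIV) X (\<lambda>x. ennreal (pmf (map_pmf X p) x))"
  unfolding distributed_def
  by (simp add: map_pmf_rep_eq[symmetric] measure_pmf_eq_density[symmetric])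

lemma mutual_information_pmf:
  fixes X :: "'o \<Rightarrow> 'a::countable" and Y :: "'o \<Rightarrow> 'b::countable"
  shows "prob_space.mutual_information (measure_pmf p) 2 (count_space UNIV) (count_space UNIV) X Y =
    measure_pmf.expectation p (\<lambda>\<omega>. log 2 (dens (map_pmf (\<lambda>\<omega>. (X \<omega>, Y \<omega>)) p) (X \<omega>, Y \<omega>)))"
proof -
  interpret information_space "measure_pmf p" 2
    by (intro information_space.intro measure_pmf.prob_space_axioms information_space_axioms.intro) simp
  let ?J = "map_pmf (\<lambda>\<omega>. (X \<omega>, Y \<omega>)) p"
  have cs: "count_space UNIV \<Otimes>\<^sub>M count_space UNIV = (count_space UNIV :: ('a \<times> 'b) measure)"
    by (simp add: pair_measure_countable)
  have m: "map_pmf fst ?J = map_pmf X p" "map_pmf snd ?J = map_pmf Y p"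
    by (simp_all add: pmf.map_comp o_def)
  have "prob_space.mutual_information (measure_pmf p) (2::real) (count_space UNIV) (count_space UNIV) X Y =
    (\<integral>w. pmf ?J w * log 2 (pmf ?J w / (pmf (map_pmf X p) (fst w) * pmf (map_pmf Y p) (snd w))) \<partial>(count_space UNIV \<Otimes>\<^sub>M count_space UNIV))"
  proof (rule mutual_information_distr[where Pxy="pmf ?J" and Px="pmf (map_pmf X p)" and Py="pmf (map_pmf Y p)"])
    show "sigma_finite_measure (count_space UNIV :: 'a measure)" "sigma_finite_measure (count_space UNIV :: 'b measure)"
      by (rule sigma_finite_measure_count_space)+
    show "distributed (measure_pmf p) (count_space UNIV \<Otimes>\<^sub>M count_space UNIV) (\<lambda>\<omega>. (X \<omega>, Y \<omega>)) (\<lambda>x. ennreal (pmf ?J x))"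
      unfolding cs by (rule distributed_pmf)
  qed (auto intro: distributed_pmf)
  also have "\<dots> = (\<integral>w. pmf ?J w * log 2 (dens ?J w) \<partial>count_space UNIV)"
    unfolding cs dens_def m ..
  also have "\<dots> = (\<integral>w. log 2 (dens ?J w) \<partial>measure_pmf ?J)"
    unfolding measure_pmf_eq_density[of ?J] by (subst integral_density) (auto simp: measure_pmf_eq_density[symmetric])
  also have "\<dots> = measure_pmf.expectation p (\<lambda>\<omega>. log 2 (dens ?J (X \<omega>, Y \<omega>)))" by simp
  finally show ?thesis .
qed

text \<open>By definition I(X;Y|Z) is I(X;(Y,Z)) - I(X;Z). In the quotient of the two densities the
  marginal of \<open>X\<close> cancels.\<close>

lemma cond_mutual_info_eq:
  fixes X :: "'o \<Rightarrow> 'a::countable" and Y :: "'o \<Rightarrow> 'b::countable" and Z :: "'o \<Rightarrow> 'c::countable"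
  assumes fin: "finite (set_pmf p)"
  shows "cond_mutual_info p X Y Z = measure_pmf.expectation p (\<lambda>\<omega>. log 2
    (pmf (map_pmf (\<lambda>\<omega>. (X \<omega>, Y \<omega>, Z \<omega>)) p) (X \<omega>, Y \<omega>, Z \<omega>) * pmf (map_pmf Z p) (Z \<omega>) /
     (pmf (map_pmf (\<lambda>\<omega>. (X \<omega>, Z \<omega>)) p) (X \<omega>, Z \<omega>) * pmf (map_pmf (\<lambda>\<omega>. (Y \<omega>, Z \<omega>)) p) (Y \<omega>, Z \<omega>))))"
    (is "_ = measure_pmf.expectation p (\<lambda>\<omega>. log 2 (?r \<omega>))")
proof -
  have cs: "count_space UNIV \<Otimes>\<^sub>M count_space UNIV = (count_space UNIV :: ('b \<times> 'c) measure)"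
    by (simp add: pair_measure_countable)
  let ?d1 = "\<lambda>\<omega>. dens (map_pmf (\<lambda>\<omega>. (X \<omega>, (Y \<omega>, Z \<omega>))) p) (X \<omega>, (Y \<omega>, Z \<omega>))"
  let ?d2 = "\<lambda>\<omega>. dens (map_pmf (\<lambda>\<omega>. (X \<omega>, Z \<omega>)) p) (X \<omega>, Z \<omega>)"
  have "cond_mutual_info p X Y Z = measure_pmf.expectation p (\<lambda>\<omega>. log 2 (?d1 \<omega>)) - measure_pmf.expectation p (\<lambda>\<omega>. log 2 (?d2 \<omega>))"
    unfolding cond_mutual_info_def prob_space.conditional_mutual_information_def[OF measure_pmf.prob_space_axioms] cs mutual_information_pmf ..
  also have "\<dots> = measure_pmf.expectation p (\<lambda>\<omega>. log 2 (?d1 \<omega>) - log 2 (?d2 \<omega>))"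
    by (rule Bochner_Integration.integral_diff[symmetric]) (intro integrable_measure_pmf_finite fin)+
  also have "\<dots> = measure_pmf.expectation p (\<lambda>\<omega>. log 2
    (?r \<omega>))"
  proof (intro integral_cong_AE AE_pmfI)
    fix \<omega> assume \<omega>: "\<omega> \<in> set_pmf p"
    have d: "0 < ?d1 \<omega>" "0 < ?d2 \<omega>" using \<omega> by (auto intro!: dens_pos)
    have px: "0 < pmf (map_pmf X p) (X \<omega>)" using \<omega> by (intro pmf_positive) auto
    have "?d1 \<omega> / ?d2 \<omega> = ?r \<omega>"
      using px by (simp add: dens_def pmf.map_comp o_def)
    moreover have "log 2 (?d1 \<omega>) - log 2 (?d2 \<omega>) = log 2 (?d1 \<omega> / ?d2 \<omega>)"
      using d by (simp add: log_divide)
    ultimately show "log 2 (?d1 \<omega>) - log 2 (?d2 \<omega>) = log 2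
      (?r \<omega>)"
      by simp
  qed auto
  finally show ?thesis .
qed

section \<open>Approaching the boundary of the region\<close>

context letters
begin

lemma achievable_near:
  assumes fin: "finite (set_pmf L)" and R: "0 \<le> R1" "0 \<le> R2" "0 \<le> RFB"
    and le: "R1 \<le> info r1" "R1 \<le> info r2 - (info r5 - info r3)" "R2 \<le> info r4" "info r5 - info r3 \<le> RFB"
    and "\<eta> > 0"
  shows "achievable W RFB (max 0 (R1 - \<eta>), max 0 (R2 - \<eta>))"
proof -
  define Ik where "Ik = info r5 - info r3"
  have "0 \<le> Ik" using info3_le_info5[OF fin] by (simp add: Ik_def)
  then consider "Ik = 0" | "Ik > 0" by linarith
  then show ?thesis
  proof cases
    case 1
    show ?thesis
    \<comment> \<open>If the description rate is 0, then \<open>info4_gap\<close> gives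
      \<open>info r4 \<le> info r6\<close>, so erasing T completely costs nothing.\<close>
    proof (rule achievable_erased[OF fin, where e=1 and \<delta>="\<eta> / 4" and \<rho>="R1 - \<eta> / 2" and \<sigma>="R2 - \<eta> / 2"])
      show "R2 - \<eta> / 2 \<le> (1 - 1) * info r4 + 1 * info r6 - 2 * (\<eta> / 4)"
        using info4_gap[OF fin] le 1 by (simp add: Ik_def)
    qed (use R le \<open>\<eta> > 0\<close> 1 in \<open>auto simp: Ik_def max_def\<close>)
  next
    case 2
    \<comment> \<open>The absolute value plus 1 keeps the divisor in \<open>e\<close> positive.
      Erasing the fraction \<open>e\<close> then costs at most \<open>\<eta> / 4\<close> in the
      bound on \<open>R2\<close>.\<close>
    define c where "c = \<bar>info r4 - info r6\<bar> + 1"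
    define e where "e = min (1 / 2) (\<eta> / (4 * c))"
    \<comment> \<open>Erasure frees \<open>e * Ik\<close>. With \<delta> at most an eighth of it,
      the six multiples of \<delta> in the conditions on \<kappa> fit, and \<kappa> stays below
      \<open>Ik\<close>, hence below \<open>RFB\<close>. The bound \<open>\<eta> / 8\<close> makes
      \<open>2 * \<delta>\<close> fit into the remaining \<open>\<eta> / 4\<close>.\<close>
    define \<delta> where "\<delta> = min (\<eta> / 8) (e * Ik / 8)"
    have c: "0 < c" "info r4 - info r6 \<le> c" by (auto simp: c_def)
    then have e: "0 < e" "e < 1" using \<open>\<eta> > 0\<close> by (auto simp: e_def)
    have "e * (info r4 - info r6) \<le> e * c" using e c by (intro mult_left_mono) auto
    also have "\<dots> \<le> \<eta> / (4 * c) * c"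
      using c by (intro mult_right_mono) (auto simp: e_def)
    also have "\<dots> = \<eta> / 4" using c by simp
    finally have e4: "e * (info r4 - info r6) \<le> \<eta> / 4" .
    have eI: "0 < e * Ik" using e 2 by simp
    have \<delta>: "0 < \<delta>" "\<delta> \<le> \<eta> / 8" "\<delta> \<le> e * Ik / 8" using eI \<open>\<eta> > 0\<close> by (auto simp: \<delta>_def)
    have Ie: "(1 - e) * Ik = Ik - e * Ik" by (simp add: left_diff_distrib)
    have pos: "0 < (1 - e) * Ik" using e 2 by simp
    show ?thesis
    proof (rule achievable_erased[OF fin, where e=e and \<delta>=\<delta> and \<rho>="R1 - \<eta> / 2" and \<sigma>="R2 - \<eta> / 2"
        and \<kappa>="(1 - e) * Ik + 4 * \<delta>"])
      show "R2 - \<eta> / 2 \<le> (1 - e) * info r4 + e * info r6 - 2 * \<delta>"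
        using le e4 \<delta> by (simp add: algebra_simps)
      show "R1 - \<eta> / 2 \<le> info r1 - 2 * \<delta>" using le \<delta> by linarith
      show "(0 < (1 - e) * Ik + 4 * \<delta> \<and> (1 - e) * Ik + 4 * \<delta> < RFB \<and>
        (1 - e) * (info r5 - info r3) + 4 * \<delta> \<le> (1 - e) * Ik + 4 * \<delta> \<and>
        R1 - \<eta> / 2 + ((1 - e) * Ik + 4 * \<delta>) \<le> info r2 - 2 * \<delta> \<and>
        (1 - e) * Ik + 4 * \<delta> \<le> info r2 - 2 * \<delta>) \<or> (e = 1 \<and> R1 - \<eta> / 2 \<le> info r2 - 2 * \<delta>)"
        unfolding Ik_def[symmetric]
        using le(2,4) \<delta> pos eI R \<open>\<eta> > 0\<close> unfolding Ik_def[symmetric] Ie by linarith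
    qed (use R e \<delta> \<open>\<eta> > 0\<close> in \<open>auto simp: max_def\<close>)
  qed
qed

lemma in_capacity_region:
  fixes R1 R2 RFB :: real
  assumes "finite (set_pmf L)" "0 \<le> R1" "0 \<le> R2" "0 \<le> RFB"
    and "R1 \<le> info r1" "R1 \<le> info r2 - (info r5 - info r3)" "R2 \<le> info r4" "info r5 - info r3 \<le> RFB"
  shows "(R1, R2) \<in> closure {R. achievable W RFB R}"
  unfolding closure_approachable
proof (intro allI impI)
  fix d :: real assume d: "d > 0"
  let ?y = "(max 0 (R1 - d / 3), max 0 (R2 - d / 3))"
  have "achievable W RFB ?y" using assms d by (intro achievable_near) auto
  moreover have "dist ?y (R1, R2) < d"
  proof -
    have "dist ?y (R1, R2) \<le> dist (max 0 (R1 - d / 3)) R1 + dist (max 0 (R2 - d / 3)) R2"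
      unfolding dist_Pair_Pair using sqrt_sum_squares_le_sum_abs[of "dist (max 0 (R1 - d / 3)) R1" "dist (max 0 (R2 - d / 3)) R2"] by simp
    also have "\<dots> \<le> d / 3 + d / 3" using assms d by (auto simp: dist_real_def max_def)
    finally show ?thesis using d by simp
  qed
  ultimately show "\<exists>y\<in>{R. achievable W RFB R}. dist y (R1, R2) < d" by blast
qed

end

theorem theorem1:
  fixes W :: "('x::finite, 'y1::finite, 'y2::finite) dmbc" and RFB :: real
  assumes "less_noisy W" and "RFB \<ge> 0"
  shows "inner_region W RFB \<subseteq> fb_capacity_region W RFB"
proof
  fix R assume "R \<in> inner_region W RFB"
  then obtain R1 R2 where R: "R = (R1, R2)" and in_region: "(R1, R2) \<in> inner_region W RFB"
    by (cases R) auto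
  then have nonneg: "0 \<le> R1" "0 \<le> R2" unfolding inner_region_def by blast+
  from in_region obtain PQ PU PX PT where *: "let p = aux_joint W PQ PU PX PT;
               Q = (\<lambda>(q, u, x, y1, y2, t). q);
               U = (\<lambda>(q, u, x, y1, y2, t). u);
               X = (\<lambda>(q, u, x, y1, y2, t). x);
               Y1 = (\<lambda>(q, u, x, y1, y2, t). y1);
               Y2 = (\<lambda>(q, u, x, y1, y2, t). y2);
               T = (\<lambda>(q, u, x, y1, y2, t). t);
               UQ = (\<lambda>\<omega>. (U \<omega>, Q \<omega>));
               TY2 = (\<lambda>\<omega>. (T \<omega>, Y2 \<omega>));
               UY2Q = (\<lambda>\<omega>. (U \<omega>, Y2 \<omega>, Q \<omega>))
           in finite (set_pmf p) \<and>
              R1 \<le> cond_mutual_info p U Y1 Q \<and>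
              R1 \<le> cond_mutual_info p U Y2 Q - cond_mutual_info p T Y1 UY2Q \<and>
              R2 \<le> cond_mutual_info p X TY2 UQ \<and>
              cond_mutual_info p T Y1 UY2Q \<le> RFB"
    unfolding inner_region_def by blast
  define p where "p = aux_joint W PQ PU PX PT"
  define Q where "Q = (\<lambda>(q::nat, u::nat, x::'x, y1::'y1, y2::'y2, t::nat). q)"
  define U where "U = (\<lambda>(q::nat, u::nat, x::'x, y1::'y1, y2::'y2, t::nat). u)"
  define X where "X = (\<lambda>(q::nat, u::nat, x::'x, y1::'y1, y2::'y2, t::nat). x)"
  define Y1 where "Y1 = (\<lambda>(q::nat, u::nat, x::'x, y1::'y1, y2::'y2, t::nat). y1)"
  define Y2 where "Y2 = (\<lambda>(q::nat, u::nat, x::'x, y1::'y1, y2::'y2, t::nat). y2)"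
  define T where "T = (\<lambda>(q::nat, u::nat, x::'x, y1::'y1, y2::'y2, t::nat). t)"
  note defs = Q_def U_def X_def Y1_def Y2_def T_def
  have fin: "finite (set_pmf p)" and
    rates: "R1 \<le> cond_mutual_info p U Y1 Q"
      "R1 \<le> cond_mutual_info p U Y2 Q - cond_mutual_info p T Y1 (\<lambda>\<omega>. (U \<omega>, Y2 \<omega>, Q \<omega>))"
      "R2 \<le> cond_mutual_info p X (\<lambda>\<omega>. (T \<omega>, Y2 \<omega>)) (\<lambda>\<omega>. (U \<omega>, Q \<omega>))"
      "cond_mutual_info p T Y1 (\<lambda>\<omega>. (U \<omega>, Y2 \<omega>, Q \<omega>)) \<le> RFB"
    using * by (simp_all only: Let_def p_def defs)
  \<comment> \<open>Taking \<open>v\<close> to be the pair (q, u) makes the input and description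
    kernels functions of \<open>v\<close> alone.\<close>
  interpret S: letters PQ "\<lambda>q. map_pmf (Pair q) (PU q)" "\<lambda>(q, u). PX u q" W "\<lambda>(q, u) y. PT u y q" .
  define \<psi> where "\<psi> \<omega> = ((((Q \<omega>, (Q \<omega>, U \<omega>)), X \<omega>), (Y1 \<omega>, Y2 \<omega>)), T \<omega>)" for \<omega>
  have \<psi>: "S.lq (\<psi> \<omega>) = Q \<omega>" "S.lv (\<psi> \<omega>) = (Q \<omega>, U \<omega>)" "S.lx (\<psi> \<omega>) = X \<omega>" "S.ly (\<psi> \<omega>) = (Y1 \<omega>, Y2 \<omega>)"
    "S.lt (\<psi> \<omega>) = T \<omega>" for \<omega>
    by (simp_all add: S.l_defs \<psi>_def)
  have L: "S.L = map_pmf \<psi> p"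
    unfolding S.L_def p_def aux_joint_def
    by (simp add: \<psi>_def defs map_pmf_def bind_assoc_pmf bind_return_pmf case_prod_unfold)
  have finL: "finite (set_pmf S.L)" unfolding L using fin by simp
  have in_L: "\<psi> \<omega> \<in> set_pmf S.L" if "\<omega> \<in> set_pmf p" for \<omega> using that by (simp add: L)
  \<comment> \<open>The letter repeats q and orders the variables differently from \<open>p\<close>;
    only equality of level sets has to be checked.\<close>
  have marginal: "S.marg f (\<psi> \<omega>) = pmf (map_pmf g p) (g \<omega>)" if "\<And>\<omega>'. f (\<psi> \<omega>') = f (\<psi> \<omega>) \<longleftrightarrow> g \<omega>' = g \<omega>"
    for f :: "_ \<Rightarrow> 'a" and g :: "_ \<Rightarrow> 'b" and \<omega>
  proof -
    have "S.marg f (\<psi> \<omega>) = pmf (map_pmf (\<lambda>\<omega>. f (\<psi> \<omega>)) p) (f (\<psi> \<omega>))"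
      by (simp add: S.marg_def L pmf.map_comp o_def)
    also have "\<dots> = pmf (map_pmf g p) (g \<omega>)" by (rule pmf_map_eq_cong) (rule that)
    finally show ?thesis .
  qed
  have info: "cond_mutual_info p A B C = S.info r"
    if "\<And>\<omega>. \<omega> \<in> set_pmf p \<Longrightarrow> S.marg f1 (\<psi> \<omega>) * S.marg f2 (\<psi> \<omega>) / (S.marg f3 (\<psi> \<omega>) * S.marg f4 (\<psi> \<omega>)) = r (\<psi> \<omega>)"
      "\<And>\<omega> \<omega>'. f1 (\<psi> \<omega>') = f1 (\<psi> \<omega>) \<longleftrightarrow> (A \<omega>', B \<omega>', C \<omega>') = (A \<omega>, B \<omega>, C \<omega>)"
      "\<And>\<omega> \<omega>'. f2 (\<psi> \<omega>') = f2 (\<psi> \<omega>) \<longleftrightarrow> C \<omega>' = C \<omega>"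
      "\<And>\<omega> \<omega>'. f3 (\<psi> \<omega>') = f3 (\<psi> \<omega>) \<longleftrightarrow> (A \<omega>', C \<omega>') = (A \<omega>, C \<omega>)"
      "\<And>\<omega> \<omega>'. f4 (\<psi> \<omega>') = f4 (\<psi> \<omega>) \<longleftrightarrow> (B \<omega>', C \<omega>') = (B \<omega>, C \<omega>)"
    for A :: "_ \<Rightarrow> 'a::countable" and B :: "_ \<Rightarrow> 'b::countable" and C :: "_ \<Rightarrow> 'c::countable"
      and f1 :: "_ \<Rightarrow> 'd" and f2 :: "_ \<Rightarrow> 'e" and f3 :: "_ \<Rightarrow> 'f" and f4 :: "_ \<Rightarrow> 'g" and r
  proof -
    have "cond_mutual_info p A B C = measure_pmf.expectation p (\<lambda>\<omega>. log 2 (r (\<psi> \<omega>)))"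
      unfolding cond_mutual_info_eq[OF fin]
    proof (intro integral_cong_AE AE_pmfI)
      fix \<omega> assume "\<omega> \<in> set_pmf p"
      have "S.marg f1 (\<psi> \<omega>) = pmf (map_pmf (\<lambda>\<omega>. (A \<omega>, B \<omega>, C \<omega>)) p) (A \<omega>, B \<omega>, C \<omega>)"
        by (rule marginal, rule that(2))
      moreover have "S.marg f2 (\<psi> \<omega>) = pmf (map_pmf C p) (C \<omega>)" by (rule marginal, rule that(3))
      moreover have "S.marg f3 (\<psi> \<omega>) = pmf (map_pmf (\<lambda>\<omega>. (A \<omega>, C \<omega>)) p) (A \<omega>, C \<omega>)"
        by (rule marginal, rule that(4))
      moreover have "S.marg f4 (\<psi> \<omega>) = pmf (map_pmf (\<lambda>\<omega>. (B \<omega>, C \<omega>)) p) (B \<omega>, C \<omega>)"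
        by (rule marginal, rule that(5))
      ultimately show "log 2 (pmf (map_pmf (\<lambda>\<omega>. (A \<omega>, B \<omega>, C \<omega>)) p) (A \<omega>, B \<omega>, C \<omega>) * pmf (map_pmf C p) (C \<omega>) /
          (pmf (map_pmf (\<lambda>\<omega>. (A \<omega>, C \<omega>)) p) (A \<omega>, C \<omega>) * pmf (map_pmf (\<lambda>\<omega>. (B \<omega>, C \<omega>)) p) (B \<omega>, C \<omega>))) = log 2 (r (\<psi> \<omega>))"
        using that(1)[OF \<open>\<omega> \<in> set_pmf p\<close>] by simp
    qed auto
    then show ?thesis by (simp add: L)
  qed
  have I1: "cond_mutual_info p U Y1 Q = S.info S.r1"
    by (rule info[OF S.r1_eq_marg[OF in_L]]) (auto simp: \<psi>)
  have I2: "cond_mutual_info p U Y2 Q = S.info S.r2"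
    by (rule info[OF S.r2_eq_marg[OF in_L]]) (auto simp: \<psi>)
  have I4: "cond_mutual_info p X (\<lambda>\<omega>. (T \<omega>, Y2 \<omega>)) (\<lambda>\<omega>. (U \<omega>, Q \<omega>)) = S.info S.r4"
    by (rule info[OF S.r4_eq_marg[OF in_L]]) (auto simp: \<psi>)
  have "cond_mutual_info p T Y1 (\<lambda>\<omega>. (U \<omega>, Y2 \<omega>, Q \<omega>)) = S.info (\<lambda>z. S.r5 z / S.r3 z)"
    by (rule info[OF S.r5_r3_eq_marg[OF in_L]]) (auto simp: \<psi>)
  also have "\<dots> = S.info S.r5 - S.info S.r3"
    by (rule S.info_diff[OF finL S.r_pos(5) S.r_pos(3)])
  finally have Ik: "cond_mutual_info p T Y1 (\<lambda>\<omega>. (U \<omega>, Y2 \<omega>, Q \<omega>)) = S.info S.r5 - S.info S.r3" .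
  show "R \<in> fb_capacity_region W RFB"
    unfolding fb_capacity_region_def R
    using rates unfolding I1 I2 I4 Ik by (intro S.in_capacity_region finL nonneg assms(2))
qed

end
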